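(* Let $\mathfrak g=\mathfrak{so}_n$ with $n\ge7$. For any $k\ge2$, $$S_k=\varpi(\Phi_{2k})[-1]+\sum_{1\le r<k}R(k,r)\,\varpi\bigl(\tau^{2r}\Phi_{2k-2r}[-1]\bigr)\cdot1$$ is a Segal--Sugawara vector, i.e. $S_k\in\mathfrak z(\widehat{\mathfrak g})$, if $$R(k,r)=\frac{2^r}{(2r)!}\prod_{u=1}^r\left(\binom n2+2n(k-u)+(k-u)(2k-2u-1)\right).$$
   Context: $\mathfrak{so}_n\subset\mathfrak{gl}_n$ is the linear span of $F_{ij}=E_{ij}-E_{j'i'}$, $i,j\in\{1,\dots,n\}$, $i'=n-i+1$. The invariants $\Phi_{2k}\in\mathcal S^{2k}(\mathfrak g)^{\mathfrak g}$ are defined by $\det(I_n-q(F_{ij}))^{-1}=1+\Phi_2q^2+\Phi_4q^4+\dots+\Phi_{2k}q^{2k}+\cdots$, the determinant being computed over the commutative algebra $\mathcal S(\mathfrak g)$. Put $\widehat{\mathfrak g}^-=t^{-1}\mathfrak g[t^{-1}]$, $x[a]=xt^a$. $\varpi$ is the symmetrisation map $\varpi(y_1\cdots y_m)=\frac1{m!}\sum_{\sigma\in S_m}y_{\sigma(1)}\cdots y_{\sigma(m)}$ from $\mathcal S(\widehat{\mathfrak g}^-)$ to $\mathcal U(\widehat{\mathfrak g}^-)$. For $F\in\mathcal S(\mathfrak g)$, $F[-1]\in\mathcal S(\mathfrak gt^{-1})$ is its image under $x\mapsto x[-1]$, and $\varpi(F)[-1]:=\varpi(F[-1])$. The Feigin--Frenkel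 centre $\mathfrak z(\widehat{\mathfrak g})\subset\mathcal U(\widehat{\mathfrak g}^-)$ is the centre of the universal affine vertex algebra at the critical level (the space of $\mathfrak g[t]$-invariant vectors in the vacuum module at the critical level, identified as a vector space with $\mathcal U(\widehat{\mathfrak g}^-)$). By a theorem of Rybnikov it equals the centraliser in $\mathcal U(\widehat{\mathfrak g}^-)$ of $\mathcal H[-1]=\sum_i x_i[-1]x_i[-1]$, where $\{x_i\}$ is an orthonormal basis of $\mathfrak g$ for a non-degenerate $\mathfrak g$-invariant scalar product. Notation $\varpi(\tau^rF[-1])\cdot1$: let $\tau=-\partial_t$, so that $\tau x[a]-x[a]\tau=-a\,x[a-1]$ in the algebra generated by $\mathcal U(\widehat{\mathfrak g}^-)$ and $\tau$. For $F=y_1\cdots y_m$, $\varpi(\tau^rF[-1])$ is the average over all $(m+r)!$ orderings of the product of the $m+r$ factors $\tau,\dots,\tau$ ($r$ times), $y_1[-1],\dots,y_m[-1]$; $\varpi(\tau^rF[-1])\cdot1\in\mathcal U(\widehat{\mathfrak g}^-)$ is obtained by moving all $\tau$'s to the right and setting $\tau\cdot1=0$. Extend to all $F$ by linearity. *)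

theory Defs
  imports
    "HOL-Library.Poly_Mapping"
    "HOL-Computational_Algebra.Formal_Power_Series"
    "HOL-Algebra.QuotRing"
    "HOL-Combinatorics.Permutations"
    "Jordan_Normal_Form.Determinant"
    "Jordan_Normal_Form.VS_Connect"
begin

section \<open>Symmetric and tensor algebras on a set of letters\<close>

text \<open>Monoid algebras over the complex numbers.  Multisets are the commutative monomials;
  words are wrapped in a datatype of their own because lists carry no monoid instance.\<close>

datatype 'a fword = Word (letters: "'a list")

instantiation fword :: (type) monoid_add
begin
definition zero_fword :: "'a fword" where "0 = Word []"
definition plus_fword :: "'a fword \<Rightarrow> 'a fword \<Rightarrow> 'a fword" where
  "v + w = Word (letters v @ letters w)"
instance by standard (simp_all add: zero_fword_def plus_fword_def)
end

type_synonym 'a symalg = "'a multiset \<Rightarrow>\<^sub>0 complex"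
type_synonym 'a tenalg = "'a fword \<Rightarrow>\<^sub>0 complex"

definition var :: "'a \<Rightarrow> 'a symalg" where
  "var x = Poly_Mapping.single {#x#} 1"

definition letter :: "'a \<Rightarrow> 'a tenalg" where
  "letter x = Poly_Mapping.single (Word [x]) 1"

definition scal :: "complex \<Rightarrow> ('m::monoid_add \<Rightarrow>\<^sub>0 complex) \<Rightarrow> ('m \<Rightarrow>\<^sub>0 complex)" where
  "scal c p = Poly_Mapping.single 0 c * p"

text \<open>The linear map that sends each monomial \<open>m\<close> to \<open>h m\<close>.\<close>

definition lin_ext :: "('m \<Rightarrow> ('w::monoid_add \<Rightarrow>\<^sub>0 complex)) \<Rightarrow> ('m \<Rightarrow>\<^sub>0 complex) \<Rightarrow> ('w \<Rightarrow>\<^sub>0 complex)" where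
  "lin_ext h p = (\<Sum>m\<in>Poly_Mapping.keys p. scal (Poly_Mapping.lookup p m) (h m))"

definition rename :: "('a \<Rightarrow> 'b) \<Rightarrow> 'a symalg \<Rightarrow> 'b symalg" where
  "rename f = lin_ext (\<lambda>M. Poly_Mapping.single (image_mset f M) 1)"

text \<open>The symmetrisation map.  The average over all orderings does not depend on the chosen
  enumeration \<open>ys\<close> of the monomial.\<close>

definition symm_list :: "'a list \<Rightarrow> 'a tenalg" where
  "symm_list ys = scal (1 / fact (length ys))
     (\<Sum>\<sigma> | \<sigma> permutes {..<length ys}.
        Poly_Mapping.single (Word (map (\<lambda>i. ys ! \<sigma> i) [0..<length ys])) 1)"

definition symmetrise :: "'a symalg \<Rightarrow> 'a tenalg" where
  "symmetrise = lin_ext (\<lambda>M. symm_list (SOME ys. mset ys = M))"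

text \<open>The tensor algebra on the letters in \<open>X\<close>, as a ring in the sense of HOL-Algebra.\<close>

definition tensor_ring :: "'a set \<Rightarrow> 'a tenalg ring" where
  "tensor_ring X =
     \<lparr>carrier = {p. \<forall>w \<in> Poly_Mapping.keys p. set (letters w) \<subseteq> X},
      mult = (*), one = 1, zero = 0, add = (+)\<rparr>"

lemma ring_tensor_ring: "ring (tensor_ring X)"
proof -
  define C where "C = {p :: 'a tenalg. \<forall>w \<in> Poly_Mapping.keys p. set (letters w) \<subseteq> X}"
  have C: "p \<in> C \<longleftrightarrow> (\<forall>w \<in> Poly_Mapping.keys p. set (letters w) \<subseteq> X)" for p
    by (simp add: C_def)
  have mult: "p * q \<in> C" if "p \<in> C" "q \<in> C" for p q
    unfolding C
  proof
    fix w assume "w \<in> Poly_Mapping.keys (p * q)"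
    then obtain u v where "w = u + v" "u \<in> Poly_Mapping.keys p" "v \<in> Poly_Mapping.keys q"
      using keys_mult[of p q] by blast
    with that show "set (letters w) \<subseteq> X"
      unfolding C by (simp add: plus_fword_def)
  qed
  have add: "p + q \<in> C" if "p \<in> C" "q \<in> C" for p q
    using that Poly_Mapping.keys_add[of p q] unfolding C by blast
  have zero: "0 \<in> C" and one: "1 \<in> C"
    unfolding C by (simp_all add: zero_fword_def)
  have neg: "- p \<in> C" if "p \<in> C" for p
    using that unfolding C by simp
  have R: "tensor_ring X = \<lparr>carrier = C, mult = (*), one = 1, zero = 0, add = (+)\<rparr>"
    by (simp add: tensor_ring_def C_def)
  show ?thesis
    unfolding R
  proof (rule ringI)
    show "abelian_group \<lparr>carrier = C, mult = (*), one = 1, zero = 0, add = (+)\<rparr>"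
    proof (rule abelian_groupI, goal_cases)
      case (6 x)
      then show ?case
        using neg[of x] by (auto intro!: bexI[of _ "- x"])
    qed (simp_all add: add zero add.assoc add.commute)
    show "Group.monoid \<lparr>carrier = C, mult = (*), one = 1, zero = 0, add = (+)\<rparr>"
      by (rule monoidI) (simp_all add: mult one mult.assoc)
  qed (simp_all add: distrib_left distrib_right)
qed

definition left_ideal_gen :: "('a, 'b) ring_scheme \<Rightarrow> 'a set \<Rightarrow> 'a set" where
  "left_ideal_gen R S = \<Inter>{J. additive_subgroup J R \<and>
     (\<forall>a\<in>carrier R. \<forall>x\<in>J. a \<otimes>\<^bsub>R\<^esub> x \<in> J) \<and> S \<subseteq> J}"


section \<open>The orthogonal Lie algebra and its affinisation\<close>

text \<open>Row and column indices run from \<open>0\<close> to \<open>n - 1\<close>, so that \<open>i'\<close> is \<open>n - 1 - i\<close>.\<close>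

definition Emat :: "nat \<Rightarrow> nat \<Rightarrow> nat \<Rightarrow> complex mat" where
  "Emat n i j = mat n n (\<lambda>(k, l). if k = i \<and> l = j then 1 else 0)"

definition Fmat :: "nat \<Rightarrow> nat \<Rightarrow> nat \<Rightarrow> complex mat" where
  "Fmat n i j = Emat n i j - Emat n (n - 1 - j) (n - 1 - i)"

definition so :: "nat \<Rightarrow> complex mat set" where
  "so n = LinearCombinations.module.span class_ring (module_mat TYPE(complex) n n)
            {Fmat n i j | i j. i < n \<and> j < n}"

definition lie :: "complex mat \<Rightarrow> complex mat \<Rightarrow> complex mat" where
  "lie x y = x * y - y * x"

text \<open>The invariant form \<open>tr(xy)/2\<close> gives long roots squared length \<open>2\<close> for \<open>n \<ge> 5\<close>;
  with this normalisation the dual Coxeter number is \<open>n - 2\<close>, and the critical level is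
  \<open>-(n - 2)\<close> (equivalently, minus one half of the Killing form \<open>(n - 2) tr(xy)\<close>).\<close>

definition form :: "complex mat \<Rightarrow> complex mat \<Rightarrow> complex" where
  "form x y = (\<Sum>i<dim_row x. (x * y) $$ (i, i)) / 2"

definition dual_coxeter :: "nat \<Rightarrow> complex" where
  "dual_coxeter n = of_nat n - 2"

text \<open>\<open>Cur x a\<close> stands for \<open>x[a] = x t^a\<close> and \<open>Cent\<close> for the central element \<open>K\<close>.\<close>

datatype aff = Cur "complex mat" int | Cent

definition cur_letters :: "nat \<Rightarrow> int set \<Rightarrow> aff set" where
  "cur_letters n D = {Cur x a | x a. x \<in> so n \<and> a \<in> D}"

text \<open>Linearity of \<open>x \<mapsto> x[a]\<close> and
  \<open>[x[a], y[b]] = [x,y][a+b] + a \<delta>\<^bsub>a,-b\<^esub> (x,y) K\<close>, for degrees \<open>a\<close>, \<open>b\<close> in \<open>D\<close>.\<close>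

definition cur_rels :: "nat \<Rightarrow> int set \<Rightarrow> aff tenalg set" where
  "cur_rels n D =
     {letter (Cur (x + y) a) - letter (Cur x a) - letter (Cur y a) | x y a.
        x \<in> so n \<and> y \<in> so n \<and> a \<in> D} \<union>
     {letter (Cur (c \<cdot>\<^sub>m x) a) - scal c (letter (Cur x a)) | c x a.
        x \<in> so n \<and> a \<in> D} \<union>
     {letter (Cur x a) * letter (Cur y b) - letter (Cur y b) * letter (Cur x a)
        - letter (Cur (lie x y) (a + b))
        - (if a + b = 0 then scal (of_int a * form x y) (letter Cent) else 0) | x y a b.
        x \<in> so n \<and> y \<in> so n \<and> a \<in> D \<and> b \<in> D}"

definition aff_ring :: "nat \<Rightarrow> aff tenalg ring" where
  "aff_ring n = tensor_ring (insert Cent (cur_letters n UNIV))"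

definition aff_rels :: "nat \<Rightarrow> aff tenalg set" where
  "aff_rels n = cur_rels n UNIV \<union>
     {letter Cent * letter (Cur x a) - letter (Cur x a) * letter Cent | x a. x \<in> so n}"

text \<open>The universal enveloping algebra of \<open>t\<^sup>-\<^sup>1 so\<^sub>n[t\<^sup>-\<^sup>1]\<close> as a quotient of the tensor algebra
  (the central term of the bracket cannot occur for negative degrees).\<close>

definition neg_ring :: "nat \<Rightarrow> aff tenalg ring" where
  "neg_ring n = tensor_ring (cur_letters n {..<0})"

definition neg_ideal :: "nat \<Rightarrow> aff tenalg set" where
  "neg_ideal n = Idl\<^bsub>neg_ring n\<^esub> (cur_rels n {..<0})"

definition U_neg :: "nat \<Rightarrow> aff tenalg set ring" where
  "U_neg n = neg_ring n Quot neg_ideal n"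

definition U_class :: "nat \<Rightarrow> aff tenalg \<Rightarrow> aff tenalg set" where
  "U_class n u = neg_ideal n +>\<^bsub>neg_ring n\<^esub> u"


section \<open>The Feigin--Frenkel centre\<close>

text \<open>The vacuum module at the critical level is the quotient of the enveloping algebra of the
  affine algebra by the left ideal generated by \<open>so\<^sub>n[t]\<close> and \<open>K + h\<close>, with \<open>h\<close> the dual Coxeter
  number.  Pulled back to the tensor algebra, that left ideal is \<open>vac_ideal\<close>; an element \<open>u\<close> of
  the tensor algebra represents the vector \<open>u |0>\<close>, which is zero iff \<open>u\<close> lies in it.\<close>

definition vac_ideal :: "nat \<Rightarrow> aff tenalg set" where
  "vac_ideal n = left_ideal_gen (aff_ring n)
     (Idl\<^bsub>aff_ring n\<^esub> (aff_rels n) \<union>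
      letter ` cur_letters n {0..} \<union>
      {letter Cent + scal (dual_coxeter n) 1})"

text \<open>The elements \<open>S\<close> of the enveloping algebra of the negative part for which \<open>S |0>\<close> is
  annihilated by all \<open>x[a]\<close> with \<open>a \<ge> 0\<close>.  The condition does not depend on the representative
  \<open>u\<close>, since the relations defining \<open>U_neg\<close> also hold in the affine algebra.\<close>

definition FF_centre :: "nat \<Rightarrow> aff tenalg set set" where
  "FF_centre n = {S \<in> carrier (U_neg n). \<exists>u\<in>S.
     \<forall>x\<in>so n. \<forall>a\<ge>0. letter (Cur x a) * u \<in> vac_ideal n}"


section \<open>The invariants and their symmetrisations\<close>

text \<open>The symmetric algebra of \<open>so\<^sub>n\<close> is the polynomial ring in the basis elements
  \<open>F\<^sub>i\<^sub>j\<close> with \<open>i < j'\<close> (recall \<open>F\<^sub>i\<^sub>j = -F\<^sub>j\<^sub>'\<^sub>i\<^sub>'\<close>).  The coordinate of \<open>x\<close> at such an \<open>F\<^sub>i\<^sub>j\<close> is the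
  matrix entry \<open>x\<^sub>i\<^sub>j\<close>.\<close>

definition so_to_sym :: "nat \<Rightarrow> complex mat \<Rightarrow> complex mat symalg" where
  "so_to_sym n x =
     (\<Sum>(i, j) | i < n \<and> j < n \<and> i < n - 1 - j. scal (x $$ (i, j)) (var (Fmat n i j)))"

definition \<Phi> :: "nat \<Rightarrow> nat \<Rightarrow> complex mat symalg" where
  "\<Phi> n m = fps_nth (fps_right_inverse
     (det (1\<^sub>m n - fps_X \<cdot>\<^sub>m mat n n (\<lambda>(i, j). fps_const (so_to_sym n (Fmat n i j))))) 1) m"

text \<open>\<open>F \<mapsto> F[-1]\<close>.\<close>

definition at_minus_one :: "complex mat symalg \<Rightarrow> aff symalg" where
  "at_minus_one = rename (\<lambda>x. Cur x (-1))"

text \<open>The derivation \<open>u \<mapsto> \<tau>u - u\<tau>\<close>, with \<open>x[a] \<mapsto> -a x[a-1]\<close>.\<close>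

primrec tau_letter :: "aff \<Rightarrow> aff tenalg" where
  "tau_letter (Cur x a) = scal (- of_int a) (letter (Cur x (a - 1)))"
| "tau_letter Cent = 0"

primrec tau_word :: "aff list \<Rightarrow> aff tenalg" where
  "tau_word [] = 0"
| "tau_word (g # gs) = tau_letter g * Poly_Mapping.single (Word gs) 1 + letter g * tau_word gs"

definition tau_der :: "aff tenalg \<Rightarrow> aff tenalg" where
  "tau_der = lin_ext (\<lambda>w. tau_word (letters w))"

text \<open>Words in \<open>\<tau>\<close> (the letter \<open>None\<close>) and the \<open>x[a]\<close>, applied to \<open>1\<close>.  Moving \<open>\<tau>\<close> to the right
  past \<open>u\<close> gives \<open>\<tau>u = tau_der u + u\<tau>\<close>, and \<open>u\<tau>\<cdot>1 = 0\<close>.\<close>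

primrec word_on_one :: "aff option list \<Rightarrow> aff tenalg" where
  "word_on_one [] = 1"
| "word_on_one (g # gs) = (case g of
      None \<Rightarrow> tau_der (word_on_one gs)
    | Some y \<Rightarrow> letter y * word_on_one gs)"

definition on_one :: "aff option tenalg \<Rightarrow> aff tenalg" where
  "on_one = lin_ext (\<lambda>w. word_on_one (letters w))"

text \<open>A representative in the tensor algebra of \<open>\<varpi>(\<tau>\<^sup>r F[-1])\<cdot>1\<close>.\<close>

definition symm_tau :: "nat \<Rightarrow> complex mat symalg \<Rightarrow> aff tenalg" where
  "symm_tau r F = on_one (symmetrise (var None ^ r * rename Some (at_minus_one F)))"

end

theory Submission
  imports Defs
begin

text \<open>Let \<open>E\<close> be the Gaussian functional on polynomials in \<open>u, v\<close> with \<open>E (u\<^sup>a v\<^sup>b) = \<delta>\<^sub>a\<^sub>b a!\<close>.  By MacMahon's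
  master theorem \<open>det (1 - q F)\<close> has inverse \<open>E (exp (q v\<cdot>F u))\<close>, so \<open>\<Phi>\<^sub>m = E (Y\<^sup>m) / m!\<close> for the decomposable
  bivector \<open>Y = v \<and> u'\<close>.  As \<open>R k r\<close> is the binomial coefficient of \<open>n + 2 k - 2\<close> over \<open>2 r\<close>, the vector
  \<open>S\<^sub>k\<close> is \<open>E\<^sub>w (T\<^sup>2\<^sup>k\<cdot>1)\<close> up to a factor, where \<open>T = \<tau> + Y[-1]\<close> and \<open>E\<^sub>w\<close> weights the part of degree
  \<open>m\<close> by \<open>1 / (n + m - 2)!\<close>.  This weight satisfies \<open>E\<^sub>w (\<alpha>\<^sup>2 f) = E\<^sub>w f\<close>, where \<open>0, \<plusminus>\<alpha>\<close> are the eigenvalues of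
  \<open>ad Y\<close>; so \<open>E\<^sub>w\<close> is the average over the orbit of a minuscule coweight.

  Invariance under \<open>x[0]\<close> is the invariance of \<open>E\<close>.  Moving \<open>x[1]\<close> to the right gives
  \<open>x[1] T\<^sup>N\<cdot>1 = N K (x, Y) T\<^sup>N\<^sup>-\<^sup>1\<cdot>1 + \<Sum> (p + 1) T\<^sup>p b[-1] T\<^sup>q\<cdot>1\<close>, summed over \<open>p + q = N - 2\<close>, with
  \<open>b = [x, Y] + [[x, Y], Y]\<close>.  Here \<open>[T, b[-1]] = (1 - \<alpha>\<^sup>2) [x, Y][-2]\<close> averages to zero, so \<open>p + 1\<close> may be
  replaced by \<open>N / 2\<close>.  The resulting sum is the derivative of \<open>T\<^sup>N\<^sup>-\<^sup>1\<close> along the vector field \<open>Y \<mapsto> b\<close>, and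
  integration by parts turns it into \<open>2 (n - 2) (x, Y) T\<^sup>N\<^sup>-\<^sup>1\<close>, which cancels the first term exactly at the
  critical level \<open>K = -(n - 2)\<close>.\<close>

subsection \<open>Linear maps between monoid algebras\<close>

text \<open>No orbit and no measure is introduced: the average is a linear functional on
  polynomials. Therefore \<open>gauss_alpha2\<close> needs, besides the weight, that its argument
  depends on the two vectors only through their bivector; this is expressed by a derivation, the
  shear. The shape of the proof comes from mixing noncommuting letters with integration by parts in
  commuting parameters. Both live in one algebra of words with polynomial coefficients, and
  identities hold there modulo elements that die in the vacuum module under every functional on the
  coefficients. Replacing p + 1 by N / 2 works because 2 (p + 1) - N = p - q is antisymmetric, so
  the difference is a combination of commutators of T with b[-1]. The link with symmetrisation is
  that symmetrising a power of a linear form gives the power of the same sum of letters; T^(2k) then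
  expands by the commutative binomial theorem. Odd invariants vanish, and so does the term of degree
  0, since \<tau> 1 = 0; hence r stops before k. Higher modes x[a] are commutators of lower ones, as
  the Lie algebra is perfect, so x[0] and x[1] suffice.\<close>

lemma scal_add_right: "scal c (p + q) = scal c p + scal c q"
  by (simp add: scal_def distrib_left)

lemma scal_add_left: "scal (c + d) p = scal c p + scal d p"
  by (simp add: scal_def single_add distrib_right)

lemma scal_scal [simp]: "scal c (scal d p) = scal (c * d) p"
  by (simp add: scal_def mult.assoc[symmetric] mult_single)

lemma scal_one [simp]: "scal 1 p = p"
  by (simp add: scal_def)

lemma scal_zero_left [simp]: "scal 0 p = 0"
  by (simp add: scal_def)

lemma scal_zero_right [simp]: "scal c 0 = 0"
  by (simp add: scal_def)

lemma scal_minus_left: "scal (- c) p = - scal c p"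
  by (simp add: scal_def single_uminus)

lemma scal_minus_right: "scal c (- p) = - scal c p"
  by (simp add: scal_def)

lemma scal_minus_one [simp]: "scal (- 1) p = - p"
  by (simp add: scal_minus_left)

lemma scal_diff_right: "scal c (p - q) = scal c p - scal c q"
  by (simp add: scal_def right_diff_distrib)

lemma scal_diff_left: "scal (c - d) p = scal c p - scal d p"
  by (simp add: scal_def single_diff left_diff_distrib)

lemma scal_sum_right: "scal c (sum f A) = (\<Sum>x\<in>A. scal c (f x))"
  by (simp add: scal_def sum_distrib_left)

lemma lookup_scal [simp]: "Poly_Mapping.lookup (scal c p) w = c * Poly_Mapping.lookup p w"
proof -
  have "scal c p = Poly_Mapping.map ((*) c) p"
    by (simp add: scal_def mult_map_scale_conv_mult)
  then show ?thesis
    by (simp add: Poly_Mapping.map.rep_eq when_def)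
qed

lemma scal_single [simp]: "scal c (Poly_Mapping.single w d) = Poly_Mapping.single w (c * d)"
  by (simp add: scal_def mult_single)

lemma scal_mult_left [simp]: "scal c p * q = scal c (p * q)"
  by (simp add: scal_def mult.assoc)

lemma sum_single: "Poly_Mapping.single w (sum f A) = (\<Sum>x\<in>A. Poly_Mapping.single w (f x))"
  by (induction A rule: infinite_finite_induct) (simp_all add: single_add)

lemma poly_mapping_sum_single:
  "f = (\<Sum>w\<in>Poly_Mapping.keys f. Poly_Mapping.single w (Poly_Mapping.lookup f w))"
proof (rule poly_mapping_eqI)
  fix k
  show "Poly_Mapping.lookup f k = Poly_Mapping.lookup
      (\<Sum>w\<in>Poly_Mapping.keys f. Poly_Mapping.single w (Poly_Mapping.lookup f w)) k"
    by (cases "k \<in> Poly_Mapping.keys f")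
      (auto simp: lookup_sum lookup_single when_def sum.delta' in_keys_iff)
qed

lemma poly_mapping_single_induct [case_names single add]:
  assumes "\<And>w c. P (Poly_Mapping.single w c)"
    and "\<And>f g. P f \<Longrightarrow> P g \<Longrightarrow> P (f + g)"
  shows "P (f :: 'a \<Rightarrow>\<^sub>0 'b::comm_monoid_add)"
proof -
  have "P (\<Sum>w\<in>A. Poly_Mapping.single w (h w))" if "finite A" for A and h :: "'a \<Rightarrow> 'b"
    using that
  proof (induction A rule: finite_induct)
    case empty
    then show ?case using assms(1)[of undefined 0] by simp
  qed (simp add: assms)
  then show ?thesis
    by (subst poly_mapping_sum_single) simp
qed

lemma additive_eqI:
  fixes F G :: "('w \<Rightarrow>\<^sub>0 'p::ab_group_add) \<Rightarrow> 'b::ab_group_add"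
  assumes "additive F" "additive G"
    and "\<And>w c. F (Poly_Mapping.single w c) = G (Poly_Mapping.single w c)"
  shows "F p = G p"
  by (induction p rule: poly_mapping_single_induct) (simp_all add: assms additive.add)

text \<open>Words do not commute, but a constant sits at the neutral word and is therefore
  central.\<close>

lemma mult_scal_right [simp]: "p * scal c q = scal c (p * q)"
proof -
  have "p * Poly_Mapping.single 0 c = Poly_Mapping.single 0 c * p"
    by (rule additive_eqI)
      (auto simp: additive_def distrib_left distrib_right mult_single mult.commute)
  then show ?thesis
    by (metis scal_def mult.assoc)
qed

definition clinear_map :: "(('m::monoid_add \<Rightarrow>\<^sub>0 complex) \<Rightarrow> ('w::monoid_add \<Rightarrow>\<^sub>0 complex)) \<Rightarrow> bool" where
  "clinear_map F \<longleftrightarrow> additive F \<and> (\<forall>c p. F (scal c p) = scal c (F p))"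

lemma lin_ext_superset:
  assumes "finite A" "Poly_Mapping.keys p \<subseteq> A"
  shows "lin_ext h p = (\<Sum>m\<in>A. scal (Poly_Mapping.lookup p m) (h m))"
  unfolding lin_ext_def
  by (rule sum.mono_neutral_left) (use assms in \<open>auto simp: in_keys_iff\<close>)

lemma additive_lin_ext: "additive (lin_ext h)"
proof
  fix p q :: "'a \<Rightarrow>\<^sub>0 complex"
  let ?A = "Poly_Mapping.keys p \<union> Poly_Mapping.keys q"
  have "Poly_Mapping.keys (p + q) \<subseteq> ?A"
    by (rule Poly_Mapping.keys_add)
  then show "lin_ext h (p + q) = lin_ext h p + lin_ext h q"
    by (simp add: lin_ext_superset[of ?A] lookup_add scal_add_left sum.distrib)
qed

lemma lin_ext_single [simp]: "lin_ext h (Poly_Mapping.single m c) = scal c (h m)"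
  by (simp add: lin_ext_def)

lemma clinear_lin_ext: "clinear_map (lin_ext (h :: 'a::monoid_add \<Rightarrow> _))"
  unfolding clinear_map_def
proof (intro conjI allI additive_lin_ext)
  fix c and p :: "'a \<Rightarrow>\<^sub>0 complex"
  have "Poly_Mapping.keys (scal c p) \<subseteq> Poly_Mapping.keys p"
    by (auto simp: in_keys_iff)
  then show "lin_ext h (scal c p) = scal c (lin_ext h p)"
    by (simp add: lin_ext_superset[of "Poly_Mapping.keys p"] scal_sum_right)
qed

lemma clinear_map_single: "clinear_map F \<Longrightarrow> F (Poly_Mapping.single m c) = scal c (F (Poly_Mapping.single m 1))"
  unfolding clinear_map_def by (metis mult.right_neutral scal_single)

lemma clinear_map_add: "clinear_map F \<Longrightarrow> F (p + q) = F p + F q"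
  and clinear_map_scal: "clinear_map F \<Longrightarrow> F (scal c p) = scal c (F p)"
  and clinear_map_sum: "clinear_map F \<Longrightarrow> F (sum f A) = (\<Sum>x\<in>A. F (f x))"
  and clinear_map_diff: "clinear_map F \<Longrightarrow> F (p - q) = F p - F q"
  and clinear_map_uminus: "clinear_map F \<Longrightarrow> F (- p) = - F p"
  and clinear_map_zero: "clinear_map F \<Longrightarrow> F 0 = 0"
  by (simp_all add: clinear_map_def additive.add additive.sum additive.diff additive.minus additive.zero)

lemma clinear_map_eqI:
  assumes "clinear_map F" "clinear_map G"
    and "\<And>w. F (Poly_Mapping.single w 1) = G (Poly_Mapping.single w 1)"
  shows "F p = G p"
proof (induction p rule: poly_mapping_single_induct)
  case (single w c)
  then show ?case
    using clinear_map_single[OF assms(1), of w c] clinear_map_single[OF assms(2), of w c] assms(3)[of w]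
    by simp
qed (simp add: clinear_map_add[OF assms(1)] clinear_map_add[OF assms(2)])

lemma clinear_map_comp: "clinear_map F \<Longrightarrow> clinear_map G \<Longrightarrow> clinear_map (\<lambda>p. F (G p))"
  by (simp add: clinear_map_def additive_def)

lemma clinear_map_mult_left: "clinear_map (\<lambda>p. q * p)"
  by (simp add: clinear_map_def additive_def distrib_left)

subsection \<open>Coefficientwise maps\<close>

abbreviation cmap :: "('p::zero \<Rightarrow> 'q::zero) \<Rightarrow> ('w \<Rightarrow>\<^sub>0 'p) \<Rightarrow> ('w \<Rightarrow>\<^sub>0 'q)" where
  "cmap \<equiv> Poly_Mapping.map"

lemma lookup_cmap: "additive \<phi> \<Longrightarrow> Poly_Mapping.lookup (cmap \<phi> f) w = \<phi> (Poly_Mapping.lookup f w)"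
  by (simp add: Poly_Mapping.map.rep_eq when_def additive.zero)

lemma cmap_single: "additive \<phi> \<Longrightarrow> cmap \<phi> (Poly_Mapping.single w c) = Poly_Mapping.single w (\<phi> c)"
  by (rule poly_mapping_eqI) (simp add: lookup_cmap lookup_single when_def additive.zero)

lemma additive_cmap: "additive \<phi> \<Longrightarrow> additive (cmap \<phi>)"
  by (intro additive.intro poly_mapping_eqI) (simp add: lookup_cmap lookup_add additive.add)

lemma cmap_add: "additive \<phi> \<Longrightarrow> cmap \<phi> (f + g) = cmap \<phi> f + cmap \<phi> g"
  and cmap_diff: "additive \<phi> \<Longrightarrow> cmap \<phi> (f - g) = cmap \<phi> f - cmap \<phi> g"
  and cmap_sum: "additive \<phi> \<Longrightarrow> cmap \<phi> (sum h A) = (\<Sum>x\<in>A. cmap \<phi> (h x))"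
  by (simp_all add: additive.add[OF additive_cmap] additive.diff[OF additive_cmap]
      additive.sum[OF additive_cmap])

lemma additive_comp: "additive F \<Longrightarrow> additive G \<Longrightarrow> additive (\<lambda>x. F (G x))"
  by (simp add: additive_def)

lemma additive_mult_left: "additive (\<lambda>x. (c::'a::ring) * x)"
  by (simp add: additive_def distrib_left)

lemma additive_mult_right: "additive (\<lambda>x. x * (c::'a::ring))"
  by (simp add: additive_def distrib_right)

text \<open>A coefficientwise map is not multiplicative, yet a monomial can be pulled out once its
  coefficient is absorbed into the map. The later rules for letters and scalars are
  instances.\<close>

lemma cmap_single_mult:
  fixes \<phi> :: "'p::ring_1 \<Rightarrow> 'q::ring_1" and f :: "'w::monoid_add \<Rightarrow>\<^sub>0 'p"
  assumes "additive \<phi>"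
  shows "cmap \<phi> (Poly_Mapping.single w p * f) = Poly_Mapping.single w 1 * cmap (\<lambda>c. \<phi> (p * c)) f"
proof -
  have a: "additive (\<lambda>c. \<phi> (p * c))"
    by (rule additive_comp[OF assms additive_mult_left])
  show ?thesis
  proof (rule additive_eqI[where F = "\<lambda>f. cmap \<phi> (Poly_Mapping.single w p * f)"
        and G = "\<lambda>f. Poly_Mapping.single w 1 * cmap (\<lambda>c. \<phi> (p * c)) f"])
    show "additive (\<lambda>f :: 'w \<Rightarrow>\<^sub>0 'p. cmap \<phi> (Poly_Mapping.single w p * f))"
      by (rule additive_comp[OF additive_cmap[OF assms] additive_mult_left])
    show "additive (\<lambda>f :: 'w \<Rightarrow>\<^sub>0 'p. Poly_Mapping.single w 1 * cmap (\<lambda>c. \<phi> (p * c)) f)"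
      by (rule additive_comp[OF additive_mult_left additive_cmap[OF a]])
  qed (simp add: mult_single cmap_single a assms)
qed

lemma cmap_cmap: "additive \<phi> \<Longrightarrow> additive \<psi> \<Longrightarrow> cmap \<phi> (cmap \<psi> f) = cmap (\<lambda>c. \<phi> (\<psi> c)) f"
  by (rule poly_mapping_eqI) (simp add: lookup_cmap additive_comp)

subsection \<open>Matrices over a commutative ring\<close>

definition bracket :: "nat \<Rightarrow> (nat \<Rightarrow> nat \<Rightarrow> 'a::comm_ring_1) \<Rightarrow> (nat \<Rightarrow> nat \<Rightarrow> 'a) \<Rightarrow> nat \<Rightarrow> nat \<Rightarrow> 'a" where
  "bracket n Z W i j = (\<Sum>k<n. Z i k * W k j - W i k * Z k j)"

definition skew :: "nat \<Rightarrow> (nat \<Rightarrow> nat \<Rightarrow> 'a::comm_ring_1) \<Rightarrow> bool" where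
  "skew n Z \<longleftrightarrow> (\<forall>i<n. \<forall>j<n. Z i j = - Z (n - 1 - j) (n - 1 - i))"

definition mvec :: "nat \<Rightarrow> (nat \<Rightarrow> nat \<Rightarrow> 'a::comm_ring_1) \<Rightarrow> (nat \<Rightarrow> 'a) \<Rightarrow> nat \<Rightarrow> 'a" where
  "mvec n Z a i = (\<Sum>j<n. Z i j * a j)"

definition wedge :: "nat \<Rightarrow> (nat \<Rightarrow> 'a::comm_ring_1) \<Rightarrow> (nat \<Rightarrow> 'a) \<Rightarrow> nat \<Rightarrow> nat \<Rightarrow> 'a" where
  "wedge n a b i j = a i * b (n - 1 - j) - b i * a (n - 1 - j)"

definition pairing :: "nat \<Rightarrow> (nat \<Rightarrow> 'a::comm_ring_1) \<Rightarrow> (nat \<Rightarrow> 'a) \<Rightarrow> 'a" where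
  "pairing n a b = (\<Sum>j<n. a (n - 1 - j) * b j)"

lemma sum_reflect: "(\<Sum>i<n. f (n - 1 - i)) = (\<Sum>i<n. f i)" for f :: "nat \<Rightarrow> 'a::comm_monoid_add"
  using sum.nat_diff_reindex[of f n] by simp

lemma skewD: "skew n Z \<Longrightarrow> i < n \<Longrightarrow> j < n \<Longrightarrow> Z (n - 1 - j) (n - 1 - i) = - Z i j"
  unfolding skew_def by (metis minus_minus)

lemmas skewD_Suc = skewD[unfolded One_nat_def diff_Suc_eq_diff_pred[symmetric], simplified]

lemma skew_wedge: "skew n (wedge n a b)"
  unfolding skew_def wedge_def by (simp add: algebra_simps)

lemma skew_add: "skew n Z \<Longrightarrow> skew n W \<Longrightarrow> skew n (\<lambda>i j. Z i j + W i j)"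
  unfolding skew_def by (metis minus_add_distrib)

lemma skew_bracket:
  assumes "skew n Z" "skew n W"
  shows "skew n (bracket n Z W)"
  unfolding skew_def
proof (intro allI impI)
  fix i j assume ij: "i < n" "j < n"
  have "bracket n Z W (n - 1 - j) (n - 1 - i)
      = (\<Sum>k<n. Z (n - 1 - j) (n - 1 - k) * W (n - 1 - k) (n - 1 - i)
          - W (n - 1 - j) (n - 1 - k) * Z (n - 1 - k) (n - 1 - i))"
    unfolding bracket_def by (rule sum_reflect[symmetric])
  also have "\<dots> = (\<Sum>k<n. Z k j * W i k - W k j * Z i k)"
    by (rule sum.cong) (use ij in \<open>simp_all add: skewD_Suc[OF assms(1)] skewD_Suc[OF assms(2)]\<close>)
  also have "\<dots> = - bracket n Z W i j"
    unfolding bracket_def by (simp add: sum_negf[symmetric] mult.commute)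
  finally show "bracket n Z W i j = - bracket n Z W (n - 1 - j) (n - 1 - i)" by simp
qed

lemma bracket_add_right: "bracket n Z (\<lambda>i j. W i j + W' i j) i j = bracket n Z W i j + bracket n Z W' i j"
  unfolding bracket_def by (simp add: algebra_simps sum.distrib sum_subtractf)

lemma bracket_diff_right: "bracket n Z (\<lambda>i j. W i j - W' i j) i j = bracket n Z W i j - bracket n Z W' i j"
  unfolding bracket_def by (simp add: algebra_simps sum.distrib sum_subtractf)

lemma bracket_scale_right: "bracket n Z (\<lambda>i j. p * W i j) i j = p * bracket n Z W i j"
  unfolding bracket_def by (simp add: algebra_simps sum_distrib_left)

lemma bracket_anticomm: "bracket n Z W i j = - bracket n W Z i j"
  unfolding bracket_def by (simp add: sum_negf[symmetric])

lemma bracket_cong: "(\<And>i j. i < n \<Longrightarrow> j < n \<Longrightarrow> W i j = W' i j) \<Longrightarrow> i < n \<Longrightarrow> j < n \<Longrightarrow> bracket n Z W i j = bracket n Z W' i j"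
  unfolding bracket_def by (rule sum.cong) simp_all

text \<open>A skew \<open>Z\<close> acts on bivectors as a derivation: by skewness, multiplication
  by \<open>Z\<close> on the right is minus its action on the reflected factor.\<close>

lemma bracket_wedge:
  assumes "skew n Z" "i < n" "j < n"
  shows "bracket n Z (wedge n a b) i j = wedge n (mvec n Z a) b i j + wedge n a (mvec n Z b) i j"
proof -
  have *: "(\<Sum>k<n. c (n - 1 - k) * Z k j) = - mvec n Z c (n - 1 - j)" for c
  proof -
    have "(\<Sum>k<n. c (n - 1 - k) * Z k j) = (\<Sum>k<n. - (Z (n - 1 - j) (n - 1 - k) * c (n - 1 - k)))"
      by (rule sum.cong) (use assms in \<open>simp_all add: skewD_Suc[OF assms(1)]\<close>)
    also have "\<dots> = - mvec n Z c (n - 1 - j)"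
      unfolding mvec_def using sum_reflect[of "\<lambda>k. Z (n - 1 - j) k * c k" n] by (simp add: sum_negf)
    finally show ?thesis .
  qed
  have "bracket n Z (wedge n a b) i j = (\<Sum>k<n. Z i k * a k) * b (n - 1 - j) - (\<Sum>k<n. Z i k * b k) * a (n - 1 - j)
     - a i * (\<Sum>k<n. b (n - 1 - k) * Z k j) + b i * (\<Sum>k<n. a (n - 1 - k) * Z k j)"
    unfolding bracket_def wedge_def
    by (simp add: sum_distrib_left sum_distrib_right sum.distrib[symmetric] sum_subtractf[symmetric] algebra_simps)
  then show ?thesis
    unfolding * by (simp add: wedge_def mvec_def)
qed

lemma mvec_wedge: "mvec n (wedge n a b) d i = pairing n b d * a i - pairing n a d * b i"
  unfolding mvec_def wedge_def pairing_def
  by (simp add: sum_distrib_left sum_subtractf algebra_simps)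

lemma pairing_commute: "pairing n a b = pairing n b a"
proof -
  have "pairing n a b = (\<Sum>j<n. a (n - 1 - (n - 1 - j)) * b (n - 1 - j))"
    unfolding pairing_def by (rule sum_reflect[symmetric])
  also have "\<dots> = pairing n b a"
    unfolding pairing_def by (rule sum.cong) (simp_all add: mult.commute)
  finally show ?thesis .
qed

lemma pairing_mvec:
  assumes "skew n Z"
  shows "pairing n a (mvec n Z b) = - pairing n (mvec n Z a) b"
proof -
  have "pairing n (mvec n Z a) b = (\<Sum>i<n. \<Sum>k<n. Z (n - 1 - i) k * a k * b i)"
    unfolding pairing_def mvec_def by (simp add: sum_distrib_left sum_distrib_right mult_ac)
  also have "\<dots> = (\<Sum>i<n. \<Sum>k<n. Z (n - 1 - i) (n - 1 - k) * a (n - 1 - k) * b i)"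
    by (rule sum.cong[OF refl], rule sum_reflect[symmetric])
  also have "\<dots> = (\<Sum>i<n. \<Sum>k<n. - (Z k i * a (n - 1 - k) * b i))"
    by (intro sum.cong refl) (simp add: skewD_Suc[OF assms])
  also have "\<dots> = (\<Sum>k<n. \<Sum>i<n. - (Z k i * a (n - 1 - k) * b i))"
    by (rule sum.swap)
  also have "\<dots> = - pairing n a (mvec n Z b)"
    unfolding pairing_def mvec_def by (simp add: sum_distrib_left sum_distrib_right sum_negf mult_ac)
  finally show ?thesis by simp
qed

text \<open>\<open>wedge n v w\<close> is the endomorphism \<open>d \<mapsto> (w, d) v - (v, d) w\<close>.  It acts on the span of \<open>v\<close> and \<open>w\<close>
  with eigenvalues \<open>\<plusminus>\<alpha>\<close>, where \<open>-\<alpha>\<^sup>2\<close> is the Gram determinant, and kills the orthogonal complement.\<close>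

lemma ad_cubed_wedge:
  fixes n :: nat and X :: "nat \<Rightarrow> nat \<Rightarrow> 'a::comm_ring_1" and v w :: "nat \<Rightarrow> 'a"
  defines "Y \<equiv> wedge n v w"
  defines "C \<equiv> bracket n X Y"
  assumes X: "skew n X" and ij: "i < n" "j < n"
    and iso: "pairing n v (mvec n X v) = 0" "pairing n w (mvec n X w) = 0"
  shows "bracket n Y (bracket n Y C) i j = ((pairing n v w)\<^sup>2 - pairing n v v * pairing n w w) * C i j"
proof -
  define p r where "p = mvec n X v" and "r = mvec n X w"
  define s c d t where "s = pairing n v w" and "c = pairing n v v" and "d = pairing n w w" and "t = pairing n w p"
  have Y: "skew n Y" unfolding Y_def by (rule skew_wedge)
  have C: "C i j = wedge n p w i j + wedge n v r i j" if "i < n" "j < n" for i j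
    unfolding C_def Y_def p_def r_def by (rule bracket_wedge[OF X that])
  have vr: "pairing n v r = - t"
    unfolding r_def t_def p_def by (simp add: pairing_mvec[OF X, of v w] pairing_commute[of n w])
  have vp: "pairing n v p = 0" and wr: "pairing n w r = 0"
    using iso by (simp_all add: p_def r_def)
  have Ycoord: "mvec n Y p = (\<lambda>i. t * v i)" and Yr: "mvec n Y r = (\<lambda>i. t * w i)"
    and Yv: "mvec n Y v = (\<lambda>i. s * v i - c * w i)" and Yw: "mvec n Y w = (\<lambda>i. d * v i - s * w i)"
    unfolding Y_def
    by (auto simp: mvec_wedge vr vp wr t_def[symmetric] s_def c_def d_def pairing_commute[of n w v] fun_eq_iff)
  \<comment> \<open>The component along \<open>wedge n v w\<close> is annihilated by the next
    bracket, because \<open>Y\<close> has trace zero on the span of \<open>v\<close> and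
    \<open>w\<close>; the other components combine to a multiple of \<open>C\<close>.\<close>
  have YC: "bracket n Y C i j = 2 * t * wedge n v w i j + d * wedge n p v i j - s * wedge n p w i j
     + s * wedge n v r i j - c * wedge n w r i j" if "i < n" "j < n" for i j
  proof -
    have "bracket n Y C i j = bracket n Y (\<lambda>i j. wedge n p w i j + wedge n v r i j) i j"
      by (rule bracket_cong) (use C that in auto)
    also have "\<dots> = wedge n (mvec n Y p) w i j + wedge n p (mvec n Y w) i j
        + (wedge n (mvec n Y v) r i j + wedge n v (mvec n Y r) i j)"
      using that by (simp add: bracket_add_right bracket_wedge[OF Y])
    finally show ?thesis
      unfolding Ycoord Yr Yv Yw by (simp add: wedge_def algebra_simps)
  qed
  have "bracket n Y (bracket n Y C) i j = bracket n Y (\<lambda>i j. 2 * t * wedge n v w i j + d * wedge n p v i j - s * wedge n p w i j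
     + s * wedge n v r i j - c * wedge n w r i j) i j"
    by (rule bracket_cong) (use YC ij in auto)
  also have "\<dots> = 2 * t * (wedge n (mvec n Y v) w i j + wedge n v (mvec n Y w) i j)
      + d * (wedge n (mvec n Y p) v i j + wedge n p (mvec n Y v) i j)
      - s * (wedge n (mvec n Y p) w i j + wedge n p (mvec n Y w) i j)
      + s * (wedge n (mvec n Y v) r i j + wedge n v (mvec n Y r) i j)
      - c * (wedge n (mvec n Y w) r i j + wedge n w (mvec n Y r) i j)"
    using ij by (simp add: bracket_add_right bracket_diff_right bracket_scale_right bracket_wedge[OF Y])
  also have "\<dots> = (s\<^sup>2 - c * d) * C i j"
    unfolding Ycoord Yr Yv Yw C[OF ij] by (simp add: wedge_def power2_eq_square algebra_simps)
  finally show ?thesis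
    unfolding s_def c_def d_def .
qed

subsection \<open>Derivations and Gaussian functionals on polynomials\<close>

datatype gvar = Vec nat | Cov nat

type_synonym gpoly = "gvar symalg"

text \<open>If \<open>x\<close> does not occur in \<open>M\<close>, the multiset difference leaves
  \<open>M\<close> unchanged, but the factor \<open>count M x\<close> is 0 and removes the
  term.\<close>

definition partial :: "'a \<Rightarrow> 'a symalg \<Rightarrow> 'a symalg" where
  "partial x = lin_ext (\<lambda>M. Poly_Mapping.single (M - {#x#}) (of_nat (count M x)))"

definition derivation :: "('a::ring \<Rightarrow> 'a) \<Rightarrow> bool" where
  "derivation D \<longleftrightarrow> additive D \<and> (\<forall>p q. D (p * q) = D p * q + p * D q)"

lemma derivation_mult: "derivation D \<Longrightarrow> D (p * q) = D p * q + p * D q"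
  and derivation_add: "derivation D \<Longrightarrow> D (p + q) = D p + D q"
  and derivation_diff: "derivation D \<Longrightarrow> D (p - q) = D p - D q"
  and derivation_zero: "derivation D \<Longrightarrow> D 0 = 0"
  and derivation_sum: "derivation D \<Longrightarrow> D (sum f A) = (\<Sum>x\<in>A. D (f x))"
  and derivation_additive: "derivation D \<Longrightarrow> additive D"
  by (simp_all add: derivation_def additive.add additive.diff additive.zero additive.sum)

lemma derivation_one: "derivation D \<Longrightarrow> D (1 :: 'a::ring_1) = 0"
  using derivation_mult[of D 1 1] by simp

lemma additive_partial: "additive (partial x)"
  unfolding partial_def by (rule additive_lin_ext)

lemma partial_single [simp]:
  "partial x (Poly_Mapping.single M c) = Poly_Mapping.single (M - {#x#}) (c * of_nat (count M x))"
  by (simp add: partial_def)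

lemma partial_mult_single:
  "partial x (Poly_Mapping.single M c * q) = partial x (Poly_Mapping.single M c) * q + Poly_Mapping.single M c * partial x q"
proof (induction q rule: poly_mapping_single_induct)
  case (single N d)
  consider "x \<in># M" "x \<in># N" | "x \<in># M" "x \<notin># N" | "x \<notin># M" "x \<in># N" | "x \<notin># M" "x \<notin># N" by blast
  then show ?case
  proof cases
    case 1
    then show ?thesis
      by (simp add: mult_single algebra_simps single_add[symmetric])
  qed (simp_all add: mult_single not_in_iff algebra_simps)
qed (simp add: additive.add[OF additive_partial] distrib_left)

lemma derivation_partial: "derivation (partial x)"
  unfolding derivation_def
proof (intro conjI allI additive_partial)
  fix p q
  show "partial x (p * q) = partial x p * q + p * partial x q"
    by (induction p rule: poly_mapping_single_induct)
      (simp_all add: partial_mult_single additive.add[OF additive_partial] distrib_right del: partial_single)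
qed

lemma partial_var: "partial x (var y) = (if x = y then 1 else 0)"
  by (simp add: var_def)

lemma partial_const [simp]: "partial x (Poly_Mapping.single 0 c) = 0"
  by simp

lemma partial_commute: "partial x (partial y p) = partial y (partial x p)"
proof (induction p rule: poly_mapping_single_induct)
  case (single M c)
  then show ?case
    by (cases "x = y") (simp_all add: add_mset_commute mult_ac)
qed (simp add: additive.add[OF additive_partial])

section \<open>Weighted Gaussian functionals and integration by parts\<close>

definition cfunctional :: "(('m::monoid_add \<Rightarrow>\<^sub>0 complex) \<Rightarrow> complex) \<Rightarrow> bool" where
  "cfunctional \<phi> \<longleftrightarrow> additive \<phi> \<and> (\<forall>c p. \<phi> (scal c p) = c * \<phi> p)"

lemma cfunctional_additive: "cfunctional \<phi> \<Longrightarrow> additive \<phi>"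
  and cfunctional_scal: "cfunctional \<phi> \<Longrightarrow> \<phi> (scal c p) = c * \<phi> p"
  by (simp_all add: cfunctional_def)

lemma cfunctional_mult: "cfunctional \<phi> \<Longrightarrow> cfunctional (\<lambda>c. \<phi> (p * c))"
  by (simp add: cfunctional_def additive_def distrib_left)

definition lfun :: "('m \<Rightarrow> complex) \<Rightarrow> ('m \<Rightarrow>\<^sub>0 complex) \<Rightarrow> complex" where
  "lfun g p = (\<Sum>M\<in>Poly_Mapping.keys p. Poly_Mapping.lookup p M * g M)"

lemma lfun_superset:
  assumes "finite A" "Poly_Mapping.keys p \<subseteq> A"
  shows "lfun g p = (\<Sum>m\<in>A. Poly_Mapping.lookup p m * g m)"
  unfolding lfun_def
  by (rule sum.mono_neutral_left) (use assms in \<open>auto simp: in_keys_iff\<close>)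

lemma cfunctional_lfun: "cfunctional (lfun (g :: 'm::monoid_add \<Rightarrow> complex))"
  unfolding cfunctional_def
proof (intro conjI allI additive.intro)
  fix p q :: "'m \<Rightarrow>\<^sub>0 complex" and c
  show "lfun g (p + q) = lfun g p + lfun g q"
    using Poly_Mapping.keys_add[of p q]
    by (simp add: lfun_superset[of "Poly_Mapping.keys p \<union> Poly_Mapping.keys q"] lookup_add distrib_right sum.distrib)
  have "Poly_Mapping.keys (scal c p) \<subseteq> Poly_Mapping.keys p"
    by (auto simp: in_keys_iff)
  then show "lfun g (scal c p) = c * lfun g p"
    by (simp add: lfun_superset[of "Poly_Mapping.keys p"] sum_distrib_left mult.assoc)
qed

lemma lfun_single [simp]: "lfun g (Poly_Mapping.single M c) = c * g M"
  by (simp add: lfun_def)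

text \<open>On balanced monomials this is also the number of \<open>Cov\<close> variables. Every
  entry of the generic bivector raises it by one, so it is the degree in \<open>Y\<close>.\<close>

definition vdeg :: "gvar multiset \<Rightarrow> nat" where
  "vdeg M = size (filter_mset (\<lambda>x. \<exists>i. x = Vec i) M)"

text \<open>The moments of a Gaussian vector with \<open>Cov i\<close> conjugate to \<open>Vec i\<close>, for \<open>i < n\<close>.\<close>

definition balanced :: "nat \<Rightarrow> gvar multiset \<Rightarrow> bool" where
  "balanced n M \<longleftrightarrow> (\<forall>i. count M (Vec i) = count M (Cov i) \<and> (n \<le> i \<longrightarrow> count M (Vec i) = 0))"

definition gauss_moment :: "nat \<Rightarrow> gvar multiset \<Rightarrow> complex" where
  "gauss_moment n M = (if balanced n M then \<Prod>i<n. fact (count M (Vec i)) else 0)"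

text \<open>The averaging functional differs from the Gaussian one only by a factor on each
  homogeneous part, hence a weight depending on the degree. The constant weight 1 is the Gaussian
  functional itself.\<close>

definition gauss :: "nat \<Rightarrow> (nat \<Rightarrow> complex) \<Rightarrow> gpoly \<Rightarrow> complex" where
  "gauss n w = lfun (\<lambda>M. w (vdeg M) * gauss_moment n M)"

lemma cfunctional_gauss: "cfunctional (gauss n w)"
  unfolding gauss_def by (rule cfunctional_lfun)

lemma additive_gauss: "additive (gauss n w)"
  by (rule cfunctional_additive[OF cfunctional_gauss])

lemma gauss_add: "gauss n w (p + q) = gauss n w p + gauss n w q"
  and gauss_diff: "gauss n w (p - q) = gauss n w p - gauss n w q"
  and gauss_uminus: "gauss n w (- p) = - gauss n w p"
  and gauss_sum: "gauss n w (sum f A) = (\<Sum>x\<in>A. gauss n w (f x))"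
  and gauss_zero: "gauss n w 0 = 0"
  using additive_gauss by (simp_all add: additive.add additive.diff additive.minus additive.sum additive.zero)

lemma gauss_single: "gauss n w (Poly_Mapping.single M c) = c * (w (vdeg M) * gauss_moment n M)"
  by (simp add: gauss_def)

lemma gauss_moment_pair:
  assumes "i < n"
  shows "gauss_moment n (add_mset (Vec i) (add_mset (Cov i) M)) = of_nat (Suc (count M (Vec i))) * gauss_moment n M"
proof -
  define f g :: "nat \<Rightarrow> complex"
    where "f k = fact (count (add_mset (Vec i) (add_mset (Cov i) M)) (Vec k))"
      and "g k = fact (count M (Vec k))" for k
  have "prod f {..<n} = f i * prod f ({..<n} - {i})" "prod g {..<n} = g i * prod g ({..<n} - {i})"
    using prod.remove[of "{..<n}" i f] prod.remove[of "{..<n}" i g] assms by simp_all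
  moreover have "prod f ({..<n} - {i}) = prod g ({..<n} - {i})"
    by (rule prod.cong) (auto simp: f_def g_def)
  moreover have "f i = of_nat (Suc (count M (Vec i))) * g i"
    by (simp add: f_def g_def)
  ultimately have "prod f {..<n} = of_nat (Suc (count M (Vec i))) * prod g {..<n}"
    by (simp only: mult.assoc)
  then have *: "(\<Prod>k<n. fact (count (add_mset (Vec i) (add_mset (Cov i) M)) (Vec k)) :: complex)
      = of_nat (Suc (count M (Vec i))) * (\<Prod>k<n. fact (count M (Vec k)))"
    by (simp only: f_def[abs_def] g_def[abs_def])
  have "balanced n (add_mset (Vec i) (add_mset (Cov i) M)) \<longleftrightarrow> balanced n M"
    unfolding balanced_def
  proof (intro all_cong1)
    fix k
    show "(count (add_mset (Vec i) (add_mset (Cov i) M)) (Vec k) = count (add_mset (Vec i) (add_mset (Cov i) M)) (Cov k)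
        \<and> (n \<le> k \<longrightarrow> count (add_mset (Vec i) (add_mset (Cov i) M)) (Vec k) = 0))
      \<longleftrightarrow> (count M (Vec k) = count M (Cov k) \<and> (n \<le> k \<longrightarrow> count M (Vec k) = 0))"
      using assms by (cases "k = i") simp_all
  qed
  then show ?thesis
    unfolding gauss_moment_def * by (simp only: mult_zero_right split: if_split) simp
qed

lemma gauss_moment_Cov:
  assumes "i < n"
  shows "gauss_moment n (add_mset (Cov i) M) = of_nat (count M (Vec i)) * gauss_moment n (M - {#Vec i#})"
proof (cases "Vec i \<in># M")
  case True
  then obtain N where "M = add_mset (Vec i) N" by (metis mset_add)
  then show ?thesis
    using gauss_moment_pair[OF assms, of N] by (simp add: add_mset_commute)
next
  case False
  then have "count (add_mset (Cov i) M) (Vec i) \<noteq> count (add_mset (Cov i) M) (Cov i)"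
    by (simp add: not_in_iff)
  then have "gauss_moment n (add_mset (Cov i) M) = 0"
    unfolding gauss_moment_def balanced_def by meson
  with False show ?thesis by (simp add: not_in_iff)
qed

lemma gauss_moment_Vec:
  assumes "i < n"
  shows "gauss_moment n (add_mset (Vec i) M) = of_nat (count M (Cov i)) * gauss_moment n (M - {#Cov i#})"
proof (cases "Cov i \<in># M")
  case True
  then obtain N where N: "M = add_mset (Cov i) N" by (metis mset_add)
  show ?thesis
  proof (cases "count N (Vec i) = count N (Cov i)")
    case True
    then show ?thesis
      using gauss_moment_pair[OF assms, of N] N by simp
  next
    case False
    then have "gauss_moment n N = 0"
      unfolding gauss_moment_def balanced_def by meson
    then show ?thesis
      using gauss_moment_pair[OF assms, of N] N by simp
  qed
next
  case False
  then have "count (add_mset (Vec i) M) (Vec i) \<noteq> count (add_mset (Vec i) M) (Cov i)"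
    by (simp add: not_in_iff)
  then have "gauss_moment n (add_mset (Vec i) M) = 0"
    unfolding gauss_moment_def balanced_def by meson
  with False show ?thesis by (simp add: not_in_iff)
qed

text \<open>By the recursion of the factorial, a moment with one more \<open>Cov i\<close> is a
  multiple of the moment with one \<open>Vec i\<close> fewer. Removing a \<open>Vec\<close> lowers
  the degree by one, hence the shifted weight.\<close>

lemma gauss_Cov:
  assumes "i < n"
  shows "gauss n w (var (Cov i) * p) = gauss n (\<lambda>m. w (Suc m)) (partial (Vec i) p)"
proof (rule additive_eqI[where F = "\<lambda>p. gauss n w (var (Cov i) * p)"
    and G = "\<lambda>p. gauss n (\<lambda>m. w (Suc m)) (partial (Vec i) p)"])
  fix M c
  have "of_nat (count M (Vec i)) * w (vdeg M) = of_nat (count M (Vec i)) * w (Suc (vdeg (M - {#Vec i#})))"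
  proof (cases "Vec i \<in># M")
    case True
    then obtain N where "M = add_mset (Vec i) N" by (metis mset_add)
    then show ?thesis by (simp add: vdeg_def)
  qed (simp add: not_in_iff)
  moreover have "vdeg (add_mset (Cov i) M) = vdeg M" by (simp add: vdeg_def)
  ultimately show "gauss n w (var (Cov i) * Poly_Mapping.single M c)
      = gauss n (\<lambda>m. w (Suc m)) (partial (Vec i) (Poly_Mapping.single M c))"
    by (auto simp: var_def mult_single gauss_single gauss_moment_Cov[OF assms] mult_ac)
qed (simp_all add: additive_def distrib_left gauss_add additive.add[OF additive_partial])

lemma gauss_Vec:
  assumes "i < n"
  shows "gauss n w (var (Vec i) * p) = gauss n (\<lambda>m. w (Suc m)) (partial (Cov i) p)"
proof (rule additive_eqI[where F = "\<lambda>p. gauss n w (var (Vec i) * p)"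
    and G = "\<lambda>p. gauss n (\<lambda>m. w (Suc m)) (partial (Cov i) p)"])
  fix M c
  have "vdeg (M - {#Cov i#}) = vdeg M"
    by (cases "Cov i \<in># M") (auto simp: vdeg_def dest!: multi_member_split)
  moreover have "vdeg (add_mset (Vec i) M) = Suc (vdeg M)" by (simp add: vdeg_def)
  ultimately show "gauss n w (var (Vec i) * Poly_Mapping.single M c)
      = gauss n (\<lambda>m. w (Suc m)) (partial (Cov i) (Poly_Mapping.single M c))"
    by (simp add: var_def mult_single gauss_single gauss_moment_Vec[OF assms] mult_ac)
qed (simp_all add: additive_def distrib_left gauss_add additive.add[OF additive_partial])

lemma vdeg_eq_sum:
  assumes "\<And>i. n \<le> i \<Longrightarrow> count M (Vec i) = 0"
  shows "vdeg M = (\<Sum>i<n. count M (Vec i))"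
proof -
  let ?F = "filter_mset (\<lambda>x. \<exists>i. x = Vec i) M"
  have "set_mset ?F \<subseteq> Vec ` {..<n}"
    using assms by (auto simp: not_in_iff[symmetric] intro!: imageI) (meson leI)
  then have "sum (count ?F) (set_mset ?F) = (\<Sum>x\<in>Vec ` {..<n}. count ?F x)"
    by (intro sum.mono_neutral_left) (simp, assumption, simp only: DiffE count_eq_zero_iff, blast)
  then have "size ?F = (\<Sum>x\<in>Vec ` {..<n}. count ?F x)"
    by (simp only: size_multiset_overloaded_eq)
  also have "\<dots> = (\<Sum>i<n. count M (Vec i))"
    by (subst sum.reindex) (simp_all add: inj_on_def)
  finally show ?thesis by (simp add: vdeg_def)
qed

lemma gauss_euler:
  "gauss n w (\<Sum>i<n. var (Vec i) * partial (Vec i) p) = gauss n (\<lambda>m. of_nat m * w m) p"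
proof (rule additive_eqI[where F = "\<lambda>p. gauss n w (\<Sum>i<n. var (Vec i) * partial (Vec i) p)"
    and G = "gauss n (\<lambda>m. of_nat m * w m)"])
  fix M c
  have *: "var (Vec i) * partial (Vec i) (Poly_Mapping.single M c) = Poly_Mapping.single M (c * of_nat (count M (Vec i)))" for i
  proof (cases "Vec i \<in># M")
    case True
    then obtain N where "M = add_mset (Vec i) N" by (metis mset_add)
    then show ?thesis by (simp add: var_def mult_single)
  qed (simp add: not_in_iff)
  have "gauss n w (\<Sum>i<n. var (Vec i) * partial (Vec i) (Poly_Mapping.single M c))
      = c * of_nat (\<Sum>i<n. count M (Vec i)) * (w (vdeg M) * gauss_moment n M)"
    by (simp add: * gauss_sum gauss_single sum_distrib_left sum_distrib_right mult_ac del: partial_single)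
  \<comment> \<open>\<open>vdeg\<close> also counts variables with index at least \<open>n\<close>,
    which the sum omits; monomials containing them have moment zero.\<close>
  also have "\<dots> = c * of_nat (vdeg M) * (w (vdeg M) * gauss_moment n M)"
  proof (cases "\<forall>i. n \<le> i \<longrightarrow> count M (Vec i) = 0")
    case False
    then have "gauss_moment n M = 0" unfolding gauss_moment_def balanced_def by meson
    then show ?thesis by simp
  next
    case True
    then have "vdeg M = (\<Sum>i<n. count M (Vec i))" by (intro vdeg_eq_sum) auto
    then show ?thesis by (simp only:)
  qed
  finally show "gauss n w (\<Sum>i<n. var (Vec i) * partial (Vec i) (Poly_Mapping.single M c))
      = gauss n (\<lambda>m. of_nat m * w m) (Poly_Mapping.single M c)"
    by (simp add: gauss_single mult_ac)
qed (simp_all add: additive_def distrib_left gauss_add additive.add[OF additive_partial] sum.distrib)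

section \<open>Polynomial vector fields and the action of gl_n\<close>

lemma derivation_mult_left: "derivation D \<Longrightarrow> derivation (\<lambda>p. c * D p)" for c :: "'a::comm_ring"
  by (simp add: derivation_def additive_def algebra_simps)

lemma derivation_diff_fun: "derivation D \<Longrightarrow> derivation D' \<Longrightarrow> derivation (\<lambda>p. D p - D' p)"
  by (simp add: derivation_def additive_def algebra_simps)

lemma derivation_sum_fun:
  assumes "\<And>x. x \<in> A \<Longrightarrow> derivation (D x)"
  shows "derivation (\<lambda>p. \<Sum>x\<in>A. D x p)"
proof -
  have "additive (D x)" "D x (p * q) = D x p * q + p * D x q" if "x \<in> A" for x p q
    using assms[OF that] by (simp_all add: derivation_def)
  then show ?thesis
    by (simp add: derivation_def additive_def sum.distrib sum_distrib_left sum_distrib_right)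
qed

text \<open>The action of the matrix unit \<open>(i, j)\<close> on \<open>v\<close> and, contragrediently, on \<open>u\<close>.\<close>

definition glder :: "nat \<Rightarrow> nat \<Rightarrow> gpoly \<Rightarrow> gpoly" where
  "glder i j p = var (Vec j) * partial (Vec i) p - var (Cov i) * partial (Cov j) p"

definition mder :: "nat \<Rightarrow> (nat \<Rightarrow> nat \<Rightarrow> gpoly) \<Rightarrow> gpoly \<Rightarrow> gpoly" where
  "mder n Z p = (\<Sum>i<n. \<Sum>j<n. Z i j * glder i j p)"

lemma derivation_glder: "derivation (glder i j)"
  unfolding glder_def by (intro derivation_diff_fun derivation_mult_left derivation_partial)

lemma derivation_mder: "derivation (mder n Z)"
  unfolding mder_def by (intro derivation_sum_fun derivation_mult_left derivation_glder)

text \<open>Integration by parts turns both terms into the same mixed second derivative with the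
  same shift of the weight, so the invariance holds for every weight.\<close>

lemma gauss_glder: "i < n \<Longrightarrow> j < n \<Longrightarrow> gauss n w (glder i j p) = 0"
  by (simp add: glder_def gauss_diff gauss_Cov gauss_Vec partial_commute[of "Vec i"])

text \<open>The functional kills \<open>glder i j (Z i j * p)\<close>, and the Leibniz rule splits
  this into the field applied to \<open>p\<close> and a divergence. Constant \<open>Z\<close> give
  invariance, polynomial \<open>Z\<close> a correction term.\<close>

lemma gauss_mder:
  "gauss n w (mder n Z p) = - gauss n w ((\<Sum>i<n. \<Sum>j<n. glder i j (Z i j)) * p)"
proof -
  have "0 = gauss n w (\<Sum>i<n. \<Sum>j<n. glder i j (Z i j * p))"
    by (simp add: gauss_sum gauss_glder)
  also have "(\<Sum>i<n. \<Sum>j<n. glder i j (Z i j * p)) = (\<Sum>i<n. \<Sum>j<n. glder i j (Z i j)) * p + mder n Z p"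
    by (simp add: derivation_mult[OF derivation_glder] mder_def sum.distrib sum_distrib_right)
  finally show ?thesis by (simp add: gauss_add eq_neg_iff_add_eq_0 add.commute)
qed

abbreviation gv :: "nat \<Rightarrow> gpoly" where
  "gv i \<equiv> var (Vec i)"

text \<open>Reading the covector through the antidiagonal form makes it a vector: a skew matrix acts
  on \<open>gv\<close> and on \<open>gw n\<close> by the same \<open>mvec\<close>.\<close>

definition gw :: "nat \<Rightarrow> nat \<Rightarrow> gpoly" where
  "gw n i = var (Cov (n - 1 - i))"

text \<open>The generic decomposable bivector.\<close>

definition Ymat :: "nat \<Rightarrow> nat \<Rightarrow> nat \<Rightarrow> gpoly" where
  "Ymat n = wedge n gv (gw n)"

lemma skew_Ymat: "skew n (Ymat n)"
  unfolding Ymat_def by (rule skew_wedge)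

lemma glder_Vec: "glder i j (gv k) = (if k = i then gv j else 0)"
  by (simp add: glder_def partial_var)

lemma glder_Cov: "glder i j (var (Cov k)) = (if k = j then - var (Cov i) else 0)"
  by (simp add: glder_def partial_var)

lemma mder_Vec: "k < n \<Longrightarrow> mder n Z (gv k) = mvec n Z gv k"
proof -
  assume k: "k < n"
  have "mder n Z (gv k) = (\<Sum>i<n. if k = i then \<Sum>j<n. Z i j * gv j else 0)"
    unfolding mder_def glder_Vec by (rule sum.cong) auto
  also have "\<dots> = mvec n Z gv k"
    using k by (simp add: mvec_def)
  finally show ?thesis .
qed

lemma mder_gw:
  assumes "skew n Z" "k < n"
  shows "mder n Z (gw n k) = mvec n Z (gw n) k"
proof -
  have "mder n Z (gw n k) = (\<Sum>i<n. \<Sum>j<n. if n - 1 - k = j then - (Z i j * var (Cov i)) else 0)"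
    unfolding mder_def gw_def glder_Cov by (intro sum.cong) auto
  also have "\<dots> = (\<Sum>i<n. - (Z i (n - 1 - k) * var (Cov i)))"
    using assms by simp
  also have "\<dots> = (\<Sum>i<n. - (Z (n - 1 - i) (n - 1 - k) * var (Cov (n - 1 - i))))"
    by (rule sum_reflect[symmetric])
  also have "\<dots> = mvec n Z (gw n) k"
    unfolding mvec_def gw_def
    by (rule sum.cong) (use assms in \<open>simp_all add: skewD_Suc[OF assms(1)]\<close>)
  finally show ?thesis .
qed

text \<open>Both factors of the wedge move by \<open>mvec n Z\<close>. The entries of
  \<open>Z\<close> only multiply derivations, so \<open>Z\<close> may itself depend on
  \<open>Y\<close>; this realises the field given by \<open>b\<close> on the parameters.\<close>

lemma mder_Ymat:
  assumes "skew n Z" "i < n" "j < n"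
  shows "mder n Z (Ymat n i j) = bracket n Z (Ymat n) i j"
proof -
  have "n - 1 - j < n" using assms by simp
  then show ?thesis
    unfolding Ymat_def bracket_wedge[OF assms]
    using assms
    by (simp add: wedge_def derivation_mult[OF derivation_mder] derivation_diff[OF derivation_mder]
        mder_Vec mder_gw del: One_nat_def)
qed

lemma gpoly_eq_neg: "p = - p \<Longrightarrow> p = 0" for p :: "'a \<Rightarrow>\<^sub>0 complex"
proof (rule poly_mapping_eqI)
  fix k assume "p = - p"
  then have "Poly_Mapping.lookup p k = - Poly_Mapping.lookup p k"
    by (metis lookup_uminus)
  then show "Poly_Mapping.lookup p k = Poly_Mapping.lookup 0 k" by simp
qed

lemma pairing_mvec_self: "skew n Z \<Longrightarrow> pairing n a (mvec n Z a) = 0" for a :: "nat \<Rightarrow> gpoly"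
  by (rule gpoly_eq_neg) (metis pairing_mvec pairing_commute)

definition cmat :: "(nat \<Rightarrow> nat \<Rightarrow> complex) \<Rightarrow> nat \<Rightarrow> nat \<Rightarrow> gpoly" where
  "cmat x i j = Poly_Mapping.single 0 (x i j)"

definition alpha2 :: "nat \<Rightarrow> gpoly" where
  "alpha2 n = (pairing n gv (gw n))\<^sup>2 - pairing n gv gv * pairing n (gw n) (gw n)"

lemma skew_cmat: "skew n x \<Longrightarrow> skew n (cmat x)"
  unfolding skew_def cmat_def by (metis single_uminus)

lemma glder_const: "glder i j (cmat x k l) = 0"
  by (simp add: glder_def cmat_def)

lemma gauss_mder_cmat: "gauss n w (mder n (cmat x) p) = 0"
  by (simp add: gauss_mder glder_const gauss_zero)

section \<open>The divergence that produces the dual Coxeter number\<close>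

lemma skew_trace:
  fixes Z :: "nat \<Rightarrow> nat \<Rightarrow> gpoly"
  assumes "skew n Z"
  shows "(\<Sum>i<n. Z i i) = 0"
proof (rule gpoly_eq_neg)
  have "(\<Sum>i<n. Z i i) = (\<Sum>i<n. Z (n - 1 - i) (n - 1 - i))"
    by (rule sum_reflect[symmetric])
  also have "\<dots> = (\<Sum>i<n. - Z i i)"
    by (rule sum.cong) (simp_all add: skewD_Suc[OF assms])
  finally show "(\<Sum>i<n. Z i i) = - (\<Sum>i<n. Z i i)" by (simp add: sum_negf)
qed

text \<open>The invariant form of \<open>X\<close> and \<open>Ymat n\<close>; see \<open>trace_Ymat\<close>.\<close>

definition qform :: "nat \<Rightarrow> (nat \<Rightarrow> nat \<Rightarrow> gpoly) \<Rightarrow> gpoly" where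
  "qform n X = pairing n (gw n) (mvec n X gv)"

lemma gw_reflect: "j < n \<Longrightarrow> gw n (n - 1 - j) = var (Cov j)"
  by (simp add: gw_def)

lemma qform_alt: "qform n X = (\<Sum>i<n. var (Cov i) * mvec n X gv i)"
  unfolding qform_def pairing_def by (rule sum.cong) (simp_all add: gw_def)

lemma qform_alt2: "skew n X \<Longrightarrow> (\<Sum>j<n. mvec n X (gw n) (n - 1 - j) * gv j) = - qform n X"
  unfolding qform_def pairing_mvec by (simp add: pairing_def)

lemma trace_Ymat:
  assumes "skew n X"
  shows "(\<Sum>i<n. \<Sum>k<n. X i k * Ymat n k i) = 2 * qform n X"
proof -
  have "(\<Sum>i<n. \<Sum>k<n. X i k * Ymat n k i)
      = (\<Sum>i<n. mvec n X gv i * gw n (n - 1 - i)) - (\<Sum>i<n. mvec n X (gw n) i * gv (n - 1 - i))"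
    by (simp add: Ymat_def wedge_def mvec_def sum_distrib_right sum_distrib_left sum_subtractf
        right_diff_distrib mult_ac)
  also have "\<dots> = pairing n (gw n) (mvec n X gv) - pairing n gv (mvec n X (gw n))"
    by (simp add: pairing_def mult.commute)
  also have "\<dots> = 2 * qform n X"
    by (simp add: qform_def pairing_mvec[OF assms, of gv] pairing_commute[of n _ "gw n"])
  finally show ?thesis .
qed

lemma glder_mvec_gv:
  assumes "i < n"
  shows "glder i j (mvec n (cmat x) gv k) = cmat x k i * gv j"
proof -
  have "glder i j (mvec n (cmat x) gv k) = (\<Sum>l<n. if l = i then cmat x k l * gv j else 0)"
    unfolding mvec_def derivation_sum[OF derivation_glder]
    by (rule sum.cong) (simp_all add: derivation_mult[OF derivation_glder] glder_const glder_Vec)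
  then show ?thesis using assms by simp
qed

lemma glder_mvec_gw:
  assumes "j < n"
  shows "glder i j (mvec n (cmat x) (gw n) k) = - cmat x k (n - 1 - j) * var (Cov i)"
proof -
  have "n - 1 - l = j \<longleftrightarrow> l = n - 1 - j" if "l < n" for l
    using assms that by auto
  then have "glder i j (mvec n (cmat x) (gw n) k) = (\<Sum>l<n. if l = n - 1 - j then - cmat x k l * var (Cov i) else 0)"
    unfolding mvec_def derivation_sum[OF derivation_glder]
    by (intro sum.cong) (simp_all add: derivation_mult[OF derivation_glder] glder_const gw_def glder_Cov)
  then show ?thesis using assms by simp
qed

text \<open>Derivatives that hit the factor carrying the differentiated index itself occur
  \<open>n\<close> times in each of two terms and give \<open>- 2 n\<close> copies of the form. Four
  further contributions give one copy each with the opposite sign, and the trace terms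
  vanish.\<close>

lemma divergence:
  assumes "skew n x"
  shows "(\<Sum>i<n. \<Sum>j<n. glder i j (bracket n (cmat x) (Ymat n) i j)) = - (2 * (of_nat n - 2) * qform n (cmat x))"
proof -
  define X where "X = cmat x"
  have X: "skew n X" unfolding X_def by (rule skew_cmat[OF assms])
  define p r where "p = mvec n X gv" and "r = mvec n X (gw n)"
  let ?i = "\<lambda>i. n - 1 - i"
  have entry: "glder i j (bracket n X (Ymat n) i j)
     = X i i * (gv j * var (Cov j)) - p i * var (Cov i) + (if i = ?i j then var (Cov i) * p (?i j) else 0)
       - gw n i * X (?i j) i * gv j + gv j * r (?i j) - gv i * X (?i j) (?i j) * var (Cov i)
       + X i (?i j) * var (Cov i) * gv (?i j) - (if i = ?i j then r i * gv j else 0)"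
    if ij: "i < n" "j < n" for i j
  proof -
    have e: "?i i = j \<longleftrightarrow> i = ?i j" using ij by auto
    have gi: "glder i j (gw n i) = (if i = ?i j then - var (Cov i) else 0)"
      unfolding gw_def glder_Cov e by simp
    have pc: "glder i j (p k) = X k i * gv j" for k
      unfolding p_def X_def by (rule glder_mvec_gv) fact
    have rc: "glder i j (r k) = - X k (?i j) * var (Cov i)" for k
      unfolding r_def X_def by (rule glder_mvec_gw) fact
    have "bracket n X (Ymat n) i j = p i * var (Cov j) - gw n i * p (?i j) + (gv i * r (?i j) - r i * gv (?i j))"
      unfolding Ymat_def bracket_wedge[OF X ij] wedge_def p_def r_def gw_reflect[OF ij(2)] by simp
    then have "glder i j (bracket n X (Ymat n) i j) = glder i j (p i * var (Cov j) - gw n i * p (?i j) + (gv i * r (?i j) - r i * gv (?i j)))"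
      by (simp only:)
    also have "\<dots> = X i i * gv j * var (Cov j) + p i * (if j = j then - var (Cov i) else 0)
       - ((if i = ?i j then - var (Cov i) else 0) * p (?i j) + gw n i * (X (?i j) i * gv j))
       + ((if i = i then gv j else 0) * r (?i j) + gv i * (- X (?i j) (?i j) * var (Cov i))
         - ((- X i (?i j) * var (Cov i)) * gv (?i j) + r i * (if ?i j = i then gv j else 0)))"
      by (simp only: derivation_add[OF derivation_glder] derivation_diff[OF derivation_glder]
          derivation_mult[OF derivation_glder] gi pc rc glder_Cov glder_Vec)
    also have "\<dots> = X i i * (gv j * var (Cov j)) - p i * var (Cov i) + (if i = ?i j then var (Cov i) * p (?i j) else 0)
       - gw n i * X (?i j) i * gv j + gv j * r (?i j) - gv i * X (?i j) (?i j) * var (Cov i)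
       + X i (?i j) * var (Cov i) * gv (?i j) - (if i = ?i j then r i * gv j else 0)"
      unfolding eq_commute[of "?i j" i] by (simp add: algebra_simps)
    finally show ?thesis .
  qed
  have tr: "(\<Sum>i<n. X i i) = 0" by (rule skew_trace[OF X])
  have q1: "(\<Sum>i<n. var (Cov i) * p i) = qform n X"
    unfolding p_def qform_alt ..
  have q2: "(\<Sum>j<n. r (?i j) * gv j) = - qform n X"
    unfolding r_def by (rule qform_alt2[OF X])
  have t1: "(\<Sum>i<n. \<Sum>j<n. X i i * (gv j * var (Cov j))) = 0"
    using tr by (simp add: sum_product[symmetric])
  have t2: "(\<Sum>i<n. \<Sum>j<n. p i * var (Cov i)) = of_nat n * qform n X"
    by (simp add: sum_distrib_left[symmetric] q1[symmetric] mult.commute)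
  have t3: "(\<Sum>i<n. \<Sum>j<n. if i = ?i j then var (Cov i) * p (?i j) else 0) = qform n X"
  proof -
    have "(\<Sum>i<n. \<Sum>j<n. if i = ?i j then var (Cov i) * p (?i j) else 0)
       = (\<Sum>j<n. \<Sum>i<n. if i = ?i j then var (Cov i) * p (?i j) else 0)" by (rule sum.swap)
    also have "\<dots> = (\<Sum>j<n. var (Cov (?i j)) * p (?i j))"
      by (rule sum.cong) (simp_all add: sum.delta)
    also have "\<dots> = qform n X" unfolding q1[symmetric] by (rule sum_reflect)
    finally show ?thesis .
  qed
  have t4: "(\<Sum>i<n. \<Sum>j<n. gw n i * X (?i j) i * gv j) = - qform n X"
  proof -
    have "(\<Sum>i<n. \<Sum>j<n. gw n i * X (?i j) i * gv j) = (\<Sum>j<n. r (?i j) * gv j)"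
      by (subst sum.swap) (simp add: r_def mvec_def sum_distrib_right sum_distrib_left mult_ac)
    then show ?thesis using q2 by simp
  qed
  have t5: "(\<Sum>i<n. \<Sum>j<n. gv j * r (?i j)) = - (of_nat n * qform n X)"
    using q2 by (simp add: mult.commute)
  have t6: "(\<Sum>i<n. \<Sum>j<n. gv i * X (?i j) (?i j) * var (Cov i)) = 0"
  proof -
    have "(\<Sum>i<n. \<Sum>j<n. gv i * X (?i j) (?i j) * var (Cov i)) = (\<Sum>i<n. gv i * (\<Sum>j<n. X (?i j) (?i j)) * var (Cov i))"
      by (simp only: sum_distrib_left sum_distrib_right)
    then show ?thesis
      unfolding sum_reflect[of "\<lambda>j. X j j"] tr by simp
  qed
  have t7: "(\<Sum>i<n. \<Sum>j<n. X i (?i j) * var (Cov i) * gv (?i j)) = qform n X"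
  proof -
    have "(\<Sum>j<n. X i (?i j) * var (Cov i) * gv (?i j)) = var (Cov i) * p i" for i
      unfolding p_def mvec_def sum_distrib_left
      using sum_reflect[of "\<lambda>j. X i j * var (Cov i) * gv j" n] by (simp add: mult_ac)
    then show ?thesis using q1 by simp
  qed
  have t8: "(\<Sum>i<n. \<Sum>j<n. if i = ?i j then r i * gv j else 0) = - qform n X"
  proof -
    have "(\<Sum>i<n. \<Sum>j<n. if i = ?i j then r i * gv j else 0)
       = (\<Sum>j<n. \<Sum>i<n. if i = ?i j then r i * gv j else 0)" by (rule sum.swap)
    also have "\<dots> = (\<Sum>j<n. r (?i j) * gv j)"
      by (rule sum.cong) (simp_all add: sum.delta)
    finally show ?thesis using q2 by simp
  qed
  have "(\<Sum>i<n. \<Sum>j<n. glder i j (bracket n X (Ymat n) i j))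
     = (\<Sum>i<n. \<Sum>j<n. X i i * (gv j * var (Cov j)) - p i * var (Cov i) + (if i = ?i j then var (Cov i) * p (?i j) else 0)
       - gw n i * X (?i j) i * gv j + gv j * r (?i j) - gv i * X (?i j) (?i j) * var (Cov i)
       + X i (?i j) * var (Cov i) * gv (?i j) - (if i = ?i j then r i * gv j else 0))"
    by (intro sum.cong refl entry) simp_all
  also have "\<dots> = 0 - of_nat n * qform n X + qform n X - (- qform n X) + (- (of_nat n * qform n X)) - 0 + qform n X - (- qform n X)"
    by (simp only: sum.distrib sum_subtractf t1 t2 t3 t4 t5 t6 t7 t8)
  also have "\<dots> = - (2 * (of_nat n - 2) * qform n X)"
    by (simp add: algebra_simps)
  finally show ?thesis by (simp only: X_def)
qed

section \<open>The weight recursion and the shear\<close>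

lemma gauss_weight_add: "gauss n (\<lambda>m. w m + w' m) p = gauss n w p + gauss n w' p"
  by (simp add: gauss_def lfun_def algebra_simps sum.distrib)

lemma gauss_weight_scale: "gauss n (\<lambda>m. c * w m) p = c * gauss n w p"
  by (simp add: gauss_def lfun_def sum_distrib_left algebra_simps)

text \<open>Integrating by parts against each \<open>Cov i\<close> gives the identity plus
  \<open>gv i * partial (Vec i)\<close>. The sum over \<open>i\<close> is \<open>n\<close> plus the
  Euler operator, which reads off the degree.\<close>

lemma gauss_pairing:
  "gauss n w (pairing n gv (gw n) * p) = gauss n (\<lambda>m. (of_nat n + of_nat m) * w (Suc m)) p"
proof -
  have "pairing n gv (gw n) = (\<Sum>i<n. var (Cov i) * gv i)"
    using pairing_commute[of n gv "gw n"] unfolding pairing_def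
    by (simp only:) (rule sum.cong, simp_all add: gw_def)
  then have "gauss n w (pairing n gv (gw n) * p) = (\<Sum>i<n. gauss n w (var (Cov i) * (gv i * p)))"
    by (simp add: sum_distrib_right gauss_sum mult.assoc)
  also have "\<dots> = (\<Sum>i<n. gauss n (\<lambda>m. w (Suc m)) p + gauss n (\<lambda>m. w (Suc m)) (gv i * partial (Vec i) p))"
    by (rule sum.cong) (simp_all add: gauss_Cov derivation_mult[OF derivation_partial] partial_var gauss_add)
  also have "\<dots> = of_nat n * gauss n (\<lambda>m. w (Suc m)) p + gauss n (\<lambda>m. of_nat m * w (Suc m)) p"
    using gauss_euler[of n "\<lambda>m. w (Suc m)" p] by (simp add: sum.distrib gauss_sum)
  finally show ?thesis
    by (simp add: distrib_right gauss_weight_add gauss_weight_scale)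
qed

text \<open>\<open>Ymat n\<close> only depends on the bivector, hence is constant along \<open>v \<mapsto> v + t gw n\<close>.\<close>

definition shear :: "nat \<Rightarrow> gpoly \<Rightarrow> gpoly" where
  "shear n p = (\<Sum>i<n. gw n i * partial (Vec i) p)"

lemma derivation_shear: "derivation (shear n)"
  unfolding shear_def by (intro derivation_sum_fun derivation_mult_left derivation_partial)

lemma shear_gv: "k < n \<Longrightarrow> shear n (gv k) = gw n k"
  by (simp add: shear_def partial_var if_distrib[of "(*) _"] cong: if_cong)

lemma shear_gw: "shear n (gw n k) = 0"
  by (simp add: shear_def gw_def partial_var)

lemma shear_cmat: "shear n (cmat x i j) = 0"
  by (simp add: shear_def cmat_def)

lemma shear_Ymat: "i < n \<Longrightarrow> j < n \<Longrightarrow> shear n (Ymat n i j) = 0"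
  by (simp add: Ymat_def wedge_def derivation_diff[OF derivation_shear] derivation_mult[OF derivation_shear]
      shear_gv shear_gw)

lemma shear_bracket: "i < n \<Longrightarrow> j < n \<Longrightarrow> shear n (bracket n (cmat x) (Ymat n) i j) = 0"
  by (simp add: bracket_def derivation_sum[OF derivation_shear] derivation_diff[OF derivation_shear]
      derivation_mult[OF derivation_shear] shear_cmat shear_Ymat)

text \<open>One of the two factors is integrated by parts; the other contains no \<open>Vec\<close>
  variable and survives as the coefficient of the derivation.\<close>

lemma gauss_gw_square: "gauss n w (pairing n (gw n) (gw n) * p) = gauss n (\<lambda>m. w (Suc m)) (shear n p)"
proof -
  have "pairing n (gw n) (gw n) = (\<Sum>i<n. var (Cov i) * gw n i)"
    unfolding pairing_def by (rule sum.cong) (simp_all add: gw_def)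
  then have "gauss n w (pairing n (gw n) (gw n) * p) = (\<Sum>i<n. gauss n w (var (Cov i) * (gw n i * p)))"
    by (simp add: sum_distrib_right gauss_sum mult.assoc)
  also have "\<dots> = (\<Sum>i<n. gauss n (\<lambda>m. w (Suc m)) (gw n i * partial (Vec i) p))"
    by (rule sum.cong) (simp_all add: gauss_Cov derivation_mult[OF derivation_partial] gw_def partial_var)
  finally show ?thesis by (simp add: shear_def gauss_sum)
qed

text \<open>The recursion says that \<open>w m\<close> is proportional to \<open>1 / (n + m - 2)!\<close>.  For this weight the functional
  behaves like an average over bivectors with \<open>\<alpha>\<^sup>2 = 1\<close>.\<close>

lemma gauss_alpha2:
  fixes w :: "nat \<Rightarrow> complex"
  assumes w: "\<And>m. w m = (of_nat n + of_nat m) * (of_nat n + of_nat m - 1) * w (m + 2)"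
    and p: "shear n p = 0"
  shows "gauss n w (alpha2 n * p) = gauss n w p"
proof -
  let ?s = "pairing n gv (gw n)"
  have vv: "shear n (pairing n gv gv) = 2 * ?s"
  proof -
    have "shear n (pairing n gv gv) = (\<Sum>j<n. gw n (n - 1 - j) * gv j + gv (n - 1 - j) * gw n j)"
      unfolding pairing_def derivation_sum[OF derivation_shear]
      by (rule sum.cong) (simp_all add: derivation_mult[OF derivation_shear] shear_gv)
    also have "\<dots> = pairing n (gw n) gv + pairing n gv (gw n)"
      by (simp add: pairing_def sum.distrib)
    finally show ?thesis by (simp add: pairing_commute[of n "gw n"])
  qed
  have "gauss n w (?s\<^sup>2 * p) = gauss n (\<lambda>m. (of_nat n + of_nat m) * ((of_nat n + of_nat (Suc m)) * w (Suc (Suc m)))) p"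
    by (simp add: power2_eq_square mult.assoc gauss_pairing)
  moreover have "gauss n w (pairing n gv gv * pairing n (gw n) (gw n) * p) = gauss n (\<lambda>m. w (Suc m)) (shear n (pairing n gv gv * p))"
    using gauss_gw_square[of n w "pairing n gv gv * p"] by (simp add: mult_ac)
  \<comment> \<open>As \<open>p\<close> is constant along the shear, only
    \<open>pairing n gv gv\<close> is differentiated, and it yields twice the mixed pairing.\<close>
  moreover have "gauss n (\<lambda>m. w (Suc m)) (shear n (pairing n gv gv * p))
      = 2 * gauss n (\<lambda>m. (of_nat n + of_nat m) * w (Suc (Suc m))) p"
  proof -
    have "shear n (pairing n gv gv * p) = ?s * p + ?s * p"
      by (simp add: derivation_mult[OF derivation_shear] vv p)
    then show ?thesis by (simp only: gauss_add gauss_pairing) simp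
  qed
  ultimately have "gauss n w (alpha2 n * p)
      = gauss n (\<lambda>m. (of_nat n + of_nat m) * ((of_nat n + of_nat (Suc m)) * w (Suc (Suc m)))) p
        - 2 * gauss n (\<lambda>m. (of_nat n + of_nat m) * w (Suc (Suc m))) p"
    by (simp only: alpha2_def left_diff_distrib gauss_diff)
  also have "\<dots> = gauss n (\<lambda>m. (of_nat n + of_nat m) * ((of_nat n + of_nat (Suc m)) * w (Suc (Suc m)))
        + (- 2) * ((of_nat n + of_nat m) * w (Suc (Suc m)))) p"
    unfolding gauss_weight_add gauss_weight_scale by simp
  \<comment> \<open>With M = n + m the two contributions are M (M + 1) and - 2 M; their sum M (M -
    1) is the factor in the recursion.\<close>
  also have "(\<lambda>m. (of_nat n + of_nat m) * ((of_nat n + of_nat (Suc m)) * w (Suc (Suc m)))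
        + (- 2) * ((of_nat n + of_nat m) * w (Suc (Suc m)))) = w"
  proof
    fix m
    show "(of_nat n + of_nat m) * ((of_nat n + of_nat (Suc m)) * w (Suc (Suc m)))
        + (- 2) * ((of_nat n + of_nat m) * w (Suc (Suc m))) = w m"
      unfolding w[of m] by (simp add: algebra_simps)
  qed
  finally show ?thesis .
qed

lemma ad_cubed_Ymat:
  assumes "skew n x" "i < n" "j < n"
  shows "bracket n (Ymat n) (bracket n (Ymat n) (bracket n (cmat x) (Ymat n))) i j = alpha2 n * bracket n (cmat x) (Ymat n) i j"
  unfolding Ymat_def alpha2_def
  by (rule ad_cubed_wedge) (simp_all add: assms skew_cmat pairing_mvec_self)

subsection \<open>The orthogonal Lie algebra\<close>

definition basis_idx :: "nat \<Rightarrow> (nat \<times> nat) set" where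
  "basis_idx n = {(i, j). i < n \<and> j < n \<and> i < n - 1 - j}"

lemma finite_basis_idx [simp]: "finite (basis_idx n)"
  by (rule finite_subset[of _ "{..<n} \<times> {..<n}"]) (auto simp: basis_idx_def)

lemma basis_idxD: "(i, j) \<in> basis_idx n \<Longrightarrow> i < n \<and> j < n"
  by (simp add: basis_idx_def)

lemma Fmat_carrier [simp]: "Fmat n i j \<in> carrier_mat n n"
  unfolding Fmat_def Emat_def by (intro minus_carrier_mat mat_carrier)

lemma Fmat_index:
  "k < n \<Longrightarrow> l < n \<Longrightarrow> Fmat n i j $$ (k, l)
     = (if k = i \<and> l = j then 1 else 0) - (if k = n - 1 - j \<and> l = n - 1 - i then 1 else 0)"
  by (simp add: Fmat_def Emat_def)

text \<open>Off the antidiagonal exactly one of \<open>(k, l)\<close> and its reflection is a basis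
  index. The entries on the antidiagonal vanish by \<open>diag\<close>, since skewness over a
  general ring only says that twice such an entry is zero.\<close>

lemma basis_idx_expansion:
  fixes Z :: "nat \<Rightarrow> nat \<Rightarrow> 'a::comm_ring_1"
  assumes Z: "skew n Z" and diag: "\<And>k. k < n \<Longrightarrow> Z k (n - 1 - k) = 0" and kl: "k < n" "l < n"
  shows "(\<Sum>(i, j)\<in>basis_idx n. Z i j * ((if k = i \<and> l = j then 1 else 0)
            - (if k = n - 1 - j \<and> l = n - 1 - i then 1 else 0))) = Z k l"
proof -
  have "(\<Sum>(i, j)\<in>basis_idx n. Z i j * ((if k = i \<and> l = j then 1 else 0)
            - (if k = n - 1 - j \<and> l = n - 1 - i then 1 else 0)))
      = (\<Sum>p\<in>basis_idx n. (if p = (k, l) then Z k l else 0)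
          - (if p = (n - 1 - l, n - 1 - k) then Z (n - 1 - l) (n - 1 - k) else 0))"
  proof (rule sum.cong[OF refl], clarify)
    fix i j assume "(i, j) \<in> basis_idx n"
    then have "i < n" "j < n" by (simp_all add: basis_idx_def)
    then have a: "k = n - 1 - j \<longleftrightarrow> j = n - 1 - k" and b: "l = n - 1 - i \<longleftrightarrow> i = n - 1 - l"
      using kl by linarith+
    have B: "k = n - 1 - j \<and> l = n - 1 - i \<longleftrightarrow> (i, j) = (n - 1 - l, n - 1 - k)"
      unfolding prod.inject a b by (rule conj_commute)
    have A: "k = i \<and> l = j \<longleftrightarrow> (i, j) = (k, l)" by auto
    have *: "a * ((if P then 1 else 0) - (if Q then 1 else 0)) = (if P then b else 0) - (if Q then c else 0)"
      if "P \<Longrightarrow> a = b" "Q \<Longrightarrow> a = c" for P Q and a b c :: 'a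
      using that by (cases P; cases Q) simp_all
    show "Z i j * ((if k = i \<and> l = j then 1 else 0) - (if k = n - 1 - j \<and> l = n - 1 - i then 1 else 0))
       = (if (i, j) = (k, l) then Z k l else 0)
          - (if (i, j) = (n - 1 - l, n - 1 - k) then Z (n - 1 - l) (n - 1 - k) else 0)"
      unfolding A B
      by (rule *) (drule arg_cong[where f = "case_prod Z"], simp only: prod.case)+
  qed
  also have "\<dots> = (if (k, l) \<in> basis_idx n then Z k l else 0)
      - (if (n - 1 - l, n - 1 - k) \<in> basis_idx n then Z (n - 1 - l) (n - 1 - k) else 0)"
    unfolding sum_subtractf by (simp add: sum.delta)
  also have "\<dots> = Z k l"
  proof -
    consider "k < n - 1 - l" | "n - 1 - l < k" | "l = n - 1 - k" using kl by linarith
    then show ?thesis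
      using kl skewD_Suc[OF Z kl] diag[of k] by cases (auto simp: basis_idx_def)
  qed
  finally show ?thesis .
qed

definition skew_mats :: "nat \<Rightarrow> complex mat set" where
  "skew_mats n = {x \<in> carrier_mat n n. skew n (\<lambda>i j. x $$ (i, j))}"

lemma skew_mats_carrier: "x \<in> skew_mats n \<Longrightarrow> x \<in> carrier_mat n n"
  by (simp add: skew_mats_def)

lemma skew_diag: "skew n Z \<Longrightarrow> k < n \<Longrightarrow> Z k (n - 1 - k) = 0" for Z :: "nat \<Rightarrow> nat \<Rightarrow> complex"
  using skewD_Suc[of n Z k "n - 1 - k"] by simp

lemma skew_diag_gpoly: "skew n Z \<Longrightarrow> k < n \<Longrightarrow> Z k (n - 1 - k) = 0" for Z :: "nat \<Rightarrow> nat \<Rightarrow> gpoly"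
  using skewD_Suc[of n Z k "n - 1 - k"] by (intro gpoly_eq_neg) simp

text \<open>The matrix is rebuilt from its basis expansion one term at a time. This serves both to
  generate the span and to apply the linearity relations of the currents.\<close>

lemma skew_mats_induct:
  assumes x: "x \<in> skew_mats n" and zero: "P (0\<^sub>m n n)"
    and step: "\<And>i j y. (i, j) \<in> basis_idx n \<Longrightarrow> y \<in> carrier_mat n n \<Longrightarrow> P y \<Longrightarrow> P (x $$ (i, j) \<cdot>\<^sub>m Fmat n i j + y)"
  shows "P x"
proof -
  define S where "S A = mat n n (\<lambda>(k, l). \<Sum>(i, j)\<in>A. x $$ (i, j) * Fmat n i j $$ (k, l))" for A
  have dims: "dim_row (S A) = n" "dim_col (S A) = n" for A
    unfolding S_def by simp_all
  have S_index: "S A $$ (k, l) = (\<Sum>p\<in>A. x $$ p * Fmat n (fst p) (snd p) $$ (k, l))"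
    if "k < n" "l < n" for A k l
    unfolding S_def by (simp only: index_mat(1)[OF that] prod.case case_prod_unfold prod.collapse)
  have "P (S A)" if "finite A" "A \<subseteq> basis_idx n" for A
    using that
  proof (induction A rule: finite_induct)
    case empty
    have "S {} = 0\<^sub>m n n" by (rule eq_matI) (simp_all add: S_index dims)
    then show ?case using zero by simp
  next
    case (insert p A)
    obtain i j where p: "p = (i, j)" by force
    have "S (insert p A) = x $$ (i, j) \<cdot>\<^sub>m Fmat n i j + S A"
      using insert.hyps carrier_matD[OF Fmat_carrier[of n i j]]
      by (intro eq_matI) (simp_all add: S_index dims p)
    moreover have "S A \<in> carrier_mat n n" by (rule carrier_matI) (simp_all only: dims)
    ultimately show ?case
      using step[of i j "S A"] insert p by simp
  qed
  moreover have "S (basis_idx n) = x"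
  proof (rule eq_matI)
    show "dim_row (S (basis_idx n)) = dim_row x" "dim_col (S (basis_idx n)) = dim_col x"
      using x by (auto simp: dims skew_mats_def)
    fix k l assume "k < dim_row x" "l < dim_col x"
    then have kl: "k < n" "l < n" using x by (auto simp: skew_mats_def)
    have sk: "skew n (\<lambda>i j. x $$ (i, j))" using x by (simp add: skew_mats_def)
    show "S (basis_idx n) $$ (k, l) = x $$ (k, l)"
      using basis_idx_expansion[OF sk skew_diag[OF sk] kl]
      by (simp only: S_index[OF kl] Fmat_index[OF kl] case_prod_unfold prod.collapse)
  qed
  ultimately show ?thesis by (metis finite_basis_idx order_refl)
qed

lemma skew_Fmat: "i < n \<Longrightarrow> j < n \<Longrightarrow> skew n (\<lambda>k l. Fmat n i j $$ (k, l))"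
  unfolding skew_def
proof (intro allI impI)
  fix k l assume ij: "i < n" "j < n" and kl: "k < n" "l < n"
  then have kl': "n - 1 - l < n" "n - 1 - k < n" by linarith+
  have e: "n - 1 - l = i \<longleftrightarrow> l = n - 1 - i" "n - 1 - k = j \<longleftrightarrow> k = n - 1 - j"
    "n - 1 - l = n - 1 - j \<longleftrightarrow> l = j" "n - 1 - k = n - 1 - i \<longleftrightarrow> k = i"
    using ij kl by linarith+
  show "Fmat n i j $$ (k, l) = - Fmat n i j $$ (n - 1 - l, n - 1 - k)"
    unfolding Fmat_index[OF kl] Fmat_index[OF kl'] e by (simp only: minus_diff_eq conj_commute)
qed

lemma skew_mats_Fmat: "i < n \<Longrightarrow> j < n \<Longrightarrow> Fmat n i j \<in> skew_mats n"
  by (simp add: skew_mats_def skew_Fmat)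

lemma skew_mats_zero: "0\<^sub>m n n \<in> skew_mats n"
  by (simp add: skew_mats_def skew_def)

lemma skew_cong:
  assumes "skew n Z" "\<And>i j. i < n \<Longrightarrow> j < n \<Longrightarrow> W i j = Z i j"
  shows "skew n W"
  unfolding skew_def
proof (intro allI impI)
  fix i j assume ij: "i < n" "j < n"
  then have "n - 1 - j < n" "n - 1 - i < n" by linarith+
  then show "W i j = - W (n - 1 - j) (n - 1 - i)"
    using assms(2)[OF ij] assms(2)[of "n - 1 - j" "n - 1 - i"] assms(1) ij
    unfolding skew_def by metis
qed

lemma skew_smult: "skew n Z \<Longrightarrow> skew n (\<lambda>i j. c * Z i j)"
  unfolding skew_def by (metis mult_minus_right)

lemma skew_mats_add:
  assumes "x \<in> skew_mats n" "y \<in> skew_mats n"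
  shows "x + y \<in> skew_mats n"
proof -
  have c: "x \<in> carrier_mat n n" "y \<in> carrier_mat n n"
    and s: "skew n (\<lambda>i j. x $$ (i, j))" "skew n (\<lambda>i j. y $$ (i, j))"
    using assms by (simp_all add: skew_mats_def)
  have "skew n (\<lambda>i j. (x + y) $$ (i, j))"
    by (rule skew_cong[OF skew_add[OF s]]) (use c in auto)
  with c show ?thesis by (simp add: skew_mats_def)
qed

lemma skew_mats_smult:
  assumes "x \<in> skew_mats n"
  shows "c \<cdot>\<^sub>m x \<in> skew_mats n"
proof -
  have c: "x \<in> carrier_mat n n" and s: "skew n (\<lambda>i j. x $$ (i, j))"
    using assms by (simp_all add: skew_mats_def)
  have "skew n (\<lambda>i j. (c \<cdot>\<^sub>m x) $$ (i, j))"
    by (rule skew_cong[OF skew_smult[OF s]]) (use c in auto)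
  with c show ?thesis by (simp add: skew_mats_def)
qed

text \<open>The generators are skew, and the basis expansion recovers every skew matrix. The
  skewness condition makes closure under the commutator easy to see.\<close>

lemma so_eq: "so n = skew_mats n"
proof
  interpret vectorspace "class_ring :: complex ring" "module_mat TYPE(complex) n n"
    by (rule matrix_vs)
  let ?M = "module_mat TYPE(complex) n n"
  let ?S = "{Fmat n i j | i j. i < n \<and> j < n}"
  have S: "?S \<subseteq> carrier ?M" by (auto simp: module_mat_simps)
  have "submodule class_ring (skew_mats n) ?M"
    by (intro submodule.intro module_axioms)
      (auto simp: module_mat_simps class_ring_simps skew_mats_add skew_mats_zero skew_mats_smult
        dest: skew_mats_carrier)
  then show "so n \<subseteq> skew_mats n"
    unfolding so_def by (intro span_is_subset) (auto simp: skew_mats_Fmat)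
  have sub: "submodule class_ring (so n) ?M"
    unfolding so_def by (rule span_is_submodule[OF S])
  have F: "Fmat n i j \<in> so n" if "(i, j) \<in> basis_idx n" for i j
    using in_own_span[OF S] basis_idxD[OF that] unfolding so_def by blast
  show "skew_mats n \<subseteq> so n"
  proof
    fix x assume "x \<in> skew_mats n"
    then show "x \<in> so n"
    proof (rule skew_mats_induct)
      show "0\<^sub>m n n \<in> so n"
        using submodule.zero_closed[OF sub] by (simp add: module_mat_simps)
      fix i j y assume "(i, j) \<in> basis_idx n" "y \<in> so n"
      then show "x $$ (i, j) \<cdot>\<^sub>m Fmat n i j + y \<in> so n"
        using submodule.m_closed[OF sub] submodule.smult_closed[OF sub] F
        by (simp add: module_mat_simps class_ring_simps)
    qed
  qed
qed

lemma so_carrier: "x \<in> so n \<Longrightarrow> x \<in> carrier_mat n n"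
  and so_skew: "x \<in> so n \<Longrightarrow> skew n (\<lambda>i j. x $$ (i, j))"
  by (simp_all add: so_eq skew_mats_def)

lemma so_Fmat: "i < n \<Longrightarrow> j < n \<Longrightarrow> Fmat n i j \<in> so n"
  and so_add: "x \<in> so n \<Longrightarrow> y \<in> so n \<Longrightarrow> x + y \<in> so n"
  and so_smult: "x \<in> so n \<Longrightarrow> c \<cdot>\<^sub>m x \<in> so n"
  and so_zero: "0\<^sub>m n n \<in> so n"
  by (simp_all add: so_eq skew_mats_Fmat skew_mats_add skew_mats_smult skew_mats_zero)

lemma lie_index:
  assumes "x \<in> carrier_mat n n" "y \<in> carrier_mat n n" "i < n" "j < n"
  shows "lie x y $$ (i, j) = bracket n (\<lambda>i j. x $$ (i, j)) (\<lambda>i j. y $$ (i, j)) i j"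
  using assms
  by (simp add: lie_def bracket_def scalar_prod_def sum_subtractf atLeast0LessThan)

lemma lie_carrier: "x \<in> carrier_mat n n \<Longrightarrow> y \<in> carrier_mat n n \<Longrightarrow> lie x y \<in> carrier_mat n n"
  unfolding lie_def by (intro minus_carrier_mat mult_carrier_mat[of _ n n])

lemma so_lie:
  assumes "x \<in> so n" "y \<in> so n"
  shows "lie x y \<in> so n"
proof -
  note xy = so_carrier[OF assms(1)] so_carrier[OF assms(2)]
  have "skew n (bracket n (\<lambda>i j. x $$ (i, j)) (\<lambda>i j. y $$ (i, j)))"
    by (intro skew_bracket so_skew assms)
  then have "skew n (\<lambda>i j. lie x y $$ (i, j))"
    by (rule skew_cong) (rule lie_index[OF xy])
  with lie_carrier[OF xy] show ?thesis by (simp add: so_eq skew_mats_def)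
qed

lemma form_eq:
  assumes "x \<in> carrier_mat n n" "y \<in> carrier_mat n n"
  shows "form x y = (\<Sum>i<n. \<Sum>k<n. x $$ (i, k) * y $$ (k, i)) / 2"
proof -
  have "(\<Sum>i<dim_row x. (x * y) $$ (i, i)) = (\<Sum>i<n. \<Sum>k<n. x $$ (i, k) * y $$ (k, i))"
    using assms by (intro sum.cong) (auto simp: scalar_prod_def atLeast0LessThan)
  then show ?thesis by (simp add: form_def)
qed

subsection \<open>The left ideal of the vacuum vector\<close>

text \<open>This is the carrier of the tensor ring, but over any coefficient ring, since it also has
  to describe words with polynomial coefficients.\<close>

definition word_span :: "'a set \<Rightarrow> ('a fword \<Rightarrow>\<^sub>0 'c::ring_1) set" where
  "word_span X = {p. \<forall>w \<in> Poly_Mapping.keys p. set (letters w) \<subseteq> X}"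

lemma word_span_zero [simp]: "0 \<in> word_span X" and word_span_one [simp]: "1 \<in> word_span X"
  by (simp_all add: word_span_def zero_fword_def)

lemma word_span_add: "p \<in> word_span X \<Longrightarrow> q \<in> word_span X \<Longrightarrow> p + q \<in> word_span X"
  using Poly_Mapping.keys_add[of p q] by (auto simp: word_span_def)

lemma word_span_uminus: "p \<in> word_span X \<Longrightarrow> - p \<in> word_span X"
  by (auto simp: word_span_def in_keys_iff)

lemma word_span_diff: "p \<in> word_span X \<Longrightarrow> q \<in> word_span X \<Longrightarrow> p - q \<in> word_span X"
  using word_span_add[OF _ word_span_uminus, of p X q] by simp

lemma word_span_mult:
  assumes "p \<in> word_span X" "q \<in> word_span X"
  shows "p * q \<in> word_span X"
  unfolding word_span_def
proof (clarify)
  fix w x assume "w \<in> Poly_Mapping.keys (p * q)" "x \<in> set (letters w)"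
  moreover then obtain u v where "w = u + v" "u \<in> Poly_Mapping.keys p" "v \<in> Poly_Mapping.keys q"
    using keys_mult[of p q] by blast
  ultimately show "x \<in> X"
    using assms unfolding word_span_def plus_fword_def by auto
qed

lemma word_span_power: "p \<in> word_span X \<Longrightarrow> p ^ k \<in> word_span X"
  by (induction k) (simp_all add: word_span_mult)

lemma word_span_single: "set ws \<subseteq> X \<Longrightarrow> Poly_Mapping.single (Word ws) c \<in> word_span X"
  by (simp add: word_span_def keys_single)

lemma word_span_scal: "p \<in> word_span X \<Longrightarrow> scal c p \<in> word_span X"
  by (auto simp: word_span_def in_keys_iff)

lemma word_span_letter: "g \<in> X \<Longrightarrow> letter g \<in> word_span X"
  by (simp add: letter_def word_span_single)

lemma word_span_sum: "(\<And>x. x \<in> A \<Longrightarrow> f x \<in> word_span X) \<Longrightarrow> sum f A \<in> word_span X"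
  by (induction A rule: infinite_finite_induct) (auto intro: word_span_add)

lemma word_span_induct [consumes 1, case_names zero single add]:
  assumes "f \<in> word_span X" and "P 0"
    and "\<And>ws c. set ws \<subseteq> X \<Longrightarrow> P (Poly_Mapping.single (Word ws) c)"
    and "\<And>f g. P f \<Longrightarrow> P g \<Longrightarrow> P (f + g)"
  shows "P f"
proof -
  have "P (\<Sum>w\<in>A. Poly_Mapping.single w (Poly_Mapping.lookup f w))" if "finite A" "A \<subseteq> Poly_Mapping.keys f" for A
    using that
  proof (induction A rule: finite_induct)
    case (insert w A)
    moreover obtain ws where "w = Word ws" by (cases w)
    ultimately show ?case using assms by (auto simp: word_span_def)
  qed (use assms in simp)
  then show ?thesis
    by (subst poly_mapping_sum_single) simp
qed

lemma tensor_ring_simps: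
  "carrier (tensor_ring X) = word_span X" "mult (tensor_ring X) = (*)" "one (tensor_ring X) = 1"
  "zero (tensor_ring X) = 0" "add (tensor_ring X) = (+)"
  by (simp_all add: tensor_ring_def word_span_def)

lemma additive_subgroup_tensor:
  assumes "J \<subseteq> word_span X" "0 \<in> J" "\<And>p q. p \<in> J \<Longrightarrow> q \<in> J \<Longrightarrow> p + q \<in> J" "\<And>p. p \<in> J \<Longrightarrow> - p \<in> J"
  shows "additive_subgroup J (tensor_ring X)"
proof -
  interpret ring "tensor_ring X" by (rule ring_tensor_ring)
  have inv: "\<ominus>\<^bsub>tensor_ring X\<^esub> p = - p" if "p \<in> word_span X" for p
    by (rule minus_equality) (simp_all add: tensor_ring_simps that word_span_uminus)
  show ?thesis
  proof (intro additive_subgroupI subgroup.intro)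
    fix p assume p: "p \<in> J"
    then have "inv\<^bsub>add_monoid (tensor_ring X)\<^esub> p = - p"
      using inv[of p] assms(1) by (auto simp: a_inv_def)
    then show "inv\<^bsub>add_monoid (tensor_ring X)\<^esub> p \<in> J"
      using assms(4)[OF p] by simp
  qed (use assms in \<open>auto simp: tensor_ring_simps\<close>)
qed

lemma additive_subgroup_tensorD:
  assumes "additive_subgroup J (tensor_ring X)"
  shows "J \<subseteq> word_span X" "0 \<in> J" "\<And>p q. p \<in> J \<Longrightarrow> q \<in> J \<Longrightarrow> p + q \<in> J"
  using additive_subgroup.a_subset[OF assms] additive_subgroup.zero_closed[OF assms]
    additive_subgroup.a_closed[OF assms]
  by (simp_all add: tensor_ring_simps)

lemma genideal_tensor:
  assumes "S \<subseteq> word_span X"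
  defines "I \<equiv> Idl\<^bsub>tensor_ring X\<^esub> S"
  shows "I \<subseteq> word_span X" "S \<subseteq> I" "0 \<in> I" "\<And>p q. p \<in> I \<Longrightarrow> q \<in> I \<Longrightarrow> p + q \<in> I" "\<And>p. p \<in> I \<Longrightarrow> - p \<in> I"
    "\<And>a p. a \<in> word_span X \<Longrightarrow> p \<in> I \<Longrightarrow> a * p \<in> I" "\<And>a p. a \<in> word_span X \<Longrightarrow> p \<in> I \<Longrightarrow> p * a \<in> I"
proof -
  interpret ring "tensor_ring X" by (rule ring_tensor_ring)
  have I: "ideal I (tensor_ring X)"
    unfolding I_def by (rule genideal_ideal) (simp add: tensor_ring_simps assms)
  note D = additive_subgroup_tensorD[OF ideal.axioms(1)[OF I]]
  show "I \<subseteq> word_span X" "0 \<in> I" "\<And>p q. p \<in> I \<Longrightarrow> q \<in> I \<Longrightarrow> p + q \<in> I" by (fact D)+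
  show "S \<subseteq> I"
    unfolding I_def by (rule genideal_self) (simp add: tensor_ring_simps assms)
  show l: "a * p \<in> I" "p * a \<in> I" if "a \<in> word_span X" "p \<in> I" for a p
    using ideal.I_l_closed[OF I] ideal.I_r_closed[OF I] that by (simp_all add: tensor_ring_simps)
  show "- p \<in> I" if "p \<in> I" for p
    using l(1)[of "- 1" p] that by (simp add: word_span_uminus)
qed

text \<open>The members of the ideal that satisfy \<open>P\<close> form an ideal containing the
  generators. Membership is carried along, so the product steps may use it.\<close>

lemma genideal_tensor_induct:
  assumes S: "S \<subseteq> word_span X" and x: "x \<in> Idl\<^bsub>tensor_ring X\<^esub> S" and zero: "P 0"
    and gen: "\<And>r. r \<in> S \<Longrightarrow> P r"
    and add: "\<And>p q. P p \<Longrightarrow> P q \<Longrightarrow> P (p + q)" and neg: "\<And>p. P p \<Longrightarrow> P (- p)"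
    and l: "\<And>a p. a \<in> word_span X \<Longrightarrow> p \<in> Idl\<^bsub>tensor_ring X\<^esub> S \<Longrightarrow> P p \<Longrightarrow> P (a * p)"
    and r: "\<And>a p. a \<in> word_span X \<Longrightarrow> p \<in> Idl\<^bsub>tensor_ring X\<^esub> S \<Longrightarrow> P p \<Longrightarrow> P (p * a)"
  shows "P x"
proof -
  interpret ring "tensor_ring X" by (rule ring_tensor_ring)
  let ?I = "Idl\<^bsub>tensor_ring X\<^esub> S"
  note G = genideal_tensor[OF S]
  have "ideal {p \<in> ?I. P p} (tensor_ring X)"
  proof (intro ideal.intro ideal_axioms.intro ring_tensor_ring additive_subgroup_tensor)
    show "{p \<in> ?I. P p} \<subseteq> word_span X" using G(1) by blast
  qed (use G zero add neg l r in \<open>auto simp: tensor_ring_simps\<close>)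
  then have "?I \<subseteq> {p \<in> ?I. P p}"
    by (rule genideal_minimal) (use G(2) gen in blast)
  with x show ?thesis by blast
qed

lemma left_ideal_gen_tensor:
  assumes S: "S \<subseteq> word_span X"
  defines "J \<equiv> left_ideal_gen (tensor_ring X) S"
  shows "J \<subseteq> word_span X" "S \<subseteq> J" "0 \<in> J" "\<And>p q. p \<in> J \<Longrightarrow> q \<in> J \<Longrightarrow> p + q \<in> J" "\<And>p. p \<in> J \<Longrightarrow> - p \<in> J"
    "\<And>a p. a \<in> word_span X \<Longrightarrow> p \<in> J \<Longrightarrow> a * p \<in> J"
proof -
  have J: "J = \<Inter>{J. additive_subgroup J (tensor_ring X) \<and> (\<forall>a\<in>word_span X. \<forall>x\<in>J. a * x \<in> J) \<and> S \<subseteq> J}"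
    by (simp add: J_def left_ideal_gen_def tensor_ring_simps)
  have "additive_subgroup (word_span X) (tensor_ring X)"
    by (rule additive_subgroup_tensor) (auto intro: word_span_add word_span_uminus)
  then show "J \<subseteq> word_span X"
    unfolding J using S by (intro Inter_lower) (auto intro: word_span_mult)
  show "S \<subseteq> J" unfolding J by blast
  show "0 \<in> J" unfolding J using additive_subgroup_tensorD(2) by blast
  show "p + q \<in> J" if "p \<in> J" "q \<in> J" for p q
    using that unfolding J by (auto intro: additive_subgroup_tensorD(3))
  show l: "a * p \<in> J" if "a \<in> word_span X" "p \<in> J" for a p
    using that unfolding J by blast
  show "- p \<in> J" if "p \<in> J" for p
    using l[of "- 1" p] that by (simp add: word_span_uminus)
qed

lemma left_ideal_gen_tensor_induct:
  assumes S: "S \<subseteq> word_span X" and x: "x \<in> left_ideal_gen (tensor_ring X) S" and zero: "P 0"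
    and gen: "\<And>r. r \<in> S \<Longrightarrow> P r"
    and add: "\<And>p q. P p \<Longrightarrow> P q \<Longrightarrow> P (p + q)" and neg: "\<And>p. P p \<Longrightarrow> P (- p)"
    and l: "\<And>a p. a \<in> word_span X \<Longrightarrow> p \<in> left_ideal_gen (tensor_ring X) S \<Longrightarrow> P p \<Longrightarrow> P (a * p)"
  shows "P x"
proof -
  let ?J = "left_ideal_gen (tensor_ring X) S"
  note G = left_ideal_gen_tensor[OF S]
  have "additive_subgroup {p \<in> ?J. P p} (tensor_ring X)"
    by (rule additive_subgroup_tensor) (use G zero add neg in auto)
  then have "?J \<subseteq> {p \<in> ?J. P p}"
    unfolding left_ideal_gen_def[of _ S]
    by (intro Inter_lower CollectI conjI)
      (use G gen l in \<open>auto simp: tensor_ring_simps left_ideal_gen_def\<close>)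
  with x show ?thesis by blast
qed

definition aff_letters :: "nat \<Rightarrow> aff set" where
  "aff_letters n = insert Cent (cur_letters n UNIV)"

lemma Cur_aff_letters: "x \<in> so n \<Longrightarrow> Cur x a \<in> aff_letters n"
  by (auto simp: aff_letters_def cur_letters_def)

lemma Cent_aff_letters: "Cent \<in> aff_letters n"
  by (simp add: aff_letters_def)

lemma aff_letters_cases: "g \<in> aff_letters n \<Longrightarrow> (g = Cent \<Longrightarrow> P) \<Longrightarrow> (\<And>x a. g = Cur x a \<Longrightarrow> x \<in> so n \<Longrightarrow> P) \<Longrightarrow> P"
  by (auto simp: aff_letters_def cur_letters_def)

lemmas word_span_intros = word_span_add word_span_diff word_span_mult word_span_scal word_span_letter word_span_uminus

definition aff_ideal :: "nat \<Rightarrow> aff tenalg set" where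
  "aff_ideal n = Idl\<^bsub>aff_ring n\<^esub> (aff_rels n)"

lemma aff_rels_word_span: "aff_rels n \<subseteq> word_span (aff_letters n)"
  unfolding aff_rels_def cur_rels_def
  by (auto intro!: word_span_intros Cur_aff_letters Cent_aff_letters so_add so_smult so_lie)

lemma aff_ideal_alt: "aff_ideal n = Idl\<^bsub>tensor_ring (aff_letters n)\<^esub> (aff_rels n)"
  by (simp add: aff_ideal_def aff_ring_def aff_letters_def)

lemmas aff_ideal_facts = genideal_tensor[OF aff_rels_word_span, folded aff_ideal_alt]
lemmas aff_ideal_word_span = aff_ideal_facts(1)[THEN subsetD]
  and aff_ideal_rel = aff_ideal_facts(2)[THEN subsetD]
  and aff_ideal_zero = aff_ideal_facts(3) and aff_ideal_add = aff_ideal_facts(4) and aff_ideal_uminus = aff_ideal_facts(5)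
  and aff_ideal_lmult = aff_ideal_facts(6) and aff_ideal_rmult = aff_ideal_facts(7)
lemmas aff_ideal_induct = genideal_tensor_induct[OF aff_rels_word_span, folded aff_ideal_alt, consumes 1, case_names zero gen add uminus left right]

lemma aff_ideal_scal: "p \<in> aff_ideal n \<Longrightarrow> scal c p \<in> aff_ideal n"
  using aff_ideal_lmult[OF word_span_scal[OF word_span_one], of p n c] by simp

lemma aff_ideal_Cur_add: "x \<in> so n \<Longrightarrow> y \<in> so n \<Longrightarrow> letter (Cur (x + y) a) - letter (Cur x a) - letter (Cur y a) \<in> aff_ideal n"
  by (rule aff_ideal_rel) (unfold aff_rels_def cur_rels_def, blast)

lemma aff_ideal_Cur_smult: "x \<in> so n \<Longrightarrow> letter (Cur (c \<cdot>\<^sub>m x) a) - scal c (letter (Cur x a)) \<in> aff_ideal n"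
  by (rule aff_ideal_rel) (unfold aff_rels_def cur_rels_def, blast)

lemma aff_ideal_Cur_lie: "x \<in> so n \<Longrightarrow> y \<in> so n \<Longrightarrow>
   letter (Cur x a) * letter (Cur y b) - letter (Cur y b) * letter (Cur x a)
        - letter (Cur (lie x y) (a + b))
        - (if a + b = 0 then scal (of_int a * form x y) (letter Cent) else 0) \<in> aff_ideal n"
  by (rule aff_ideal_rel) (unfold aff_rels_def cur_rels_def, blast)

lemma aff_ideal_Cent: "x \<in> so n \<Longrightarrow> letter Cent * letter (Cur x a) - letter (Cur x a) * letter Cent \<in> aff_ideal n"
  by (rule aff_ideal_rel) (unfold aff_rels_def, blast)

subsection \<open>The translation operator\<close>

lemma Word_mult: "Poly_Mapping.single (Word v) c * Poly_Mapping.single (Word w) d = Poly_Mapping.single (Word (v @ w)) (c * d)"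
  by (simp add: mult_single plus_fword_def)

lemma Word_Cons: "letter g * Poly_Mapping.single (Word gs) c = Poly_Mapping.single (Word (g # gs)) c"
  by (simp add: letter_def Word_mult)

lemma Word_Nil: "Poly_Mapping.single (Word []) 1 = 1"
  by (metis single_one zero_fword_def)

lemma tau_word_append:
  "tau_word (v @ w) = tau_word v * Poly_Mapping.single (Word w) 1 + Poly_Mapping.single (Word v) 1 * tau_word w"
proof (induction v)
  case Nil
  show ?case by (simp add: Word_Nil)
next
  case (Cons g v)
  show ?case
    by (simp add: Cons.IH distrib_left distrib_right mult.assoc Word_mult Word_Cons[symmetric] add.assoc)
qed

lemma tau_der_single: "tau_der (Poly_Mapping.single (Word w) c) = scal c (tau_word w)"
  by (simp add: tau_der_def)

lemma clinear_tau_der: "clinear_map tau_der"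
  unfolding tau_der_def by (rule clinear_lin_ext)

lemma additive_tau_der: "additive tau_der"
  using clinear_tau_der by (simp add: clinear_map_def)

lemma derivation_tau_der: "derivation tau_der"
  unfolding derivation_def
proof (intro conjI allI additive_tau_der)
  fix p q
  show "tau_der (p * q) = tau_der p * q + p * tau_der q"
  proof (induction p rule: poly_mapping_single_induct)
    case (single v c)
    show ?case
    proof (induction q rule: poly_mapping_single_induct)
      case (single w d)
      obtain v' w' where vw: "v = Word v'" "w = Word w'" by (metis fword.exhaust)
      have 1: "tau_word v' * Poly_Mapping.single (Word w') d = scal d (tau_word v' * Poly_Mapping.single (Word w') 1)"
        "Poly_Mapping.single (Word v') c * tau_word w' = scal c (Poly_Mapping.single (Word v') 1 * tau_word w')"
        using mult_scal_right[of "tau_word v'" d "Poly_Mapping.single (Word w') 1"]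
          scal_mult_left[of c "Poly_Mapping.single (Word v') 1" "tau_word w'"] by simp_all
      have "tau_der (Poly_Mapping.single v c * Poly_Mapping.single w d) = scal (c * d) (tau_word (v' @ w'))"
        by (simp add: vw Word_mult tau_der_single)
      also have "\<dots> = tau_der (Poly_Mapping.single v c) * Poly_Mapping.single w d
          + Poly_Mapping.single v c * tau_der (Poly_Mapping.single w d)"
        by (simp add: vw tau_der_single tau_word_append 1 scal_add_right mult.commute)
      finally show ?case .
    qed (simp add: distrib_left additive.add[OF additive_tau_der])
  qed (simp add: distrib_right additive.add[OF additive_tau_der])
qed

lemma tau_der_letter: "tau_der (letter g) = tau_letter g"
  by (simp add: letter_def tau_der_single Word_Nil)

lemma tau_der_scal: "tau_der (scal c p) = scal c (tau_der p)"
  by (rule clinear_map_scal[OF clinear_tau_der])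

lemmas tau_der_simps = derivation_mult[OF derivation_tau_der] derivation_add[OF derivation_tau_der]
  derivation_diff[OF derivation_tau_der] derivation_one[OF derivation_tau_der]
  derivation_zero[OF derivation_tau_der] tau_der_letter tau_der_scal
  clinear_map_uminus[OF clinear_tau_der]

lemma tau_letter_word_span: "g \<in> aff_letters n \<Longrightarrow> tau_letter g \<in> word_span (aff_letters n)"
  by (erule aff_letters_cases) (auto intro!: word_span_intros Cur_aff_letters)

lemma tau_word_word_span: "set w \<subseteq> aff_letters n \<Longrightarrow> tau_word w \<in> word_span (aff_letters n)"
  by (induction w) (auto intro!: word_span_intros tau_letter_word_span word_span_single)

lemma tau_der_word_span: "p \<in> word_span (aff_letters n) \<Longrightarrow> tau_der p \<in> word_span (aff_letters n)"
  by (induction p rule: word_span_induct)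
    (auto simp: tau_der_simps tau_der_single intro!: word_span_intros tau_word_word_span)

text \<open>A derivation respects an ideal as soon as it maps the generators into it; each defining
  relation goes to a combination of relations with shifted degrees.\<close>

lemma aff_ideal_tau: "r \<in> aff_ideal n \<Longrightarrow> tau_der r \<in> aff_ideal n"
proof (induction r rule: aff_ideal_induct)
  case (gen r)
  then consider
    (sum) x y a where "r = letter (Cur (x + y) a) - letter (Cur x a) - letter (Cur y a)" "x \<in> so n" "y \<in> so n"
  | (smult) c x a where "r = letter (Cur (c \<cdot>\<^sub>m x) a) - scal c (letter (Cur x a))" "x \<in> so n"
  | (lie) x y a b where "r = letter (Cur x a) * letter (Cur y b) - letter (Cur y b) * letter (Cur x a)
        - letter (Cur (lie x y) (a + b))
        - (if a + b = 0 then scal (of_int a * form x y) (letter Cent) else 0)" "x \<in> so n" "y \<in> so n"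
  | (cent) x a where "r = letter Cent * letter (Cur x a) - letter (Cur x a) * letter Cent" "x \<in> so n"
    unfolding aff_rels_def cur_rels_def by blast
  then show ?case
  proof cases
    case sum
    have "tau_der r = scal (- of_int a) (letter (Cur (x + y) (a - 1)) - letter (Cur x (a - 1)) - letter (Cur y (a - 1)))"
      by (simp add: sum tau_der_simps scal_diff_right)
    then show ?thesis using aff_ideal_scal[OF aff_ideal_Cur_add] sum by metis
  next
    case smult
    have "tau_der r = scal (- of_int a) (letter (Cur (c \<cdot>\<^sub>m x) (a - 1)) - scal c (letter (Cur x (a - 1))))"
      by (simp add: smult tau_der_simps scal_diff_right mult.commute)
    then show ?thesis using aff_ideal_scal[OF aff_ideal_Cur_smult] smult by metis
  next
    case cent
    have "tau_der r = scal (- of_int a) (letter Cent * letter (Cur x (a - 1)) - letter (Cur x (a - 1)) * letter Cent)"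
      by (simp add: cent tau_der_simps scal_diff_right)
    then show ?thesis using aff_ideal_scal[OF aff_ideal_Cent] cent by metis
  next
    case lie
    define R where "R a b = letter (Cur x a) * letter (Cur y b) - letter (Cur y b) * letter (Cur x a)
        - letter (Cur (lie x y) (a + b))
        - (if a + b = 0 then scal (of_int a * form x y) (letter Cent) else 0)" for a b
    have R: "R a b \<in> aff_ideal n" for a b
      unfolding R_def by (rule aff_ideal_Cur_lie) fact+
    have e: "a - 1 + b = a + b - 1" "a + (b - 1) = a + b - 1" by simp_all
    have "tau_der r = scal (- of_int a) (R (a - 1) b) + scal (- of_int b) (R a (b - 1))"
    \<comment> \<open>Only for \<open>a + b = 1\<close> do the shifted relations contain central
      terms. Their coefficients are \<open>a * (a - 1)\<close> and \<open>a * b\<close> times the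
      form, and these cancel.\<close>
    proof (cases "a + b - 1 = 0")
      case True
      then have b: "b = 1 - a" by simp
      show ?thesis
        unfolding lie(1) R_def e by (simp add: b tau_der_simps scal_diff_right scal_add_right scal_minus_right scal_diff_left scal_add_left scal_minus_left algebra_simps)
    next
      case False
      then show ?thesis
        unfolding lie(1) R_def e by (simp add: tau_der_simps scal_diff_right scal_add_right scal_minus_right scal_diff_left scal_add_left scal_minus_left algebra_simps)
    qed
    then show ?thesis using aff_ideal_add aff_ideal_scal R by metis
  qed
qed (auto simp: tau_der_simps aff_ideal_zero intro: aff_ideal_add aff_ideal_uminus aff_ideal_lmult aff_ideal_rmult tau_der_word_span)

section \<open>Translation and the central letter in the vacuum module\<close>

definition vac_gens :: "nat \<Rightarrow> aff tenalg set" where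
  "vac_gens n = aff_ideal n \<union> letter ` cur_letters n {0..} \<union> {letter Cent + scal (dual_coxeter n) 1}"

lemma vac_gens_word_span: "vac_gens n \<subseteq> word_span (aff_letters n)"
proof -
  have "letter Cent + scal (dual_coxeter n) 1 \<in> word_span (aff_letters n)"
    by (intro word_span_intros Cent_aff_letters word_span_one)
  moreover have "letter ` cur_letters n {0..} \<subseteq> word_span (aff_letters n)"
    by (auto simp: cur_letters_def intro: word_span_letter Cur_aff_letters)
  ultimately show ?thesis
    unfolding vac_gens_def using aff_ideal_facts(1)[of n] by blast
qed

lemma vac_alt: "vac_ideal n = left_ideal_gen (tensor_ring (aff_letters n)) (vac_gens n)"
  by (simp add: vac_ideal_def vac_gens_def aff_ideal_def aff_ring_def aff_letters_def)

lemmas vac_facts = left_ideal_gen_tensor[OF vac_gens_word_span, folded vac_alt]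
lemmas vac_word_span = vac_facts(1)[THEN subsetD]
  and vac_gen = vac_facts(2)[THEN subsetD]
  and vac_zero = vac_facts(3) and vac_add = vac_facts(4) and vac_uminus = vac_facts(5)
  and vac_lmult = vac_facts(6)
lemmas vac_induct = left_ideal_gen_tensor_induct[OF vac_gens_word_span, folded vac_alt, consumes 1, case_names zero gen add uminus left]

lemma vac_diff: "p \<in> vac_ideal n \<Longrightarrow> q \<in> vac_ideal n \<Longrightarrow> p - q \<in> vac_ideal n"
  using vac_add[OF _ vac_uminus, of p n q] by simp

lemma vac_scal: "p \<in> vac_ideal n \<Longrightarrow> scal c p \<in> vac_ideal n"
  using vac_lmult[OF word_span_scal[OF word_span_one], of p n c] by simp

lemma vac_sum: "(\<And>x. x \<in> A \<Longrightarrow> f x \<in> vac_ideal n) \<Longrightarrow> sum f A \<in> vac_ideal n"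
  by (induction A rule: infinite_finite_induct) (auto intro: vac_add vac_zero)

lemma vac_aff_ideal: "r \<in> aff_ideal n \<Longrightarrow> r \<in> vac_ideal n"
  by (rule vac_gen) (simp add: vac_gens_def)

lemma vac_rel: "r \<in> aff_ideal n \<Longrightarrow> f \<in> word_span (aff_letters n) \<Longrightarrow> r * f \<in> vac_ideal n"
  by (intro vac_aff_ideal aff_ideal_rmult)

lemma vac_pos: "x \<in> so n \<Longrightarrow> 0 \<le> a \<Longrightarrow> letter (Cur x a) \<in> vac_ideal n"
  by (rule vac_gen) (auto simp: vac_gens_def cur_letters_def)

text \<open>The mode \<open>x[a]\<close> goes to a multiple of \<open>x[a - 1]\<close>, and the
  multiple is zero for \<open>a = 0\<close>, the one case that would leave the nonnegative modes.
  Hence translation descends to the vacuum module.\<close>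

lemma vac_tau: "r \<in> vac_ideal n \<Longrightarrow> tau_der r \<in> vac_ideal n"
proof (induction r rule: vac_induct)
  case (gen r)
  then consider "r \<in> aff_ideal n" | x a where "r = letter (Cur x a)" "x \<in> so n" "0 \<le> a"
    | "r = letter Cent + scal (dual_coxeter n) 1"
    by (auto simp: vac_gens_def cur_letters_def)
  then show ?case
  proof cases
    case 1
    then show ?thesis by (intro vac_aff_ideal aff_ideal_tau)
  next
    case 2
    then show ?thesis
      using vac_scal[OF vac_pos[of x n "a - 1"], of "- of_int a"]
      by (cases "a = 0") (simp_all add: tau_der_simps vac_zero)
  qed (simp add: tau_der_simps vac_zero)
qed (auto simp: tau_der_simps vac_zero intro: vac_add vac_uminus vac_lmult tau_der_word_span)

text \<open>A left ideal absorbs factors only on the left of its generator, so the central letter is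
  first carried through \<open>h\<close>, letter by letter, modulo the relations.\<close>

lemma vac_Cent:
  assumes "h \<in> word_span (aff_letters n)"
  shows "letter Cent * h + scal (dual_coxeter n) h \<in> vac_ideal n"
proof -
  have w: "letter Cent * Poly_Mapping.single (Word ws) 1 - Poly_Mapping.single (Word ws) 1 * letter Cent \<in> aff_ideal n"
    if "set ws \<subseteq> aff_letters n" for ws
    using that
  proof (induction ws)
    case Nil
    show ?case by (simp add: Word_Nil aff_ideal_zero)
  next
    case (Cons g ws)
    let ?w = "Poly_Mapping.single (Word ws) (1 :: complex)"
    have g: "letter Cent * letter g - letter g * letter Cent \<in> aff_ideal n"
      using Cons.prems by (auto elim!: aff_letters_cases intro: aff_ideal_Cent aff_ideal_zero)
    have "letter Cent * Poly_Mapping.single (Word (g # ws)) 1 - Poly_Mapping.single (Word (g # ws)) 1 * letter Cent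
       = (letter Cent * letter g - letter g * letter Cent) * ?w + letter g * (letter Cent * ?w - ?w * letter Cent)"
      by (simp add: Word_Cons[symmetric] algebra_simps)
    moreover have "\<dots> \<in> aff_ideal n"
      using Cons g by (intro aff_ideal_add aff_ideal_rmult aff_ideal_lmult word_span_single word_span_letter) auto
    ultimately show ?case by simp
  qed
  have "letter Cent * h - h * letter Cent \<in> aff_ideal n"
    using assms
  proof (induction h rule: word_span_induct)
    case (single ws c)
    have "letter Cent * Poly_Mapping.single (Word ws) c - Poly_Mapping.single (Word ws) c * letter Cent
        = scal c (letter Cent * Poly_Mapping.single (Word ws) 1 - Poly_Mapping.single (Word ws) 1 * letter Cent)"
    proof -
      have 1: "Poly_Mapping.single (Word ws) c = scal c (Poly_Mapping.single (Word ws) 1)" by simp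
      show ?thesis by (simp only: 1 scal_diff_right mult_scal_right scal_mult_left)
    qed
    then show ?case using aff_ideal_scal[OF w[OF single]] by simp
  next
    case (add f g)
    have "letter Cent * (f + g) - (f + g) * letter Cent
        = (letter Cent * f - f * letter Cent) + (letter Cent * g - g * letter Cent)"
      by (simp add: algebra_simps)
    then show ?case using aff_ideal_add[OF add] by simp
  qed (simp add: aff_ideal_zero)
  then have "(letter Cent * h - h * letter Cent) + h * (letter Cent + scal (dual_coxeter n) 1) \<in> vac_ideal n"
    by (intro vac_add vac_aff_ideal vac_lmult assms vac_gen) (simp_all add: vac_gens_def)
  then show ?thesis by (simp add: algebra_simps)
qed

text \<open>Letters are formal symbols, so \<open>x \<mapsto> x[a]\<close> becomes linear only
  modulo the relations; these are applied along the basis expansion of \<open>x\<close>.\<close>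

lemma Cur_expansion:
  assumes "x \<in> so n"
  shows "letter (Cur x a) - (\<Sum>p\<in>basis_idx n. scal (x $$ p) (letter (Cur (Fmat n (fst p) (snd p)) a))) \<in> aff_ideal n"
proof -
  define E where "E y = (\<Sum>p\<in>basis_idx n. scal (y $$ p) (letter (Cur (Fmat n (fst p) (snd p)) a)))" for y
  have "x \<in> so n \<and> letter (Cur x a) - E x \<in> aff_ideal n"
  proof (rule skew_mats_induct[of x n])
    show "x \<in> skew_mats n" using assms by (simp add: so_eq)
    have "E (0\<^sub>m n n) = 0"
      unfolding E_def by (rule sum.neutral) (auto simp: basis_idx_def)
    \<comment> \<open>The zero matrix has a letter of its own, which vanishes only through the
      relation for the scalar 0.\<close>
    moreover have "0 \<cdot>\<^sub>m 0\<^sub>m n n = (0\<^sub>m n n :: complex mat)" by (rule eq_matI) auto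
    ultimately show "0\<^sub>m n n \<in> so n \<and> letter (Cur (0\<^sub>m n n) a) - E (0\<^sub>m n n) \<in> aff_ideal n"
      using aff_ideal_Cur_smult[OF so_zero, of 0 n a] so_zero[of n] by simp
  next
    fix i j y
    assume ij: "(i, j) \<in> basis_idx n" and y: "y \<in> carrier_mat n n" and IH: "y \<in> so n \<and> letter (Cur y a) - E y \<in> aff_ideal n"
    let ?c = "x $$ (i, j)" and ?F = "Fmat n i j"
    have F: "?F \<in> so n" using basis_idxD[OF ij] by (simp add: so_Fmat)
    have cF: "?c \<cdot>\<^sub>m ?F \<in> so n" by (rule so_smult[OF F])
    have "(?c \<cdot>\<^sub>m ?F + y) $$ p = (if p = (i, j) then ?c else 0) + y $$ p" if "p \<in> basis_idx n" for p
    proof -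
      obtain k l where p: "p = (k, l)" by force
      have kl: "k < n" "l < n" "k < n - 1 - l" using that by (auto simp: p basis_idx_def)
      have "\<not> (k = n - 1 - j \<and> l = n - 1 - i)"
        using kl ij by (auto simp: basis_idx_def)
      then have "?F $$ (k, l) = (if k = i \<and> l = j then 1 else 0)"
        unfolding Fmat_index[OF kl(1,2)] by simp
      moreover have "(?c \<cdot>\<^sub>m ?F + y) $$ (k, l) = ?c * ?F $$ (k, l) + y $$ (k, l)"
        using y kl carrier_matD[OF Fmat_carrier[of n i j]] by simp
      ultimately show ?thesis by (simp add: p)
    qed
    then have "E (?c \<cdot>\<^sub>m ?F + y) = (\<Sum>p\<in>basis_idx n. (if p = (i, j) then scal ?c (letter (Cur (Fmat n (fst p) (snd p)) a)) else 0)) + E y"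
      unfolding E_def sum.distrib[symmetric] by (intro sum.cong) (auto simp: scal_add_left)
    then have E: "E (?c \<cdot>\<^sub>m ?F + y) = scal ?c (letter (Cur ?F a)) + E y"
      using ij by (simp add: sum.delta)
    have "letter (Cur (?c \<cdot>\<^sub>m ?F + y) a) - E (?c \<cdot>\<^sub>m ?F + y)
       = (letter (Cur (?c \<cdot>\<^sub>m ?F + y) a) - letter (Cur (?c \<cdot>\<^sub>m ?F) a) - letter (Cur y a))
         + (letter (Cur (?c \<cdot>\<^sub>m ?F) a) - scal ?c (letter (Cur ?F a))) + (letter (Cur y a) - E y)"
      unfolding E by (simp add: algebra_simps)
    also have "\<dots> \<in> aff_ideal n"
      using IH by (intro aff_ideal_add aff_ideal_Cur_add aff_ideal_Cur_smult cF F) auto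
    finally show "?c \<cdot>\<^sub>m ?F + y \<in> so n \<and> letter (Cur (?c \<cdot>\<^sub>m ?F + y) a) - E (?c \<cdot>\<^sub>m ?F + y) \<in> aff_ideal n"
      using IH cF so_add by blast
  qed
  then show ?thesis by (simp add: E_def)
qed

section \<open>Evaluation at 1 of words in the translation and the currents\<close>

lemma clinear_on_one: "clinear_map on_one"
  unfolding on_one_def by (rule clinear_lin_ext)

lemma on_one_Word: "on_one (Poly_Mapping.single (Word gs) c) = scal c (word_on_one gs)"
  by (simp add: on_one_def)

lemma on_one_Some: "on_one (letter (Some y) * f) = letter y * on_one f"
proof (rule clinear_map_eqI[where F = "\<lambda>f. on_one (letter (Some y) * f)" and G = "\<lambda>f. letter y * on_one f"])
  show "clinear_map (\<lambda>f. on_one (letter (Some y) * f))"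
    by (rule clinear_map_comp[OF clinear_on_one clinear_map_mult_left])
  show "clinear_map (\<lambda>f. letter y * on_one f)"
    by (rule clinear_map_comp[OF clinear_map_mult_left clinear_on_one])
  fix w :: "aff option fword"
  show "on_one (letter (Some y) * Poly_Mapping.single w 1) = letter y * on_one (Poly_Mapping.single w 1)"
    by (cases w) (simp add: Word_Cons on_one_Word)
qed

lemma on_one_None: "on_one (letter None * f) = tau_der (on_one f)"
proof (rule clinear_map_eqI[where F = "\<lambda>f. on_one (letter None * f)" and G = "\<lambda>f. tau_der (on_one f)"])
  show "clinear_map (\<lambda>f. on_one (letter None * f))"
    by (rule clinear_map_comp[OF clinear_on_one clinear_map_mult_left])
  show "clinear_map (\<lambda>f. tau_der (on_one f))"
    by (rule clinear_map_comp[OF clinear_tau_der clinear_on_one])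
  fix w :: "aff option fword"
  show "on_one (letter None * Poly_Mapping.single w 1) = tau_der (on_one (Poly_Mapping.single w 1))"
    by (cases w) (simp add: Word_Cons on_one_Word)
qed

lemma on_one_one: "on_one 1 = 1"
  using on_one_Word[of "[]" 1] by (simp add: Word_Nil)

definition tau_letters :: "nat \<Rightarrow> aff option set" where
  "tau_letters n = insert None (Some ` aff_letters n)"

lemma word_on_one_word_span: "set gs \<subseteq> tau_letters n \<Longrightarrow> word_on_one gs \<in> word_span (aff_letters n)"
  by (induction gs) (auto simp: tau_letters_def intro!: word_span_intros tau_der_word_span split: option.splits)

lemma on_one_word_span: "f \<in> word_span (tau_letters n) \<Longrightarrow> on_one f \<in> word_span (aff_letters n)"
  by (induction f rule: word_span_induct)
    (auto simp: clinear_map_add[OF clinear_on_one] clinear_map_zero[OF clinear_on_one] on_one_Word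
      intro!: word_span_intros word_on_one_word_span)

subsection \<open>Words with polynomial coefficients\<close>

type_synonym galg = "aff option fword \<Rightarrow>\<^sub>0 gpoly"

definition gletter :: "aff option \<Rightarrow> galg" where
  "gletter g = Poly_Mapping.single (Word [g]) 1"

definition gscal :: "gpoly \<Rightarrow> galg" where
  "gscal p = Poly_Mapping.single 0 p"

abbreviation cst :: "complex \<Rightarrow> gpoly" where
  "cst c \<equiv> Poly_Mapping.single 0 c"

lemma gscal_add: "gscal (p + q) = gscal p + gscal q"
  and gscal_mult: "gscal (p * q) = gscal p * gscal q" and gscal_zero: "gscal 0 = 0" and gscal_one: "gscal 1 = 1"
  and gscal_uminus: "gscal (- p) = - gscal p"
  by (simp_all add: gscal_def single_add single_diff single_uminus mult_single)

lemma gscal_sum: "gscal (sum f A) = (\<Sum>x\<in>A. gscal (f x))"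
  by (simp add: gscal_def sum_single)

lemma gscal_commute: "f * gscal p = gscal p * f"
  by (rule additive_eqI[where F = "\<lambda>f. f * gscal p" and G = "\<lambda>f. gscal p * f"])
    (simp_all add: additive_def distrib_left distrib_right gscal_def mult_single mult.commute)

lemma gscal_left_commute: "f * (gscal p * g) = gscal p * (f * g)"
  by (metis gscal_commute mult.assoc)

lemma cmap_gletter:
  fixes \<phi> :: "gpoly \<Rightarrow> 'q::ring_1"
  shows "additive \<phi> \<Longrightarrow> cmap \<phi> (gletter g * f) = Poly_Mapping.single (Word [g]) 1 * cmap \<phi> f"
  by (simp add: gletter_def cmap_single_mult)

lemma cmap_gscal:
  fixes \<phi> :: "gpoly \<Rightarrow> 'q::ring_1"
  assumes "additive \<phi>"
  shows "cmap \<phi> (gscal p * f) = cmap (\<lambda>c. \<phi> (p * c)) f"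
proof -
  have "cmap \<phi> (gscal p * f) = Poly_Mapping.single 0 1 * cmap (\<lambda>c. \<phi> (p * c)) f"
    unfolding gscal_def by (rule cmap_single_mult) fact
  then show ?thesis by (simp only: single_one mult_1_left)
qed

lemma lookup_gscal: "Poly_Mapping.lookup (gscal p * f) w = p * Poly_Mapping.lookup f w"
proof -
  have "gscal p * f = cmap (\<lambda>c. p * c) f"
    unfolding gscal_def by (simp add: mult_map_scale_conv_mult)
  then show ?thesis by (simp add: lookup_cmap additive_mult_left)
qed

lemma cmap_derivation_gscal:
  assumes "derivation D"
  shows "cmap D (gscal p * f) = gscal (D p) * f + gscal p * cmap D f"
proof (rule poly_mapping_eqI)
  fix w
  have D: "additive D" by (rule derivation_additive) fact
  then have "additive (\<lambda>c. D (p * c))" by (rule additive_comp[OF _ additive_mult_left])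
  then show "Poly_Mapping.lookup (cmap D (gscal p * f)) w = Poly_Mapping.lookup (gscal (D p) * f + gscal p * cmap D f) w"
    by (simp only: cmap_gscal[OF D] lookup_cmap[OF D] lookup_cmap lookup_add lookup_gscal derivation_mult[OF assms])
qed

lemma cmap_scale: "additive \<phi> \<Longrightarrow> cmap (\<lambda>d. c * \<phi> d) f = scal c (cmap \<phi> f)" for \<phi> :: "gpoly \<Rightarrow> complex"
  by (rule poly_mapping_eqI) (simp add: lookup_cmap additive_comp[OF additive_mult_left])

lemma cmap_cst:
  assumes "cfunctional \<phi>"
  shows "cmap \<phi> (gscal (cst c) * f) = scal c (cmap \<phi> f)"
proof -
  have "\<phi> (cst c * d) = c * \<phi> d" for d
    using cfunctional_scal[OF assms, of c d] by (simp add: scal_def)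
  then show ?thesis
    by (simp add: cmap_gscal cfunctional_additive[OF assms] cmap_scale)
qed

lemma cmap_word_span: "additive \<phi> \<Longrightarrow> f \<in> word_span X \<Longrightarrow> cmap \<phi> f \<in> word_span X"
  by (auto simp: word_span_def in_keys_iff lookup_cmap additive.zero)

lemma gletter_word_span: "g \<in> X \<Longrightarrow> gletter g \<in> word_span X"
  by (simp add: gletter_def word_span_single)

lemma gscal_word_span: "gscal p \<in> word_span X"
  by (simp add: gscal_def word_span_def zero_fword_def keys_single)

text \<open>Zero in the vacuum module, after every specialisation of the coefficients by a linear functional.\<close>

definition vnull :: "nat \<Rightarrow> galg set" where
  "vnull n = {f. \<forall>\<phi>. cfunctional \<phi> \<longrightarrow> on_one (cmap \<phi> f) \<in> vac_ideal n}"

lemmas on_one_simps = clinear_map_add[OF clinear_on_one] clinear_map_diff[OF clinear_on_one]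
  clinear_map_uminus[OF clinear_on_one] clinear_map_zero[OF clinear_on_one]
  clinear_map_sum[OF clinear_on_one] clinear_map_scal[OF clinear_on_one]

lemma cmap_zero: "additive \<phi> \<Longrightarrow> cmap \<phi> 0 = 0"
  by (rule poly_mapping_eqI) (simp add: lookup_cmap additive.zero)

lemma vnull_zero: "0 \<in> vnull n"
  by (simp add: vnull_def cmap_zero cfunctional_additive on_one_simps vac_zero)

lemma vnull_add: "f \<in> vnull n \<Longrightarrow> g \<in> vnull n \<Longrightarrow> f + g \<in> vnull n"
  by (simp add: vnull_def cmap_add cfunctional_additive on_one_simps vac_add)

lemma vnull_diff: "f \<in> vnull n \<Longrightarrow> g \<in> vnull n \<Longrightarrow> f - g \<in> vnull n"
  by (simp add: vnull_def cmap_diff cfunctional_additive on_one_simps vac_diff)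

lemma vnull_sum: "(\<And>x. x \<in> A \<Longrightarrow> f x \<in> vnull n) \<Longrightarrow> sum f A \<in> vnull n"
  by (induction A rule: infinite_finite_induct) (auto intro: vnull_add vnull_zero)

text \<open>The polynomial is absorbed into the functional, since \<open>\<phi> (p * c)\<close> is
  again linear in \<open>c\<close>. This closure is the reason for quantifying over all functionals
  instead of fixing the average.\<close>

lemma vnull_gscal: "f \<in> vnull n \<Longrightarrow> gscal p * f \<in> vnull n"
  by (simp add: vnull_def cmap_gscal cfunctional_additive cfunctional_mult)

lemma vnull_of_nat: "f \<in> vnull n \<Longrightarrow> of_nat k * f \<in> vnull n"
  by (induction k) (auto simp: algebra_simps vnull_zero intro: vnull_add)

text \<open>A letter acts by left multiplication and \<open>None\<close> by translation; the vacuum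
  ideal is stable under both.\<close>

lemma vnull_gletter:
  assumes "g \<in> tau_letters n" "f \<in> vnull n"
  shows "gletter g * f \<in> vnull n"
  unfolding vnull_def
proof (intro CollectI allI impI)
  fix \<phi> :: "gpoly \<Rightarrow> complex" assume phi: "cfunctional \<phi>"
  have v: "on_one (cmap \<phi> f) \<in> vac_ideal n"
    using assms(2) phi by (simp add: vnull_def)
  have "cmap \<phi> (gletter g * f) = letter g * cmap \<phi> f"
    using phi by (simp add: cmap_gletter cfunctional_additive letter_def)
  then show "on_one (cmap \<phi> (gletter g * f)) \<in> vac_ideal n"
    using v assms(1)
    by (auto simp: tau_letters_def on_one_Some on_one_None intro: vac_tau vac_lmult[OF word_span_letter])
qed

abbreviation SC :: "complex mat \<Rightarrow> int \<Rightarrow> aff option" where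
  "SC x a \<equiv> Some (Cur x a)"

lemma SC_tau_letters: "x \<in> so n \<Longrightarrow> SC x a \<in> tau_letters n"
  by (simp add: tau_letters_def Cur_aff_letters)

text \<open>In front of a vector of the vacuum module the central letter acts as
  \<open>- dual_coxeter n\<close>, so the central term of the bracket becomes a scalar
  coefficient.\<close>

lemma gletter_lie:
  assumes x: "x \<in> so n" and y: "y \<in> so n" and f: "f \<in> word_span (tau_letters n)"
  shows "gletter (SC x a) * (gletter (SC y b) * f) - gletter (SC y b) * (gletter (SC x a) * f) - gletter (SC (lie x y) (a + b)) * f
     - gscal (cst (if a + b = 0 then - (dual_coxeter n * of_int a) * form x y else 0)) * f \<in> vnull n"
  unfolding vnull_def
proof (intro CollectI allI impI)
  fix \<phi> :: "gpoly \<Rightarrow> complex" assume phi: "cfunctional \<phi>"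
  define h where "h = on_one (cmap \<phi> f)"
  have h: "h \<in> word_span (aff_letters n)"
    unfolding h_def using phi f by (intro on_one_word_span cmap_word_span cfunctional_additive)
  note S = cmap_gletter[OF cfunctional_additive[OF phi], folded letter_def]
  let ?c = "if a + b = 0 then of_int a * form x y else 0"
  have "on_one (cmap \<phi> (gletter (SC x a) * (gletter (SC y b) * f) - gletter (SC y b) * (gletter (SC x a) * f) - gletter (SC (lie x y) (a + b)) * f
     - gscal (cst (if a + b = 0 then - (dual_coxeter n * of_int a) * form x y else 0)) * f))
     = letter (Cur x a) * (letter (Cur y b) * h) - letter (Cur y b) * (letter (Cur x a) * h)
        - letter (Cur (lie x y) (a + b)) * h + scal (dual_coxeter n * ?c) h"
    using phi by (simp add: cmap_diff cfunctional_additive S cmap_cst on_one_simps on_one_Some h_def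
        scal_minus_left mult_ac)
  also have "\<dots> = (letter (Cur x a) * letter (Cur y b) - letter (Cur y b) * letter (Cur x a)
        - letter (Cur (lie x y) (a + b)) - (if a + b = 0 then scal (of_int a * form x y) (letter Cent) else 0)) * h
        + scal ?c (letter Cent * h + scal (dual_coxeter n) h)"
    by (simp add: algebra_simps scal_add_right)
  also have "\<dots> \<in> vac_ideal n"
    by (intro vac_add vac_rel aff_ideal_Cur_lie x y h vac_scal vac_Cent)
  finally show "on_one (cmap \<phi> (gletter (SC x a) * (gletter (SC y b) * f) - gletter (SC y b) * (gletter (SC x a) * f) - gletter (SC (lie x y) (a + b)) * f
     - gscal (cst (if a + b = 0 then - (dual_coxeter n * of_int a) * form x y else 0)) * f)) \<in> vac_ideal n" .
qed

section \<open>Currents with polynomial entries\<close>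

definition basis_letter :: "nat \<Rightarrow> int \<Rightarrow> nat \<times> nat \<Rightarrow> galg" where
  "basis_letter n a p = gletter (SC (Fmat n (fst p) (snd p)) a)"

text \<open>The element \<open>Z[a]\<close> for a matrix \<open>Z\<close> with polynomial entries.\<close>

definition current :: "nat \<Rightarrow> (nat \<Rightarrow> nat \<Rightarrow> gpoly) \<Rightarrow> int \<Rightarrow> galg" where
  "current n Z a = (\<Sum>p\<in>basis_idx n. gscal (Z (fst p) (snd p)) * basis_letter n a p)"

lemma basis_letter_gscal: "basis_letter n a p * (gscal c * g) = gscal c * (basis_letter n a p * g)"
  by (rule gscal_left_commute)

lemma gscal_gscal: "gscal p * (gscal q * g) = gscal (p * q) * g"
  by (simp add: gscal_mult mult.assoc)

lemma basis_idx_so: "p \<in> basis_idx n \<Longrightarrow> Fmat n (fst p) (snd p) \<in> so n"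
  by (rule so_Fmat) (auto simp: basis_idx_def)

lemma basis_letter_word_span: "p \<in> basis_idx n \<Longrightarrow> basis_letter n a p \<in> word_span (tau_letters n)"
  unfolding basis_letter_def by (intro gletter_word_span SC_tau_letters basis_idx_so)

lemma current_word_span: "current n Z a \<in> word_span (tau_letters n)"
  unfolding current_def by (intro word_span_sum word_span_mult gscal_word_span basis_letter_word_span)

lemma current_mult: "current n Z a * f = (\<Sum>p\<in>basis_idx n. gscal (Z (fst p) (snd p)) * (basis_letter n a p * f))"
  by (simp add: current_def sum_distrib_right mult.assoc)

lemma vnull_current: "f \<in> vnull n \<Longrightarrow> current n Z a * f \<in> vnull n"
  unfolding current_mult basis_letter_def by (intro vnull_sum vnull_gscal vnull_gletter SC_tau_letters basis_idx_so)

lemma current_add: "current n (\<lambda>i j. Z i j + W i j) a = current n Z a + current n W a"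
  by (simp add: current_def gscal_add distrib_right sum.distrib)

lemma current_scale: "current n (\<lambda>i j. p * Z i j) a = gscal p * current n Z a"
  by (simp add: current_def gscal_mult mult.assoc sum_distrib_left)

lemma current_cong: "(\<And>i j. i < n \<Longrightarrow> j < n \<Longrightarrow> Z i j = W i j) \<Longrightarrow> current n Z a = current n W a"
  unfolding current_def by (rule sum.cong) (auto simp: basis_idx_def)

lemma gletter_expansion:
  assumes x: "x \<in> so n" and f: "f \<in> word_span (tau_letters n)"
  shows "gletter (SC x a) * f - current n (\<lambda>i j. cst (x $$ (i, j))) a * f \<in> vnull n"
  unfolding vnull_def
proof (intro CollectI allI impI)
  fix \<phi> :: "gpoly \<Rightarrow> complex" assume phi: "cfunctional \<phi>"
  define h where "h = on_one (cmap \<phi> f)"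
  have h: "h \<in> word_span (aff_letters n)"
    unfolding h_def using phi f by (intro on_one_word_span cmap_word_span cfunctional_additive)
  note S = cmap_gletter[OF cfunctional_additive[OF phi], folded letter_def]
  have "on_one (cmap \<phi> (gletter (SC x a) * f - current n (\<lambda>i j. cst (x $$ (i, j))) a * f))
     = (letter (Cur x a) - (\<Sum>p\<in>basis_idx n. scal (x $$ p) (letter (Cur (Fmat n (fst p) (snd p)) a)))) * h"
    using phi by (simp add: cmap_diff cmap_sum cfunctional_additive S cmap_cst on_one_simps on_one_Some h_def
        current_mult basis_letter_def left_diff_distrib sum_distrib_right)
  then show "on_one (cmap \<phi> (gletter (SC x a) * f - current n (\<lambda>i j. cst (x $$ (i, j))) a * f)) \<in> vac_ideal n"
    using vac_rel[OF Cur_expansion[OF x] h] by simp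
qed

definition basis_entry :: "nat \<Rightarrow> nat \<times> nat \<Rightarrow> nat \<Rightarrow> nat \<Rightarrow> gpoly" where
  "basis_entry n p k l = cst (Fmat n (fst p) (snd p) $$ (k, l))"

lemma cst_indicators: "cst ((if P then 1 else 0) - (if Q then 1 else 0)) = (if P then 1 else 0) - (if Q then 1 else 0)"
  by (cases P; cases Q) (simp_all add: single_uminus)

lemma basis_entry_expansion:
  assumes "skew n Z" "k < n" "l < n"
  shows "Z k l = (\<Sum>p\<in>basis_idx n. Z (fst p) (snd p) * basis_entry n p k l)"
proof -
  have "basis_entry n p k l = (if k = fst p \<and> l = snd p then 1 else 0)
            - (if k = n - 1 - snd p \<and> l = n - 1 - fst p then 1 else 0)" for p
    unfolding basis_entry_def Fmat_index[OF assms(2,3)] by (rule cst_indicators)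
  then show ?thesis
    using basis_idx_expansion[OF assms(1) skew_diag_gpoly[OF assms(1)] assms(2,3)]
    by (simp only: case_prod_unfold)
qed

lemma bracket_expansion:
  assumes Z: "skew n Z" and W: "skew n W" and ij: "i < n" "j < n"
  shows "bracket n Z W i j = (\<Sum>p\<in>basis_idx n. \<Sum>q\<in>basis_idx n. Z (fst p) (snd p) * W (fst q) (snd q) * bracket n (basis_entry n p) (basis_entry n q) i j)"
proof -
  let ?z = "\<lambda>p. Z (fst p) (snd p)" and ?w = "\<lambda>p. W (fst p) (snd p)"
  have 1: "Z i k * W k j = (\<Sum>p\<in>basis_idx n. \<Sum>q\<in>basis_idx n. ?z p * ?w q * (basis_entry n p i k * basis_entry n q k j))" if "k < n" for k
    unfolding basis_entry_expansion[OF Z ij(1) that] basis_entry_expansion[OF W that ij(2)] sum_product by (simp add: mult_ac)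
  have 2: "W i k * Z k j = (\<Sum>p\<in>basis_idx n. \<Sum>q\<in>basis_idx n. ?z p * ?w q * (basis_entry n q i k * basis_entry n p k j))" if "k < n" for k
    unfolding basis_entry_expansion[OF W ij(1) that] basis_entry_expansion[OF Z that ij(2)] sum_product
    by (subst sum.swap) (simp add: mult_ac)
  have "bracket n Z W i j = (\<Sum>k<n. \<Sum>p\<in>basis_idx n. \<Sum>q\<in>basis_idx n. ?z p * ?w q * (basis_entry n p i k * basis_entry n q k j - basis_entry n q i k * basis_entry n p k j))"
    unfolding bracket_def by (rule sum.cong) (simp_all add: 1 2 sum_subtractf right_diff_distrib)
  also have "\<dots> = (\<Sum>p\<in>basis_idx n. \<Sum>q\<in>basis_idx n. \<Sum>k<n. ?z p * ?w q * (basis_entry n p i k * basis_entry n q k j - basis_entry n q i k * basis_entry n p k j))"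
    by (subst sum.swap, rule sum.cong[OF refl], rule sum.swap)
  finally show ?thesis by (simp only: bracket_def sum_distrib_left)
qed

definition tform :: "nat \<Rightarrow> (nat \<Rightarrow> nat \<Rightarrow> gpoly) \<Rightarrow> (nat \<Rightarrow> nat \<Rightarrow> gpoly) \<Rightarrow> gpoly" where
  "tform n Z W = cst (1 / 2) * (\<Sum>i<n. \<Sum>k<n. Z i k * W k i)"

lemma tform_expansion:
  assumes Z: "skew n Z" and W: "skew n W"
  shows "tform n Z W = (\<Sum>p\<in>basis_idx n. \<Sum>q\<in>basis_idx n. Z (fst p) (snd p) * W (fst q) (snd q) * tform n (basis_entry n p) (basis_entry n q))"
proof -
  let ?z = "\<lambda>p. Z (fst p) (snd p)" and ?w = "\<lambda>p. W (fst p) (snd p)"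
  have "(\<Sum>i<n. \<Sum>k<n. Z i k * W k i)
     = (\<Sum>i<n. \<Sum>k<n. \<Sum>p\<in>basis_idx n. \<Sum>q\<in>basis_idx n. ?z p * ?w q * (basis_entry n p i k * basis_entry n q k i))"
  proof (intro sum.cong refl)
    fix i k assume "i \<in> {..<n}" "k \<in> {..<n}"
    then have ik: "i < n" "k < n" by simp_all
    show "Z i k * W k i = (\<Sum>p\<in>basis_idx n. \<Sum>q\<in>basis_idx n. ?z p * ?w q * (basis_entry n p i k * basis_entry n q k i))"
      unfolding basis_entry_expansion[OF Z ik] basis_entry_expansion[OF W ik(2) ik(1)] sum_product by (simp add: mult_ac)
  qed
  also have "\<dots> = (\<Sum>i<n. \<Sum>p\<in>basis_idx n. \<Sum>q\<in>basis_idx n. \<Sum>k<n. ?z p * ?w q * (basis_entry n p i k * basis_entry n q k i))"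
    by (rule sum.cong[OF refl], subst sum.swap, rule sum.cong[OF refl], rule sum.swap)
  also have "\<dots> = (\<Sum>p\<in>basis_idx n. \<Sum>q\<in>basis_idx n. \<Sum>i<n. \<Sum>k<n. ?z p * ?w q * (basis_entry n p i k * basis_entry n q k i))"
    by (subst sum.swap, rule sum.cong[OF refl], rule sum.swap)
  finally show ?thesis
    unfolding tform_def by (simp only: sum_distrib_left mult_ac)
qed

text \<open>The defining relations concern constant matrices. Both currents are expanded in the
  basis, and bilinearity of the bracket and of the form carries the relation over to polynomial
  entries.\<close>

lemma current_commutator:
  assumes Z: "skew n Z" and W: "skew n W" and f: "f \<in> word_span (tau_letters n)"
  shows "current n Z a * (current n W b * f) - current n W b * (current n Z a * f) - current n (bracket n Z W) (a + b) * f
     - gscal (cst (if a + b = 0 then - (dual_coxeter n * of_int a) else 0) * tform n Z W) * f \<in> vnull n"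
proof -
  let ?z = "\<lambda>p. Z (fst p) (snd p)" and ?w = "\<lambda>p. W (fst p) (snd p)" and ?B = "basis_idx n"
  let ?F = "\<lambda>p. Fmat n (fst p) (snd p)"
  define k where "k = (if a + b = 0 then - (dual_coxeter n * of_int a) else 0 :: complex)"
  have lieF: "cst (lie (?F p) (?F q) $$ (i, j)) = bracket n (basis_entry n p) (basis_entry n q) i j" if "i < n" "j < n" for p q i j
    unfolding lie_index[OF Fmat_carrier Fmat_carrier that] bracket_def sum_single basis_entry_def
    by (simp add: single_diff mult_single)
  have formF: "cst (form (?F p) (?F q)) = tform n (basis_entry n p) (basis_entry n q)" for p q
    unfolding form_eq[OF Fmat_carrier Fmat_carrier] tform_def basis_entry_def
    by (simp add: mult_single sum_single[symmetric])
  \<comment> \<open>The bracket of two basis matrices need not be a basis matrix, so its letter is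
    expanded again.\<close>
  have R: "basis_letter n a p * (basis_letter n b q * f) - basis_letter n b q * (basis_letter n a p * f) - current n (bracket n (basis_entry n p) (basis_entry n q)) (a + b) * f
      - gscal (cst k * tform n (basis_entry n p) (basis_entry n q)) * f \<in> vnull n" (is "?R p q \<in> _") if "p \<in> ?B" "q \<in> ?B" for p q
  proof -
    have so: "?F p \<in> so n" "?F q \<in> so n" using that by (simp_all add: basis_idx_so)
    have c: "current n (bracket n (basis_entry n p) (basis_entry n q)) (a + b) = current n (\<lambda>i j. cst (lie (?F p) (?F q) $$ (i, j))) (a + b)"
      by (rule current_cong) (simp add: lieF)
    have "cst k * tform n (basis_entry n p) (basis_entry n q) = cst (if a + b = 0 then - (dual_coxeter n * of_int a) * form (?F p) (?F q) else 0)"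
      unfolding formF[symmetric] k_def by (simp add: mult_single)
    then show ?thesis
      unfolding c basis_letter_def
      using vnull_add[OF gletter_lie[OF so f, of a b] gletter_expansion[OF so_lie[OF so] f, of "a + b"]]
      by (simp add: algebra_simps)
  qed
  have 1: "current n Z a * (current n W b * f) = (\<Sum>p\<in>?B. \<Sum>q\<in>?B. gscal (?z p * ?w q) * (basis_letter n a p * (basis_letter n b q * f)))"
    unfolding current_mult by (simp only: sum_distrib_left basis_letter_gscal gscal_gscal)
  have 2: "current n W b * (current n Z a * f) = (\<Sum>p\<in>?B. \<Sum>q\<in>?B. gscal (?z p * ?w q) * (basis_letter n b q * (basis_letter n a p * f)))"
    unfolding current_mult
    by (subst sum.swap) (simp only: sum_distrib_left basis_letter_gscal gscal_gscal mult.commute[of "W _ _"])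
  have 3: "current n (bracket n Z W) (a + b) * f
      = (\<Sum>p\<in>?B. \<Sum>q\<in>?B. gscal (?z p * ?w q) * (current n (bracket n (basis_entry n p) (basis_entry n q)) (a + b) * f))"
  proof -
    have "current n (bracket n Z W) (a + b) = current n (\<lambda>i j. \<Sum>p\<in>?B. \<Sum>q\<in>?B. ?z p * ?w q * bracket n (basis_entry n p) (basis_entry n q) i j) (a + b)"
      by (rule current_cong) (rule bracket_expansion[OF Z W])
    also have "\<dots> = (\<Sum>r\<in>?B. \<Sum>p\<in>?B. \<Sum>q\<in>?B. gscal (?z p * ?w q) * (gscal (bracket n (basis_entry n p) (basis_entry n q) (fst r) (snd r)) * basis_letter n (a + b) r))"
      by (simp add: current_def gscal_sum gscal_mult sum_distrib_right mult.assoc)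
    also have "\<dots> = (\<Sum>p\<in>?B. \<Sum>r\<in>?B. \<Sum>q\<in>?B. gscal (?z p * ?w q) * (gscal (bracket n (basis_entry n p) (basis_entry n q) (fst r) (snd r)) * basis_letter n (a + b) r))"
      by (rule sum.swap)
    also have "\<dots> = (\<Sum>p\<in>?B. \<Sum>q\<in>?B. \<Sum>r\<in>?B. gscal (?z p * ?w q) * (gscal (bracket n (basis_entry n p) (basis_entry n q) (fst r) (snd r)) * basis_letter n (a + b) r))"
      by (rule sum.cong[OF refl], rule sum.swap)
    also have "\<dots> = (\<Sum>p\<in>?B. \<Sum>q\<in>?B. gscal (?z p * ?w q) * current n (bracket n (basis_entry n p) (basis_entry n q)) (a + b))"
      by (simp only: current_def sum_distrib_left)
    finally show ?thesis by (simp only: sum_distrib_right mult.assoc)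
  qed
  have 4: "gscal (cst k * tform n Z W) * f
      = (\<Sum>p\<in>?B. \<Sum>q\<in>?B. gscal (?z p * ?w q) * (gscal (cst k * tform n (basis_entry n p) (basis_entry n q)) * f))"
  proof -
    have "cst k * tform n Z W = (\<Sum>p\<in>?B. \<Sum>q\<in>?B. ?z p * ?w q * (cst k * tform n (basis_entry n p) (basis_entry n q)))"
      unfolding tform_expansion[OF Z W] sum_distrib_left by (simp only: mult_ac)
    then show ?thesis
      by (simp only: gscal_gscal gscal_sum sum_distrib_right)
  qed
  have "current n Z a * (current n W b * f) - current n W b * (current n Z a * f) - current n (bracket n Z W) (a + b) * f
     - gscal (cst k * tform n Z W) * f = (\<Sum>p\<in>?B. \<Sum>q\<in>?B. gscal (?z p * ?w q) * ?R p q)"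
    unfolding 1 2 3 4 by (simp only: sum_subtractf right_diff_distrib)
  moreover have "\<dots> \<in> vnull n"
    by (intro vnull_sum vnull_gscal R)
  ultimately show ?thesis unfolding k_def by metis
qed

definition gtau :: galg where "gtau = gletter None"

lemma gtau_word_span: "gtau \<in> word_span (tau_letters n)"
  unfolding gtau_def by (rule gletter_word_span) (simp add: tau_letters_def)

lemma vnull_gtau: "f \<in> vnull n \<Longrightarrow> gtau * f \<in> vnull n"
  unfolding gtau_def by (rule vnull_gletter) (simp add: tau_letters_def)

lemma gtau_current:
  "gtau * (current n Z a * f) - current n Z a * (gtau * f) - gscal (cst (- of_int a)) * (current n Z (a - 1) * f) \<in> vnull n"
proof -
  have R: "gtau * (basis_letter n a p * f) - basis_letter n a p * (gtau * f) - gscal (cst (- of_int a)) * (basis_letter n (a - 1) p * f) \<in> vnull n" (is "?R p \<in> _") for p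
    unfolding vnull_def
  proof (intro CollectI allI impI)
    fix \<phi> :: "gpoly \<Rightarrow> complex" assume phi: "cfunctional \<phi>"
    note S = cmap_gletter[OF cfunctional_additive[OF phi], folded letter_def]
    show "on_one (cmap \<phi> (?R p)) \<in> vac_ideal n"
      using phi by (simp add: cmap_diff cfunctional_additive S cmap_cst on_one_simps on_one_Some on_one_None gtau_def basis_letter_def
          tau_der_simps vac_zero)
  qed
  have "gtau * (current n Z a * f) - current n Z a * (gtau * f) - gscal (cst (- of_int a)) * (current n Z (a - 1) * f)
     = (\<Sum>p\<in>basis_idx n. gscal (Z (fst p) (snd p)) * ?R p)"
    unfolding current_mult sum_distrib_left sum_subtractf[symmetric]
    by (rule sum.cong) (simp_all only: right_diff_distrib gscal_left_commute[of gtau] gscal_gscal mult.commute[of "cst _"])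
  moreover have "\<dots> \<in> vnull n" by (intro vnull_sum vnull_gscal R)
  ultimately show ?thesis by simp
qed

lemma current_vac: "0 \<le> a \<Longrightarrow> current n Z a \<in> vnull n"
proof -
  assume a: "0 \<le> a"
  have "basis_letter n a p * 1 \<in> vnull n" if "p \<in> basis_idx n" for p
    unfolding vnull_def
  proof (intro CollectI allI impI)
    fix \<phi> :: "gpoly \<Rightarrow> complex" assume phi: "cfunctional \<phi>"
    have "cmap \<phi> (1 :: galg) = scal (\<phi> 1) 1"
      using cmap_single[OF cfunctional_additive[OF phi], of 0 1] by (simp add: scal_def)
    then have "on_one (cmap \<phi> (basis_letter n a p * 1)) = scal (\<phi> 1) (letter (Cur (Fmat n (fst p) (snd p)) a))"
      using phi cmap_gletter[OF cfunctional_additive[OF phi], of "SC (Fmat n (fst p) (snd p)) a" 1, folded letter_def]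
      by (simp add: basis_letter_def on_one_Some[of _ 1, simplified] on_one_simps on_one_one)
    then show "on_one (cmap \<phi> (basis_letter n a p * 1)) \<in> vac_ideal n"
      using vac_scal[OF vac_pos[OF basis_idx_so[OF that] a]] by simp
  qed
  then show ?thesis
    unfolding current_def by (intro vnull_sum vnull_gscal) simp
qed

subsection \<open>The action of the affine algebra on powers of the translated current\<close>

definition tauY :: "nat \<Rightarrow> galg" where
  "tauY n = gtau + current n (Ymat n) (- 1)"

lemma of_nat_left_commute: "of_nat k * (a * g) = a * (of_nat k * g)" for a g :: "'a::ring_1"
  using mult_of_nat_commute[of k a] by (simp only: mult.assoc[symmetric])

lemma tauY_word_span: "tauY n \<in> word_span (tau_letters n)"
  unfolding tauY_def by (intro word_span_add gtau_word_span current_word_span)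

lemma tauY_power_word_span: "tauY n ^ k \<in> word_span (tau_letters n)"
  by (intro word_span_power tauY_word_span)

lemma vnull_tauY: "f \<in> vnull n \<Longrightarrow> tauY n * f \<in> vnull n"
  unfolding tauY_def distrib_right by (intro vnull_add vnull_gtau vnull_current)

lemma tauY_gscal: "tauY n * (gscal p * f) = gscal p * (tauY n * f)"
  by (rule gscal_left_commute)

lemma cmap_gtau: "additive D \<Longrightarrow> cmap D (gtau * f) = gtau * cmap D f" for D :: "gpoly \<Rightarrow> gpoly"
  by (simp add: gtau_def cmap_gletter) (simp add: gletter_def)

lemma cmap_basis_letter: "additive D \<Longrightarrow> cmap D (basis_letter n a p * f) = basis_letter n a p * cmap D f" for D :: "gpoly \<Rightarrow> gpoly"
  by (simp add: basis_letter_def cmap_gletter) (simp add: gletter_def)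

lemma cmap_current:
  assumes "derivation D"
  shows "cmap D (current n Z a * f) = current n Z a * cmap D f + current n (\<lambda>i j. D (Z i j)) a * f"
  unfolding current_mult
  by (simp only: cmap_sum[OF derivation_additive[OF assms]] cmap_derivation_gscal[OF assms]
      cmap_basis_letter[OF derivation_additive[OF assms]] sum.distrib add.commute)

lemma cmap_tauY:
  assumes "derivation D"
  shows "cmap D (tauY n * f) = tauY n * cmap D f + current n (\<lambda>i j. D (Ymat n i j)) (- 1) * f"
  unfolding tauY_def
  by (simp only: distrib_right cmap_add[OF derivation_additive[OF assms]] cmap_gtau[OF derivation_additive[OF assms]]
      cmap_current[OF assms] add.assoc)

text \<open>Differentiating the coefficients replaces one factor \<open>Y\<close> by
  \<open>[Z, Y]\<close>, exactly as commuting with \<open>Z[0]\<close> does. This common rule links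
  the parameter space with the affine algebra.\<close>

lemma cmap_mder_tauY:
  assumes "skew n Z"
  shows "cmap (mder n Z) (tauY n * f) = tauY n * cmap (mder n Z) f + current n (bracket n Z (Ymat n)) (- 1) * f"
proof -
  have "current n (\<lambda>i j. mder n Z (Ymat n i j)) (- 1) = current n (bracket n Z (Ymat n)) (- 1)"
    by (rule current_cong) (rule mder_Ymat[OF assms])
  then show ?thesis by (simp only: cmap_tauY[OF derivation_mder])
qed

lemma cmap_derivation_one: "derivation D \<Longrightarrow> cmap D (1 :: galg) = 0"
proof -
  assume D: "derivation D"
  have "cmap D (1 :: galg) = Poly_Mapping.single 0 (D 1)"
    using cmap_single[OF derivation_additive[OF D], of 0 1] by (simp only: single_one)
  then show ?thesis by (simp add: derivation_one[OF D])
qed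

lemma current0_tauY:
  assumes Z: "skew n Z" and f: "f \<in> word_span (tau_letters n)"
  shows "current n Z 0 * (tauY n * f) - tauY n * (current n Z 0 * f) - current n (bracket n Z (Ymat n)) (- 1) * f \<in> vnull n"
proof -
  have 1: "current n Z 0 * (current n (Ymat n) (- 1) * f) - current n (Ymat n) (- 1) * (current n Z 0 * f)
      - current n (bracket n Z (Ymat n)) (- 1) * f \<in> vnull n"
    using current_commutator[OF Z skew_Ymat f, of 0 "- 1"] by (simp add: gscal_zero)
  have 2: "gtau * (current n Z 0 * f) - current n Z 0 * (gtau * f) \<in> vnull n"
    using gtau_current[of n Z 0 f] by (simp add: gscal_zero)
  show ?thesis
    using vnull_diff[OF 1 2] by (simp add: tauY_def algebra_simps)
qed

text \<open>Commuting with the translation lowers the mode to \<open>Z[0]\<close>, and commuting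
  with \<open>Y[-1]\<close> gives \<open>[Z, Y][0]\<close> and the central scalar. The two currents
  of degree 0 are later joined into one.\<close>

lemma current1_tauY:
  assumes Z: "skew n Z" and f: "f \<in> word_span (tau_letters n)"
  shows "current n Z 1 * (tauY n * f) - tauY n * (current n Z 1 * f) - current n Z 0 * f - current n (bracket n Z (Ymat n)) 0 * f
     - gscal (cst (- dual_coxeter n) * tform n Z (Ymat n)) * f \<in> vnull n"
proof -
  have 1: "current n Z 1 * (current n (Ymat n) (- 1) * f) - current n (Ymat n) (- 1) * (current n Z 1 * f)
      - current n (bracket n Z (Ymat n)) 0 * f - gscal (cst (- dual_coxeter n) * tform n Z (Ymat n)) * f \<in> vnull n"
    using current_commutator[OF Z skew_Ymat f, of 1 "- 1"] by simp
  have "gscal (cst (- 1)) = - 1"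
    by (simp add: single_uminus gscal_uminus gscal_one)
  then have 2: "gtau * (current n Z 1 * f) - current n Z 1 * (gtau * f) + current n Z 0 * f \<in> vnull n"
    using gtau_current[of n Z 1 f] by simp
  show ?thesis
    using vnull_diff[OF 1 2] by (simp add: tauY_def algebra_simps)
qed

lemma tauY_current:
  assumes Z: "skew n Z" and f: "f \<in> word_span (tau_letters n)"
  shows "tauY n * (current n Z (- 1) * f) - current n Z (- 1) * (tauY n * f) - current n Z (- 2) * f - current n (bracket n (Ymat n) Z) (- 2) * f \<in> vnull n"
proof -
  have 1: "current n (Ymat n) (- 1) * (current n Z (- 1) * f) - current n Z (- 1) * (current n (Ymat n) (- 1) * f)
      - current n (bracket n (Ymat n) Z) (- 2) * f \<in> vnull n"
    using current_commutator[OF skew_Ymat Z f, of "- 1" "- 1"] by (simp add: gscal_zero)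
  have 2: "gtau * (current n Z (- 1) * f) - current n Z (- 1) * (gtau * f) - current n Z (- 2) * f \<in> vnull n"
    using gtau_current[of n Z "- 1" f] by (simp add: gscal_one)
  show ?thesis
    using vnull_add[OF 1 2] by (simp add: tauY_def algebra_simps)
qed

text \<open>Both operators obey the same Leibniz rule on powers of \<open>tauY n\<close> and vanish
  on the vacuum. The action of \<open>Z[0]\<close> can thus be traded for a vector field and
  integrated by parts.\<close>

lemma current0_tauY_power:
  assumes Z: "skew n Z"
  shows "current n Z 0 * tauY n ^ N - cmap (mder n Z) (tauY n ^ N) \<in> vnull n"
proof (induction N)
  case 0
  show ?case by (simp add: cmap_derivation_one derivation_mder current_vac)
next
  case (Suc N)
  have "current n Z 0 * tauY n ^ Suc N - cmap (mder n Z) (tauY n ^ Suc N)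
    = (current n Z 0 * (tauY n * tauY n ^ N) - tauY n * (current n Z 0 * tauY n ^ N) - current n (bracket n Z (Ymat n)) (- 1) * tauY n ^ N)
      + tauY n * (current n Z 0 * tauY n ^ N - cmap (mder n Z) (tauY n ^ N))"
    unfolding power_Suc cmap_mder_tauY[OF Z] by (simp add: algebra_simps)
  also have "\<dots> \<in> vnull n"
    by (intro vnull_add vnull_tauY Suc.IH current0_tauY Z tauY_power_word_span)
  finally show ?case .
qed

section \<open>Moving \<open>x[1]\<close> through powers of \<open>tauY n\<close>\<close>

context
  fixes n :: nat and x :: "nat \<Rightarrow> nat \<Rightarrow> complex"
  assumes x: "skew n x"
begin

text \<open>\<open>Cm = [x, Y]\<close> and \<open>Bm = [x, Y] + [[x, Y], Y]\<close>.\<close>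

definition Cm :: "nat \<Rightarrow> nat \<Rightarrow> gpoly" where
  "Cm = bracket n (cmat x) (Ymat n)"

definition Zm :: "nat \<Rightarrow> nat \<Rightarrow> gpoly" where
  "Zm = (\<lambda>i j. cmat x i j + Cm i j)"

definition Bm :: "nat \<Rightarrow> nat \<Rightarrow> gpoly" where
  "Bm = bracket n Zm (Ymat n)"

lemma skew_Zm: "skew n Zm" and skew_Bm: "skew n Bm"
proof -
  have C: "skew n Cm" unfolding Cm_def by (intro skew_bracket skew_cmat x skew_Ymat)
  show Z: "skew n Zm" unfolding Zm_def by (intro skew_add skew_cmat x C)
  show "skew n Bm" unfolding Bm_def by (intro skew_bracket Z skew_Ymat)
qed

text \<open>With \<open>T = \<tau> + Y[-1]\<close>, \<open>b = Bm\<close> and \<open>c = Cm\<close>, summing over \<open>p + q = N - 1\<close> in \<open>Ap\<close>, \<open>Up\<close> and over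
  \<open>p + q = N - 2\<close> in \<open>Wp\<close>, \<open>Vp\<close>:
  \<open>Ap N = \<Sum> T\<^sup>p b[-1] T\<^sup>q\<close>, \<open>Wp N = \<Sum> (p + 1) T\<^sup>p b[-1] T\<^sup>q\<close>,
  \<open>Up N = \<Sum> (q + 1) T\<^sup>p c[-2] T\<^sup>q\<close>, \<open>Vp N = \<Sum> (p + 1) (q + 1) T\<^sup>p c[-2] T\<^sup>q\<close>.\<close>

definition Ap :: "nat \<Rightarrow> galg" where
  "Ap N = cmap (mder n Zm) (tauY n ^ N)"

lemma Ap_Suc: "Ap (Suc N) = tauY n * Ap N + current n Bm (- 1) * tauY n ^ N"
  unfolding Ap_def power_Suc Bm_def by (rule cmap_mder_tauY[OF skew_Zm])

lemma Ap_0: "Ap 0 = 0"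
  by (simp add: Ap_def cmap_derivation_one derivation_mder)

primrec Wp :: "nat \<Rightarrow> galg" where
  "Wp 0 = 0"
| "Wp (Suc N) = tauY n * Wp N + Ap N"

primrec Up :: "nat \<Rightarrow> galg" where
  "Up 0 = 0"
| "Up (Suc N) = tauY n * Up N + of_nat (Suc N) * (current n Cm (- 2) * tauY n ^ N)"

primrec Vp :: "nat \<Rightarrow> galg" where
  "Vp 0 = 0"
| "Vp (Suc N) = tauY n * Vp N + Up N"

definition kappa :: gpoly where
  "kappa = cst (- dual_coxeter n) * tform n (cmat x) (Ymat n)"

text \<open>Each passage of \<open>x[1]\<close> through a factor leaves the scalar
  \<open>kappa\<close> and the current \<open>Zm[0]\<close>, which acts on the remaining power as a
  vector field and gives \<open>Ap\<close>. An insertion with \<open>p\<close> factors on its left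
  is produced by \<open>p + 1\<close> of the passages.\<close>

lemma current1_tauY_power:
  "current n (cmat x) 1 * tauY n ^ Suc N - of_nat (Suc N) * (gscal kappa * tauY n ^ N) - Wp (Suc N) \<in> vnull n"
proof -
  have X: "skew n (cmat x)" by (rule skew_cmat[OF x])
  have c: "current n Zm 0 = current n (cmat x) 0 + current n Cm 0"
    unfolding Zm_def by (rule current_add)
  have step: "current n (cmat x) 1 * tauY n ^ Suc N - tauY n * (current n (cmat x) 1 * tauY n ^ N) - Ap N - gscal kappa * tauY n ^ N \<in> vnull n" for N
  proof -
    have "(current n (cmat x) 1 * (tauY n * tauY n ^ N) - tauY n * (current n (cmat x) 1 * tauY n ^ N) - current n (cmat x) 0 * tauY n ^ N
        - current n Cm 0 * tauY n ^ N - gscal kappa * tauY n ^ N) + (current n Zm 0 * tauY n ^ N - Ap N) \<in> vnull n"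
      unfolding kappa_def Cm_def Ap_def
      by (intro vnull_add current1_tauY[OF X] current0_tauY_power skew_Zm tauY_power_word_span)
    then show ?thesis unfolding c by (simp add: algebra_simps)
  qed
  show ?thesis
  proof (induction N)
    case 0
    show ?case
      using vnull_add[OF step[of 0] vnull_tauY[OF current_vac[of 1 n "cmat x"]]] by (simp add: Ap_0)
  next
    case (Suc N)
    have "current n (cmat x) 1 * tauY n ^ Suc (Suc N) - of_nat (Suc (Suc N)) * (gscal kappa * tauY n ^ Suc N) - Wp (Suc (Suc N))
      = (current n (cmat x) 1 * tauY n ^ Suc (Suc N) - tauY n * (current n (cmat x) 1 * tauY n ^ Suc N) - Ap (Suc N) - gscal kappa * tauY n ^ Suc N)
        + tauY n * (current n (cmat x) 1 * tauY n ^ Suc N - of_nat (Suc N) * (gscal kappa * tauY n ^ N) - Wp (Suc N))"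
    proof -
      have "tauY n * (of_nat (Suc N) * (gscal kappa * tauY n ^ N)) = of_nat (Suc N) * (gscal kappa * tauY n ^ Suc N)"
        by (simp only: of_nat_left_commute[of _ "tauY n", symmetric] tauY_gscal power_Suc)
      then show ?thesis
        by (simp only: Wp.simps(2)[of "Suc N"] right_diff_distrib of_nat_Suc[of "Suc N"] distrib_right mult_1_left)
          (simp only: algebra_simps)
    qed
    also have "\<dots> \<in> vnull n" by (intro vnull_add vnull_tauY step Suc.IH)
    finally show ?case .
  qed
qed

text \<open>Since \<open>b = c - [Y, c]\<close> and \<open>[Y, [Y, c]] = alpha2 n * c\<close>, the
  terms \<open>b[-2]\<close> and \<open>[Y, b][-2]\<close> telescope.\<close>

lemma current_Bm_shift:
  assumes f: "f \<in> word_span (tau_letters n)"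
  shows "tauY n * (current n Bm (- 1) * f) - current n Bm (- 1) * (tauY n * f) - gscal (1 - alpha2 n) * (current n Cm (- 2) * f) \<in> vnull n"
proof -
  have e: "Bm i j + bracket n (Ymat n) Bm i j = (1 - alpha2 n) * Cm i j" if ij: "i < n" "j < n" for i j
  proof -
    have B: "Bm i j = Cm i j - bracket n (Ymat n) Cm i j" for i j
    proof -
      have "Bm i j = - bracket n (Ymat n) (\<lambda>i j. cmat x i j + Cm i j) i j"
        unfolding Bm_def Zm_def by (rule bracket_anticomm)
      also have "\<dots> = bracket n (cmat x) (Ymat n) i j - bracket n (Ymat n) Cm i j"
        unfolding bracket_add_right bracket_anticomm[of n "cmat x"] by simp
      finally show ?thesis by (simp only: Cm_def)
    qed
    have "bracket n (Ymat n) Bm i j = bracket n (Ymat n) (\<lambda>i j. Cm i j - bracket n (Ymat n) Cm i j) i j"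
      by (rule bracket_cong) (simp_all add: B ij)
    also have "\<dots> = bracket n (Ymat n) Cm i j - alpha2 n * Cm i j"
      unfolding bracket_diff_right Cm_def ad_cubed_Ymat[OF x ij] ..
    finally show ?thesis unfolding B by (simp add: algebra_simps)
  qed
  have "current n (\<lambda>i j. Bm i j + bracket n (Ymat n) Bm i j) (- 2) = gscal (1 - alpha2 n) * current n Cm (- 2)"
    unfolding current_scale[symmetric] by (rule current_cong) (rule e)
  then have "current n Bm (- 2) + current n (bracket n (Ymat n) Bm) (- 2) = gscal (1 - alpha2 n) * current n Cm (- 2)"
    by (simp only: current_add)
  then have e2: "current n Bm (- 2) * f + current n (bracket n (Ymat n) Bm) (- 2) * f = gscal (1 - alpha2 n) * (current n Cm (- 2) * f)"
    by (simp only: distrib_right[symmetric] mult.assoc)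
  show ?thesis
    unfolding e2[symmetric] diff_diff_eq[symmetric] by (rule tauY_current[OF skew_Bm f])
qed

text \<open>Every insertion is carried to the far left, and each factor crossed costs a commutator
  \<open>(1 - alpha2 n) * c[-2]\<close>. The place with \<open>q\<close> factors on its right is
  crossed by \<open>q + 1\<close> insertions, which is the multiplicity in
  \<open>Up\<close>.\<close>

lemma Ap_symmetrise:
  "Ap (Suc N) - of_nat (Suc N) * (current n Bm (- 1) * tauY n ^ N) - gscal (1 - alpha2 n) * Up N \<in> vnull n"
proof (induction N)
  case 0
  show ?case by (simp add: Ap_Suc Ap_0 vnull_zero)
next
  case (Suc N)
  let ?b = "current n Bm (- 1)" and ?a = "gscal (1 - alpha2 n)" and ?c = "current n Cm (- 2)" and ?T = "tauY n"
  have n1: "of_nat k * (?T * g) = ?T * (of_nat k * g)" "of_nat k * (?a * g) = ?a * (of_nat k * g)" for k g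
    by (rule of_nat_left_commute)+
  have "Ap (Suc (Suc N)) - of_nat (Suc (Suc N)) * (?b * ?T ^ Suc N) - ?a * Up (Suc N)
     = ?T * (Ap (Suc N) - of_nat (Suc N) * (?b * ?T ^ N) - ?a * Up N)
       + of_nat (Suc N) * (?T * (?b * ?T ^ N) - ?b * (?T * ?T ^ N) - ?a * (?c * ?T ^ N))"
  proof -
    have "Ap (Suc (Suc N)) = ?T * Ap (Suc N) + ?b * ?T ^ Suc N" by (rule Ap_Suc)
    moreover have "of_nat (Suc (Suc N)) * (?b * ?T ^ Suc N) = of_nat (Suc N) * (?b * ?T ^ Suc N) + ?b * ?T ^ Suc N"
      by (simp only: of_nat_Suc[of "Suc N"] distrib_right mult_1_left add.commute)
    moreover have "?a * Up (Suc N) = ?T * (?a * Up N) + of_nat (Suc N) * (?a * (?c * ?T ^ N))"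
      by (simp only: Up.simps distrib_left tauY_gscal n1)
    moreover have "?T * (of_nat (Suc N) * (?b * ?T ^ N)) = of_nat (Suc N) * (?T * (?b * ?T ^ N))"
      by (simp only: n1)
    ultimately show ?thesis
      by (simp only: right_diff_distrib power_Suc) (simp only: algebra_simps)
  qed
  also have "\<dots> \<in> vnull n"
    by (intro vnull_add vnull_tauY Suc.IH vnull_of_nat current_Bm_shift tauY_power_word_span)
  finally show ?case .
qed

text \<open>The first two terms together weigh \<open>T^p b[-1] T^q\<close> by \<open>p - q\<close>.
  This is a sum of commutators with multiplicity \<open>(p + 1) (q + 1)\<close>, because
  \<open>p (q + 1) - (p + 1) q = p - q\<close>.\<close>

lemma Wp_symmetrise:
  "2 * Wp (Suc N) - of_nat (Suc N) * Ap N - gscal (1 - alpha2 n) * Vp N \<in> vnull n"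
proof (induction N)
  case 0
  show ?case by (simp add: Ap_0 vnull_zero)
next
  case (Suc N)
  let ?b = "current n Bm (- 1)" and ?a = "gscal (1 - alpha2 n)" and ?T = "tauY n"
  have n1: "of_nat k * (?T * g) = ?T * (of_nat k * g)" for k g
    by (rule of_nat_left_commute)
  have "2 * Wp (Suc (Suc N)) - of_nat (Suc (Suc N)) * Ap (Suc N) - ?a * Vp (Suc N)
     = ?T * (2 * Wp (Suc N) - of_nat (Suc N) * Ap N - ?a * Vp N)
       + (Ap (Suc N) - of_nat (Suc N) * (?b * ?T ^ N) - ?a * Up N)"
  proof -
    have "2 * Wp (Suc (Suc N)) = ?T * (2 * Wp (Suc N)) + 2 * Ap (Suc N)"
      by (simp add: mult_2 distrib_left distrib_right)
    moreover have "of_nat (Suc (Suc N)) * Ap (Suc N) = of_nat (Suc N) * Ap (Suc N) + Ap (Suc N)"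
      by (simp only: of_nat_Suc[of "Suc N"] distrib_right mult_1_left add.commute)
    moreover have "of_nat (Suc N) * Ap (Suc N) = ?T * (of_nat (Suc N) * Ap N) + of_nat (Suc N) * (?b * ?T ^ N)"
      by (simp only: Ap_Suc distrib_left n1)
    moreover have "?a * Vp (Suc N) = ?T * (?a * Vp N) + ?a * Up N"
      by (simp only: Vp.simps distrib_left tauY_gscal)
    ultimately show ?thesis
      by (simp only: right_diff_distrib mult_2) (simp only: algebra_simps)
  qed
  also have "\<dots> \<in> vnull n"
    by (intro vnull_add vnull_tauY Suc.IH Ap_symmetrise)
  finally show ?case .
qed

lemma current_zero: "current n (\<lambda>i j. 0) a = 0"
  by (simp add: current_def gscal_zero)

lemma shear_tauY: "cmap (shear n) (tauY n * f) = tauY n * cmap (shear n) f"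
proof -
  have "current n (\<lambda>i j. shear n (Ymat n i j)) (- 1) = current n (\<lambda>i j. 0) (- 1)"
    by (rule current_cong) (simp add: shear_Ymat)
  then show ?thesis
    by (simp only: cmap_tauY[OF derivation_shear] current_zero mult_zero_left add_0_right)
qed

lemma shear_tauY_power: "cmap (shear n) (tauY n ^ N) = 0"
  by (induction N) (simp_all add: shear_tauY cmap_derivation_one derivation_shear)

lemma shear_Cm: "cmap (shear n) (current n Cm a * f) = current n Cm a * cmap (shear n) f"
proof -
  have "current n (\<lambda>i j. shear n (Cm i j)) a = current n (\<lambda>i j. 0) a"
    by (rule current_cong) (simp add: Cm_def shear_bracket)
  then show ?thesis
    by (simp only: cmap_current[OF derivation_shear] current_zero mult_zero_left add_0_right)
qed

lemma shear_Up: "cmap (shear n) (Up N) = 0"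
proof (induction N)
  case (Suc N)
  have a: "additive (cmap (shear n) :: galg \<Rightarrow> galg)"
    by (rule additive_cmap[OF derivation_additive[OF derivation_shear]])
  have *: "cmap (shear n) (of_nat k * g) = of_nat k * cmap (shear n) g" for k and g :: galg
    by (induction k) (simp_all add: additive.zero[OF a] additive.add[OF a] distrib_right)
  show ?case
    by (simp only: Up.simps additive.add[OF a] * shear_tauY shear_Cm shear_tauY_power Suc.IH mult_zero_right add_0_right)
qed (simp add: cmap_zero derivation_additive derivation_shear)

text \<open>\<open>Vp\<close> is built from \<open>T\<close> and \<open>c[-2]\<close>, whose
  coefficients depend on the bivector alone. This is the condition under which the average of
  \<open>1 - alpha2 n\<close> times \<open>Vp N\<close> vanishes.\<close>

lemma shear_Vp: "cmap (shear n) (Vp N) = 0"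
proof (induction N)
  case (Suc N)
  then show ?case
    by (simp add: cmap_add derivation_additive derivation_shear shear_tauY shear_Up)
qed (simp add: cmap_zero derivation_additive derivation_shear)

text \<open>The constant part of \<open>Zm\<close> has no divergence, so the whole factor comes from
  \<open>Cm\<close>. The minus signs of the integration by parts and of the divergence
  cancel.\<close>

lemma gauss_Zm: "gauss n w (mder n Zm p) = 2 * dual_coxeter n * gauss n w (qform n (cmat x) * p)"
proof -
  have "(\<Sum>i<n. \<Sum>j<n. glder i j (Zm i j)) = - (2 * (of_nat n - 2) * qform n (cmat x))"
    unfolding Zm_def Cm_def
    by (simp add: derivation_add[OF derivation_glder] glder_const divergence[OF x])
  moreover have "2 * (of_nat n - 2) * qform n (cmat x) * p = scal (2 * dual_coxeter n) (qform n (cmat x) * p)"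
  proof -
    have "(2 * (of_nat n - 2) :: gpoly) = cst (2 * dual_coxeter n)"
    proof -
      have "cst (2 * dual_coxeter n) = cst 2 * (cst (of_nat n) - cst 2)"
        by (simp only: dual_coxeter_def mult_single single_diff[symmetric] add_0_left)
      then show ?thesis by (simp only: single_numeral single_of_nat)
    qed
    then show ?thesis by (simp add: scal_def mult.assoc)
  qed
  ultimately show ?thesis
    by (simp add: gauss_mder gauss_uminus cfunctional_scal[OF cfunctional_gauss])
qed

lemma kappa_eq: "kappa = cst (- dual_coxeter n) * qform n (cmat x)"
proof -
  have "cst (1 / 2) * (2 :: gpoly) = 1"
    using mult_single[of 0 "1/2 :: complex" 0 2] by simp
  then have "cst (1 / 2) * (2 * qform n (cmat x)) = qform n (cmat x)"
    by (metis mult.assoc mult_1_left)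
  then show ?thesis
    unfolding kappa_def tform_def trace_Ymat[OF skew_cmat[OF x]] by (simp only:)
qed

text \<open>In twice the relation for \<open>x[1]\<close>, the term \<open>2 * kappa\<close>
  averages to \<open>- 2 (n - 2)\<close> times the form and \<open>Ap N\<close> to
  \<open>2 (n - 2)\<close> times the form, with the common multiplicity
  \<open>Suc N\<close>.\<close>

lemma current1_vac:
  assumes w: "\<And>m. w m = (of_nat n + of_nat m) * (of_nat n + of_nat m - 1) * w (m + 2)"
  shows "on_one (cmap (gauss n w) (current n (cmat x) 1 * tauY n ^ Suc N)) \<in> vac_ideal n"
proof -
  let ?E = "cmap (gauss n w)" and ?q = "qform n (cmat x)" and ?d = "dual_coxeter n"
  have add: "additive ?E" by (rule additive_cmap[OF additive_gauss])
  have scale: "?E (of_nat k * f) = scal (of_nat k) (?E f)" for k f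
    by (induction k) (simp_all add: additive.zero[OF add] additive.add[OF add] distrib_right scal_add_left)
  have K: "?E (gscal kappa * tauY n ^ N) = scal (- ?d) (?E (gscal ?q * tauY n ^ N))"
    unfolding kappa_eq gscal_mult mult.assoc by (rule cmap_cst[OF cfunctional_gauss])
  have A: "?E (Ap N) = scal (2 * ?d) (?E (gscal ?q * tauY n ^ N))"
  proof -
    have "?E (Ap N) = cmap (\<lambda>c. 2 * ?d * gauss n w (?q * c)) (tauY n ^ N)"
      unfolding Ap_def cmap_cmap[OF additive_gauss derivation_additive[OF derivation_mder]] gauss_Zm ..
    also have "\<dots> = scal (2 * ?d) (?E (gscal ?q * tauY n ^ N))"
      by (simp add: cmap_gscal[OF additive_gauss] cmap_scale cfunctional_additive[OF cfunctional_mult[OF cfunctional_gauss]])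
    finally show ?thesis .
  qed
  \<comment> \<open>Each coefficient of \<open>Vp N\<close> is constant along the shear, so the
    weight recursion applies coefficient by coefficient.\<close>
  have V: "?E (gscal (1 - alpha2 n) * Vp N) = 0"
  proof (rule poly_mapping_eqI)
    fix v
    have "shear n (Poly_Mapping.lookup (Vp N) v) = 0"
      using lookup_cmap[OF derivation_additive[OF derivation_shear], of n "Vp N" v] shear_Vp[of N] by simp
    then show "Poly_Mapping.lookup (?E (gscal (1 - alpha2 n) * Vp N)) v = Poly_Mapping.lookup 0 v"
      by (simp add: lookup_cmap additive_gauss lookup_gscal left_diff_distrib gauss_diff gauss_alpha2[OF w])
  qed
  \<comment> \<open>The doubling lets \<open>p + 1\<close> be replaced by its mean within integer
    coefficients.\<close>
  have "2 * (current n (cmat x) 1 * tauY n ^ Suc N - of_nat (Suc N) * (gscal kappa * tauY n ^ N) - Wp (Suc N))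
     + (2 * Wp (Suc N) - of_nat (Suc N) * Ap N - gscal (1 - alpha2 n) * Vp N) \<in> vnull n"
    using vnull_of_nat[OF current1_tauY_power, of 2] by (intro vnull_add Wp_symmetrise) simp
  then have "2 * (current n (cmat x) 1 * tauY n ^ Suc N) - 2 * (of_nat (Suc N) * (gscal kappa * tauY n ^ N))
     - of_nat (Suc N) * Ap N - gscal (1 - alpha2 n) * Vp N \<in> vnull n"
  proof -
    have "2 * (a - b - c) + (2 * c - d - e) = 2 * a - 2 * b - d - e" for a b c d e :: galg
      by (simp add: algebra_simps)
    then show "2 * (current n (cmat x) 1 * tauY n ^ Suc N - of_nat (Suc N) * (gscal kappa * tauY n ^ N) - Wp (Suc N))
     + (2 * Wp (Suc N) - of_nat (Suc N) * Ap N - gscal (1 - alpha2 n) * Vp N) \<in> vnull n \<Longrightarrow> ?thesis"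
      by (simp only:)
  qed
  then have "on_one (?E (of_nat 2 * (current n (cmat x) 1 * tauY n ^ Suc N) - of_nat 2 * (of_nat (Suc N) * (gscal kappa * tauY n ^ N))
     - of_nat (Suc N) * Ap N - gscal (1 - alpha2 n) * Vp N)) \<in> vac_ideal n"
    using cfunctional_gauss by (simp add: vnull_def)
  also have "?E (of_nat 2 * (current n (cmat x) 1 * tauY n ^ Suc N) - of_nat 2 * (of_nat (Suc N) * (gscal kappa * tauY n ^ N))
     - of_nat (Suc N) * Ap N - gscal (1 - alpha2 n) * Vp N) = scal 2 (?E (current n (cmat x) 1 * tauY n ^ Suc N))"
    unfolding additive.diff[OF add] scale K A V
    by (simp add: scal_minus_left scal_minus_right mult_ac del: power_Suc of_nat_Suc)
  finally have "scal 2 (on_one (?E (current n (cmat x) 1 * tauY n ^ Suc N))) \<in> vac_ideal n"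
    by (simp only: clinear_map_scal[OF clinear_on_one])
  from vac_scal[OF this, of "1 / 2"] show ?thesis by simp
qed

lemma current0_vac: "on_one (cmap (gauss n w) (current n (cmat x) 0 * tauY n ^ N)) \<in> vac_ideal n"
proof -
  have "on_one (cmap (gauss n w) (current n (cmat x) 0 * tauY n ^ N - cmap (mder n (cmat x)) (tauY n ^ N))) \<in> vac_ideal n"
    using current0_tauY_power[OF skew_cmat[OF x], of N] cfunctional_gauss by (simp add: vnull_def)
  moreover have "cmap (gauss n w) (cmap (mder n (cmat x)) (tauY n ^ N)) = 0"
    by (rule poly_mapping_eqI)
      (simp add: lookup_cmap additive_gauss derivation_additive derivation_mder gauss_mder_cmat)
  ultimately show ?thesis by (simp add: cmap_diff additive_gauss)
qed

end

subsection \<open>MacMahon's master theorem for the invariants\<close>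

lemma fps_deriv_prod:
  fixes f :: "'i \<Rightarrow> 'a::comm_ring_1 fps"
  assumes "finite S"
  shows "fps_deriv (prod f S) = (\<Sum>i\<in>S. fps_deriv (f i) * prod f (S - {i}))"
  using assms
proof (induction S rule: finite_induct)
  case (insert x S)
  have "(\<Sum>i\<in>S. fps_deriv (f i) * prod f (insert x S - {i})) = f x * (\<Sum>i\<in>S. fps_deriv (f i) * prod f (S - {i}))"
    unfolding sum_distrib_left
  proof (rule sum.cong[OF refl])
    fix i assume "i \<in> S"
    with insert.hyps have "insert x S - {i} = insert x (S - {i})" "x \<notin> S - {i}" by auto
    then show "fps_deriv (f i) * prod f (insert x S - {i}) = f x * (fps_deriv (f i) * prod f (S - {i}))"
      using insert.hyps by (simp add: mult_ac)
  qed
  then show ?case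
    using insert by (simp add: mult_ac add.commute)
qed simp

text \<open>The Leibniz rule differentiates one row at a time, and the cofactors along that row do
  not see the differentiated entries.\<close>

lemma fps_deriv_det:
  fixes M :: "'a::comm_ring_1 fps mat"
  assumes M: "M \<in> carrier_mat n n"
  shows "fps_deriv (det M) = (\<Sum>i<n. \<Sum>j<n. fps_deriv (M $$ (i, j)) * cofactor M i j)"
proof -
  define R where "R i = mat n n (\<lambda>(k, j). if k = i then fps_deriv (M $$ (i, j)) else M $$ (k, j))" for i
  have R: "R i \<in> carrier_mat n n" for i by (simp add: R_def)
  have detR: "det (R i) = (\<Sum>j<n. fps_deriv (M $$ (i, j)) * cofactor M i j)" if i: "i < n" for i
  proof -
    have "det (R i) = (\<Sum>j<n. R i $$ (i, j) * cofactor (R i) i j)"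
      by (rule laplace_expansion_row[OF R i])
    also have "\<dots> = (\<Sum>j<n. fps_deriv (M $$ (i, j)) * cofactor M i j)"
    proof (rule sum.cong[OF refl])
      fix j assume "j \<in> {..<n}"
      then have j: "j < n" by simp
      have "mat_delete (R i) i j = mat_delete M i j"
        unfolding mat_delete_def using M i j by (intro eq_matI) (auto simp: R_def)
      then show "R i $$ (i, j) * cofactor (R i) i j = fps_deriv (M $$ (i, j)) * cofactor M i j"
        using i j by (simp add: R_def cofactor_def)
    qed
    finally show ?thesis .
  qed
  have "fps_deriv (det M) = (\<Sum>p\<in>{p. p permutes {0..<n}}. signof p * fps_deriv (\<Prod>i = 0..<n. M $$ (i, p i)))"
    unfolding det_def'[OF M] fps_deriv_sum
    by (rule sum.cong[OF refl]) (auto simp: sign_def)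
  also have "\<dots> = (\<Sum>p\<in>{p. p permutes {0..<n}}. \<Sum>i<n. signof p * (\<Prod>k = 0..<n. R i $$ (k, p k)))"
  proof (rule sum.cong[OF refl])
    fix p assume "p \<in> {p. p permutes {0..<n}}"
    then have p: "p k < n" if "k < n" for k
      using that permutes_in_image[of p "{0..<n}" k] by auto
    have "fps_deriv (\<Prod>i = 0..<n. M $$ (i, p i)) = (\<Sum>i<n. \<Prod>k = 0..<n. R i $$ (k, p k))"
      unfolding atLeast0LessThan fps_deriv_prod[OF finite_lessThan]
    proof (rule sum.cong[OF refl])
      fix i assume i: "i \<in> {..<n}"
      have "(\<Prod>k<n. R i $$ (k, p k)) = R i $$ (i, p i) * (\<Prod>k\<in>{..<n} - {i}. R i $$ (k, p k))"
        using i by (intro prod.remove) auto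
      also have "(\<Prod>k\<in>{..<n} - {i}. R i $$ (k, p k)) = (\<Prod>k\<in>{..<n} - {i}. M $$ (k, p k))"
        by (rule prod.cong) (use p in \<open>auto simp: R_def\<close>)
      finally show "fps_deriv (M $$ (i, p i)) * (\<Prod>k\<in>{..<n} - {i}. M $$ (k, p k)) = (\<Prod>k<n. R i $$ (k, p k))"
        using i p by (simp add: R_def)
    qed
    then show "signof p * fps_deriv (\<Prod>i = 0..<n. M $$ (i, p i)) = (\<Sum>i<n. signof p * (\<Prod>k = 0..<n. R i $$ (k, p k)))"
      by (simp add: sum_distrib_left)
  qed
  also have "\<dots> = (\<Sum>i<n. det (R i))"
    unfolding det_def'[OF R] by (rule sum.swap)
  also have "\<dots> = (\<Sum>i<n. \<Sum>j<n. fps_deriv (M $$ (i, j)) * cofactor M i j)"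
    by (rule sum.cong) (simp_all add: detR)
  finally show ?thesis .
qed

lemma cofactor_column:
  fixes M :: "'a::comm_ring_1 mat"
  assumes M: "M \<in> carrier_mat n n" and kl: "k < n" "l < n"
  shows "(\<Sum>j<n. M $$ (j, l) * cofactor M j k) = (if k = l then det M else 0)"
proof -
  have "(\<Sum>j<n. M $$ (j, l) * cofactor M j k) = (adj_mat M * M) $$ (k, l)"
    using M kl by (simp add: adj_mat_def scalar_prod_def atLeast0LessThan mult.commute)
  also have "\<dots> = (if k = l then det M else 0)"
    unfolding adj_mat(3)[OF M] using kl by simp
  finally show ?thesis .
qed

section \<open>Generating functions of Gaussian moments\<close>

type_synonym 'b gsym = "'b multiset \<Rightarrow>\<^sub>0 gpoly"

definition emb :: "'b symalg \<Rightarrow> 'b gsym" where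
  "emb = cmap (\<lambda>c. Poly_Mapping.single 0 c)"

definition qscal :: "gpoly \<Rightarrow> 'b gsym" where
  "qscal p = Poly_Mapping.single 0 p"

lemma additive_cst: "additive (\<lambda>c. Poly_Mapping.single 0 c)"
  by (simp add: additive_def single_add)

lemma additive_emb: "additive emb"
  unfolding emb_def by (rule additive_cmap[OF additive_cst])

lemma emb_single: "emb (Poly_Mapping.single w c) = Poly_Mapping.single w (cst c)"
  by (simp add: emb_def cmap_single additive_cst)

lemma cfunctional_cst: "cfunctional \<phi> \<Longrightarrow> \<phi> (cst c * d) = c * \<phi> d"
  using cfunctional_scal[of \<phi> c d] by (simp add: scal_def)

lemma cmap_emb:
  assumes phi: "cfunctional \<phi>"
  shows "cmap \<phi> (emb A * f) = A * cmap \<phi> f"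
proof (rule additive_eqI[where F = "\<lambda>A. cmap \<phi> (emb A * f)" and G = "\<lambda>A. A * cmap \<phi> f"])
  note a = cfunctional_additive[OF phi]
  show "additive (\<lambda>A. cmap \<phi> (emb A * f))"
    by (simp add: additive_def additive.add[OF additive_emb] distrib_right cmap_add[OF a])
  show "additive (\<lambda>A. A * cmap \<phi> f)" by (rule additive_mult_right)
  fix w c
  have "cmap \<phi> (emb (Poly_Mapping.single w c) * f) = Poly_Mapping.single w 1 * cmap (\<lambda>d. c * \<phi> d) f"
    by (simp add: emb_single cmap_single_mult[OF a] cfunctional_cst[OF phi])
  also have "cmap (\<lambda>d. c * \<phi> d) f = scal c (cmap \<phi> f)"
    by (rule poly_mapping_eqI) (simp add: lookup_cmap a additive_comp[OF additive_mult_left])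
  finally show "cmap \<phi> (emb (Poly_Mapping.single w c) * f) = Poly_Mapping.single w c * cmap \<phi> f"
    by (metis mult.right_neutral mult_scal_right scal_mult_left scal_single)
qed

lemma cmap_qscal:
  fixes \<phi> :: "gpoly \<Rightarrow> 'q::ring_1"
  assumes "additive \<phi>"
  shows "cmap \<phi> (qscal p * f) = cmap (\<lambda>c. \<phi> (p * c)) f"
proof -
  have "cmap \<phi> (qscal p * f) = Poly_Mapping.single 0 1 * cmap (\<lambda>c. \<phi> (p * c)) f"
    unfolding qscal_def by (rule cmap_single_mult) fact
  then show ?thesis by (simp only: single_one mult_1_left)
qed

lemma derivation_cmap:
  assumes D: "derivation D"
  shows "derivation (cmap D :: 'b gsym \<Rightarrow> 'b gsym)"
  unfolding derivation_def
proof (intro conjI allI)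
  note a = derivation_additive[OF D]
  show add: "additive (cmap D :: 'b gsym \<Rightarrow> 'b gsym)" by (rule additive_cmap[OF a])
  fix p q :: "'b gsym"
  show "cmap D (p * q) = cmap D p * q + p * cmap D q"
  proof (induction p rule: poly_mapping_single_induct)
    case (single v c)
    show ?case
      by (induction q rule: poly_mapping_single_induct)
        (simp_all add: mult_single cmap_single a derivation_mult[OF D] single_add distrib_left additive.add[OF add])
  qed (simp add: distrib_right additive.add[OF add])
qed

lemma derivation_emb:
  assumes D: "derivation D" and cst: "\<And>c. D (cst c) = 0"
  shows "cmap D (emb A) = 0"
  unfolding emb_def cmap_cmap[OF derivation_additive[OF D] additive_cst] cst
  by (rule poly_mapping_eqI) (simp add: lookup_cmap additive_def)

lemma derivation_power:
  "derivation D \<Longrightarrow> D (a ^ Suc m) = of_nat (Suc m) * a ^ m * D a" for a :: "'a::comm_ring_1"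
proof (induction m)
  case (Suc m)
  have "D (a ^ Suc (Suc m)) = D a * a ^ Suc m + a * D (a ^ Suc m)"
    using derivation_mult[OF Suc.prems, of a "a ^ Suc m"] by simp
  then show ?case
    unfolding Suc.IH[OF Suc.prems] by (simp add: algebra_simps)
qed simp

context
  fixes n :: nat and A :: "nat \<Rightarrow> nat \<Rightarrow> 'b symalg"
begin

definition mm_form :: "'b gsym" where
  "mm_form = (\<Sum>i<n. \<Sum>j<n. qscal (gv i * var (Cov j)) * emb (A i j))"

definition mm_E :: "'b gsym \<Rightarrow> 'b symalg" where
  "mm_E = cmap (gauss n (\<lambda>_. 1))"

definition mm_z :: "nat \<Rightarrow> 'b symalg" where
  "mm_z m = mm_E (mm_form ^ m)"

text \<open>These are the two-point functions of the quadratic form. Their generating matrix turns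
  out to be \<open>mm_zf\<close> times the transposed inverse of \<open>mm_mat\<close>.\<close>

definition mm_g :: "nat \<Rightarrow> nat \<Rightarrow> nat \<Rightarrow> 'b symalg" where
  "mm_g m i j = mm_E (qscal (gv i * var (Cov j)) * mm_form ^ m)"

lemma additive_mm_E: "additive mm_E"
  unfolding mm_E_def by (rule additive_cmap[OF additive_gauss])

lemma mm_E_emb: "mm_E (emb B * f) = B * mm_E f"
  unfolding mm_E_def by (rule cmap_emb[OF cfunctional_gauss])

lemma mm_E_Cov:
  assumes "j < n"
  shows "mm_E (qscal (var (Cov j)) * f) = mm_E (cmap (partial (Vec j)) f)"
  unfolding mm_E_def
  by (simp add: cmap_qscal additive_gauss gauss_Cov[OF assms] cmap_cmap derivation_additive derivation_partial)

lemma qscal_mult: "qscal (p * q) = qscal p * qscal q"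
  by (simp add: qscal_def mult_single)

lemma partial_qscal: "cmap (partial x) (qscal p) = qscal (partial x p)"
  by (simp add: qscal_def cmap_single derivation_additive derivation_partial)

lemma partial_mm_form:
  assumes "k < n"
  shows "cmap (partial (Vec k)) mm_form = (\<Sum>l<n. qscal (var (Cov l)) * emb (A k l))"
proof -
  note D = derivation_cmap[OF derivation_partial, of "Vec k"]
  have "cmap (partial (Vec k)) (qscal (gv i * var (Cov j)) * emb (A i j)) = (if i = k then qscal (var (Cov j)) * emb (A k j) else 0)" for i j
    by (simp add: derivation_mult[OF D] partial_qscal derivation_emb derivation_partial derivation_mult[OF derivation_partial] partial_var)
      (simp add: qscal_def)
  then have "cmap (partial (Vec k)) mm_form = (\<Sum>i<n. if i = k then (\<Sum>j<n. qscal (var (Cov j)) * emb (A k j)) else 0)"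
    unfolding mm_form_def derivation_sum[OF D] by (intro sum.cong refl) auto
  then show ?thesis using assms by simp
qed

lemma mm_z_0: "mm_z 0 = 1"
proof -
  have "gauss n (\<lambda>_. 1) (1 :: gpoly) = 1"
    using gauss_single[of n "\<lambda>_. 1" 0 1] by (simp add: gauss_moment_def balanced_def)
  moreover have "cmap (gauss n (\<lambda>_. 1)) (1 :: 'b gsym) = Poly_Mapping.single 0 (gauss n (\<lambda>_. 1) 1)"
    using cmap_single[OF additive_gauss, of n "\<lambda>_. 1" 0 1] by simp
  ultimately show ?thesis by (simp add: mm_z_def mm_E_def)
qed

lemma mm_z_Suc: "mm_z (Suc m) = (\<Sum>i<n. \<Sum>j<n. A i j * mm_g m i j)"
proof -
  have "mm_form ^ Suc m = (\<Sum>i<n. \<Sum>j<n. emb (A i j) * (qscal (gv i * var (Cov j)) * mm_form ^ m))"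
    unfolding power_Suc by (subst (1) mm_form_def) (simp add: sum_distrib_left sum_distrib_right mult_ac)
  then show ?thesis
    by (simp add: mm_z_def mm_g_def additive.sum[OF additive_mm_E] mm_E_emb)
qed

text \<open>Integration by parts against \<open>u\<^sub>j\<close>.\<close>

lemma mm_g_rec:
  assumes "i < n" "j < n"
  shows "mm_g m i j = (if i = j then mm_z m else 0) + of_nat m * (\<Sum>l<n. A j l * mm_g (m - 1) i l)"
proof -
  note D = derivation_cmap[OF derivation_partial, of "Vec j"]
  have "mm_g m i j = mm_E (qscal (var (Cov j)) * (qscal (gv i) * mm_form ^ m))"
    by (simp add: mm_g_def qscal_mult mult_ac)
  also have "\<dots> = mm_E (cmap (partial (Vec j)) (qscal (gv i) * mm_form ^ m))"
    by (rule mm_E_Cov) fact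
  also have "cmap (partial (Vec j)) (qscal (gv i) * mm_form ^ m)
      = (if i = j then mm_form ^ m else 0) + qscal (gv i) * cmap (partial (Vec j)) (mm_form ^ m)"
  proof -
    have "qscal 1 = (1 :: 'b gsym)" "qscal 0 = (0 :: 'b gsym)" by (simp_all add: qscal_def)
    then show ?thesis
      by (auto simp: derivation_mult[OF D] partial_qscal partial_var)
  qed
  also have "mm_E \<dots> = (if i = j then mm_z m else 0) + mm_E (qscal (gv i) * cmap (partial (Vec j)) (mm_form ^ m))"
    by (simp add: additive.add[OF additive_mm_E] additive.zero[OF additive_mm_E] mm_z_def)
  also have "mm_E (qscal (gv i) * cmap (partial (Vec j)) (mm_form ^ m)) = of_nat m * (\<Sum>l<n. A j l * mm_g (m - 1) i l)"
  proof (cases m)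
    case 0
    then show ?thesis by (simp add: derivation_one[OF D] additive.zero[OF additive_mm_E])
  next
    case (Suc k)
    have nat: "mm_E (of_nat r * f) = of_nat r * mm_E f" for r f
      by (induction r) (simp_all add: additive.zero[OF additive_mm_E] additive.add[OF additive_mm_E] distrib_right)
    have "qscal (gv i) * cmap (partial (Vec j)) (mm_form ^ m)
       = of_nat m * (\<Sum>l<n. emb (A j l) * (qscal (gv i * var (Cov l)) * mm_form ^ k))"
      unfolding Suc derivation_power[OF D] partial_mm_form[OF assms(2)]
      by (simp only: sum_distrib_left qscal_mult mult_ac)
    then show ?thesis
      by (simp add: nat additive.sum[OF additive_mm_E] mm_E_emb mm_g_def Suc del: of_nat_Suc)
  qed
  finally show ?thesis .
qed

definition mm_mat :: "'b symalg fps mat" where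
  "mm_mat = 1\<^sub>m n - fps_X \<cdot>\<^sub>m mat n n (\<lambda>(i, j). fps_const (A i j))"

lemma mm_mat_carrier: "mm_mat \<in> carrier_mat n n"
  unfolding mm_mat_def by (intro minus_carrier_mat smult_carrier_mat mat_carrier)

lemma mm_mat_index:
  "i < n \<Longrightarrow> j < n \<Longrightarrow> mm_mat $$ (i, j) = (if i = j then 1 else 0) - fps_X * fps_const (A i j)"
  by (simp add: mm_mat_def)

definition mm_zf :: "'b symalg fps" where
  "mm_zf = Abs_fps (\<lambda>m. scal (1 / fact m) (mm_z m))"

definition mm_gf :: "nat \<Rightarrow> nat \<Rightarrow> 'b symalg fps" where
  "mm_gf i j = Abs_fps (\<lambda>m. scal (1 / fact m) (mm_g m i j))"

lemma of_nat_mult_scal: "of_nat k * f = scal (of_nat k) f" for f :: "'m::monoid_add \<Rightarrow>\<^sub>0 complex"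
  by (simp add: scal_def)

lemma mm_gf_rec:
  assumes "i < n" "j < n"
  shows "mm_gf i j = (if i = j then mm_zf else 0) + fps_X * (\<Sum>l<n. fps_const (A j l) * mm_gf i l)"
proof (rule fps_ext)
  fix m
  show "fps_nth (mm_gf i j) m = fps_nth ((if i = j then mm_zf else 0) + fps_X * (\<Sum>l<n. fps_const (A j l) * mm_gf i l)) m"
  proof (cases m)
    case 0
    then show ?thesis by (simp add: mm_gf_def mm_zf_def mm_g_rec[OF assms, of 0])
  next
    case (Suc k)
    have "scal (1 / fact (Suc k)) (of_nat (Suc k) * f) = scal (1 / fact k) f" for f :: "'b symalg"
      unfolding of_nat_mult_scal by (simp del: of_nat_Suc)
    then have "scal (1 / fact m) (mm_g m i j) = scal (1 / fact m) (if i = j then mm_z m else 0)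
        + scal (1 / fact k) (\<Sum>l<n. A j l * mm_g k i l)"
      unfolding mm_g_rec[OF assms, of m] scal_add_right by (simp add: Suc del: of_nat_Suc fact_Suc)
    then show ?thesis
      by (simp add: mm_gf_def mm_zf_def Suc fps_sum_nth scal_sum_right)
  qed
qed

lemma mm_zf_deriv: "fps_deriv mm_zf = (\<Sum>i<n. \<Sum>j<n. fps_const (A i j) * mm_gf i j)"
proof (rule fps_ext)
  fix m
  have "of_nat (Suc m) * scal (1 / fact (Suc m)) f = scal (1 / fact m) f" for f :: "'b symalg"
    unfolding of_nat_mult_scal by (simp del: of_nat_Suc)
  moreover have "fps_nth (fps_deriv mm_zf) m = of_nat (Suc m) * scal (1 / fact (Suc m)) (mm_z (Suc m))"
    by (simp add: mm_zf_def del: of_nat_Suc fact_Suc)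
  ultimately have "fps_nth (fps_deriv mm_zf) m = scal (1 / fact m) (mm_z (Suc m))"
    by (simp only:)
  then show "fps_nth (fps_deriv mm_zf) m = fps_nth (\<Sum>i<n. \<Sum>j<n. fps_const (A i j) * mm_gf i j) m"
    by (simp add: mm_gf_def fps_sum_nth mm_z_Suc scal_sum_right del: fps_deriv_nth)
qed

lemma mm_gf_mat:
  assumes "i < n" "j < n"
  shows "(\<Sum>l<n. mm_gf i l * mm_mat $$ (j, l)) = (if i = j then mm_zf else 0)"
proof -
  have "(\<Sum>l<n. mm_gf i l * mm_mat $$ (j, l))
     = (\<Sum>l<n. (if j = l then mm_gf i l else 0) - fps_X * (fps_const (A j l) * mm_gf i l))"
    by (rule sum.cong) (use assms in \<open>auto simp: mm_mat_index algebra_simps\<close>)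
  also have "\<dots> = mm_gf i j - fps_X * (\<Sum>l<n. fps_const (A j l) * mm_gf i l)"
    using assms by (simp add: sum_subtractf sum_distrib_left)
  also have "\<dots> = (if i = j then mm_zf else 0)"
    by (subst mm_gf_rec[OF assms]) simp
  finally show ?thesis .
qed

text \<open>By \<open>mm_gf_mat\<close> the generating matrix times the transpose of
  \<open>mm_mat\<close> is scalar. Multiplication by cofactors takes the place of the inverse, so
  nothing is divided.\<close>

lemma mm_gf_det:
  assumes "i < n" "l < n"
  shows "mm_gf i l * det mm_mat = mm_zf * cofactor mm_mat i l"
proof -
  have "mm_gf i l * det mm_mat = (\<Sum>k<n. mm_gf i k * (if l = k then det mm_mat else 0))"
    using assms by (simp add: if_distrib[of "(*) _"] cong: if_cong)
  also have "\<dots> = (\<Sum>k<n. \<Sum>j<n. mm_gf i k * mm_mat $$ (j, k) * cofactor mm_mat j l)"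
    by (rule sum.cong[OF refl])
      (use assms in \<open>simp add: cofactor_column[OF mm_mat_carrier, symmetric] sum_distrib_left mult.assoc\<close>)
  also have "\<dots> = (\<Sum>j<n. (\<Sum>k<n. mm_gf i k * mm_mat $$ (j, k)) * cofactor mm_mat j l)"
    by (subst sum.swap) (simp add: sum_distrib_right)
  also have "\<dots> = (\<Sum>j<n. if i = j then mm_zf * cofactor mm_mat j l else 0)"
    by (rule sum.cong) (use assms in \<open>auto simp: mm_gf_mat\<close>)
  finally show ?thesis using assms by simp
qed

text \<open>A permutation other than the identity picks an off-diagonal entry, which is a multiple
  of \<open>fps_X\<close>. The value fixes the constant that a vanishing derivative leaves
  open.\<close>

lemma mm_det_0: "fps_nth (det mm_mat) 0 = 1"
proof -
  have "fps_nth (det mm_mat) 0 = (\<Sum>p\<in>{p. p permutes {0..<n}}. fps_nth (signof p * (\<Prod>i = 0..<n. mm_mat $$ (i, p i))) 0)"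
    unfolding det_def'[OF mm_mat_carrier] by (rule fps_sum_nth)
  also have "\<dots> = (\<Sum>p\<in>{p. p permutes {0..<n}}. if p = id then 1 else 0)"
  proof (rule sum.cong[OF refl])
    fix p assume p: "p \<in> {p. p permutes {0..<n}}"
    have e: "fps_nth (mm_mat $$ (i, p i)) 0 = (if i = p i then 1 else 0)" if "i < n" for i
      using that p permutes_in_image[of p "{0..<n}" i] by (simp add: mm_mat_index)
    show "fps_nth (signof p * (\<Prod>i = 0..<n. mm_mat $$ (i, p i))) 0 = (if p = id then 1 else 0)"
    proof (cases "p = id")
      case True
      have "fps_nth (\<Prod>i\<in>S. mm_mat $$ (i, i)) 0 = (\<Prod>i\<in>S. fps_nth (mm_mat $$ (i, i)) 0)" for S :: "nat set"
        by (induction S rule: infinite_finite_induct) simp_all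
      moreover have "(\<Prod>i = 0..<n. fps_nth (mm_mat $$ (i, i)) 0) = 1"
        using e by (intro prod.neutral) (simp add: True)
      ultimately show ?thesis using True by (simp add: sign_id)
    next
      case False
      then obtain i where i: "p i \<noteq> i" by fastforce
      then have "i < n" using p permutes_not_in[of p "{0..<n}" i] by force
      have "(\<Prod>i = 0..<n. mm_mat $$ (i, p i)) = mm_mat $$ (i, p i) * (\<Prod>k\<in>{0..<n} - {i}. mm_mat $$ (k, p k))"
        using \<open>i < n\<close> by (intro prod.remove) auto
      then have "fps_nth (\<Prod>i = 0..<n. mm_mat $$ (i, p i)) 0 = 0"
        using e[OF \<open>i < n\<close>] i by simp
      then show ?thesis using False by simp
    qed
  qed
  also have "\<dots> = 1"
    by (simp add: sum.delta permutes_id finite_permutations)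
  finally show ?thesis .
qed

lemma of_nat_mult_eq_0: "of_nat (Suc m) * f = 0 \<Longrightarrow> f = 0" for f :: "'m::monoid_add \<Rightarrow>\<^sub>0 complex"
proof -
  assume "of_nat (Suc m) * f = 0"
  then have "scal (1 / of_nat (Suc m)) (scal (of_nat (Suc m)) f) = 0"
    unfolding of_nat_mult_scal by simp
  then show "f = 0" by (simp del: of_nat_Suc)
qed

text \<open>\<open>mm_gf_det\<close> and Jacobi's formula make the derivative of the product vanish.\<close>

lemma macmahon: "mm_zf * det mm_mat = 1"
proof -
  have "fps_deriv (det mm_mat) = (\<Sum>i<n. \<Sum>j<n. - fps_const (A i j) * cofactor mm_mat i j)"
    unfolding fps_deriv_det[OF mm_mat_carrier]
    by (intro sum.cong refl) (auto simp: mm_mat_index)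
  then have "fps_deriv (mm_zf * det mm_mat)
      = (\<Sum>i<n. \<Sum>j<n. fps_const (A i j) * (mm_gf i j * det mm_mat)) - (\<Sum>i<n. \<Sum>j<n. fps_const (A i j) * (mm_zf * cofactor mm_mat i j))"
    by (simp add: mm_zf_deriv sum_distrib_left sum_distrib_right sum_negf mult_ac del: fps_const_neg)
  also have "\<dots> = 0"
    by (simp add: mm_gf_det)
  finally have d: "fps_deriv (mm_zf * det mm_mat) = 0" .
  show ?thesis
  proof (rule fps_ext)
    fix m
    show "fps_nth (mm_zf * det mm_mat) m = fps_nth 1 m"
    proof (cases m)
      case 0
      then show ?thesis by (simp add: mm_zf_def mm_z_0 mm_det_0)
    next
      case (Suc k)
      have "fps_nth (fps_deriv (mm_zf * det mm_mat)) k = 0" unfolding d by simp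
      then have "of_nat (Suc k) * fps_nth (mm_zf * det mm_mat) (Suc k) = 0"
        unfolding fps_deriv_nth by simp
      then show ?thesis using of_nat_mult_eq_0 Suc by auto
    qed
  qed
qed

lemma mm_z_eq: "mm_z m = scal (fact m) (fps_nth (fps_right_inverse (det mm_mat) 1) m)"
proof -
  have r: "det mm_mat * fps_right_inverse (det mm_mat) 1 = 1"
    by (rule fps_right_inverse) (simp add: mm_det_0)
  have "mm_zf = (mm_zf * det mm_mat) * fps_right_inverse (det mm_mat) 1"
    by (simp only: mult.assoc r mult_1_right)
  then have "fps_right_inverse (det mm_mat) 1 = mm_zf"
    by (simp only: macmahon mult_1_left)
  then show ?thesis by (simp add: mm_zf_def)
qed

end

section \<open>The invariants as moments of a decomposable bivector\<close>

lemma sum_indicator_pair: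
  fixes f :: "nat \<Rightarrow> nat \<Rightarrow> 'a::comm_ring_1"
  assumes "k < n" "l < n"
  shows "(\<Sum>i<n. \<Sum>j<n. f i j * (if i = k \<and> j = l then 1 else 0)) = f k l"
proof -
  have "(\<Sum>i<n. \<Sum>j<n. f i j * (if i = k \<and> j = l then 1 else 0)) = (\<Sum>i<n. if i = k then f k l else 0)"
  proof (rule sum.cong[OF refl])
    fix i
    have "(\<Sum>j<n. f i j * (if i = k \<and> j = l then 1 else 0)) = (\<Sum>j<n. if j = l then (if i = k then f k l else 0) else 0)"
      by (rule sum.cong) auto
    then show "(\<Sum>j<n. f i j * (if i = k \<and> j = l then 1 else 0)) = (if i = k then f k l else 0)"
      using assms by simp
  qed
  then show ?thesis using assms by simp
qed

lemma Ymat_expansion: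
  assumes kl: "k < n" "l < n"
  shows "(\<Sum>i<n. \<Sum>j<n. gv i * var (Cov j) * cst (Fmat n i j $$ (k, l))) = Ymat n k l"
proof -
  have "cst (Fmat n i j $$ (k, l)) = (if i = k \<and> j = l then 1 else 0) - (if i = n - 1 - l \<and> j = n - 1 - k then 1 else 0)"
    if "i < n" "j < n" for i j
  proof -
    have a: "k = i \<and> l = j \<longleftrightarrow> i = k \<and> j = l" by auto
    have "k = n - 1 - j \<longleftrightarrow> j = n - 1 - k" "l = n - 1 - i \<longleftrightarrow> i = n - 1 - l"
      using kl that by linarith+
    then have b: "k = n - 1 - j \<and> l = n - 1 - i \<longleftrightarrow> i = n - 1 - l \<and> j = n - 1 - k" by blast
    show ?thesis unfolding Fmat_index[OF kl] a b by (rule cst_indicators)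
  qed
  then have "(\<Sum>i<n. \<Sum>j<n. gv i * var (Cov j) * cst (Fmat n i j $$ (k, l)))
     = (\<Sum>i<n. \<Sum>j<n. gv i * var (Cov j) * ((if i = k \<and> j = l then 1 else 0) - (if i = n - 1 - l \<and> j = n - 1 - k then 1 else 0)))"
    by (intro sum.cong refl) (simp only: lessThan_iff)
  also have "\<dots> = gv k * var (Cov l) - gv (n - 1 - l) * var (Cov (n - 1 - k))"
  proof -
    have "n - 1 - l < n" "n - 1 - k < n" using kl by linarith+
    then show ?thesis
      by (simp only: right_diff_distrib sum_subtractf sum_indicator_pair[of _ n _ "\<lambda>i j. gv i * var (Cov j)"] kl)
  qed
  also have "\<dots> = Ymat n k l"
    using kl by (simp add: Ymat_def wedge_def gw_def mult.commute)
  finally show ?thesis .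
qed

definition basis_mat :: "nat \<Rightarrow> nat \<times> nat \<Rightarrow> complex mat" where
  "basis_mat n p = Fmat n (fst p) (snd p)"

definition Ycoord :: "nat \<Rightarrow> nat \<times> nat \<Rightarrow> gpoly" where
  "Ycoord n p = Ymat n (fst p) (snd p)"

text \<open>Summed over all pairs, \<open>Fmat n i j\<close> and its reflection contribute to the
  same coordinate with opposite signs, which makes the coordinate an entry of the wedge. The
  quadratic form is thus the generic element \<open>Y\<close> itself.\<close>

lemma mm_form_so:
  "mm_form n (\<lambda>i j. so_to_sym n (Fmat n i j)) = (\<Sum>p\<in>basis_idx n. Poly_Mapping.single {#basis_mat n p#} (Ycoord n p))"
proof -
  have s: "emb (so_to_sym n x) = (\<Sum>p\<in>basis_idx n. Poly_Mapping.single {#basis_mat n p#} (cst (x $$ p)))" for x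
  proof -
    have "so_to_sym n x = (\<Sum>p\<in>basis_idx n. Poly_Mapping.single {#basis_mat n p#} (x $$ p))"
      by (simp add: so_to_sym_def basis_idx_def var_def basis_mat_def case_prod_unfold)
    then show ?thesis by (simp add: additive.sum[OF additive_emb] emb_single)
  qed
  have "mm_form n (\<lambda>i j. so_to_sym n (Fmat n i j))
     = (\<Sum>i<n. \<Sum>j<n. \<Sum>p\<in>basis_idx n. Poly_Mapping.single {#basis_mat n p#} (gv i * var (Cov j) * cst (Fmat n i j $$ p)))"
    unfolding mm_form_def s sum_distrib_left by (simp add: qscal_def mult_single)
  also have "\<dots> = (\<Sum>i<n. \<Sum>p\<in>basis_idx n. \<Sum>j<n. Poly_Mapping.single {#basis_mat n p#} (gv i * var (Cov j) * cst (Fmat n i j $$ p)))"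
    by (rule sum.cong[OF refl], rule sum.swap)
  also have "\<dots> = (\<Sum>p\<in>basis_idx n. \<Sum>i<n. \<Sum>j<n. Poly_Mapping.single {#basis_mat n p#} (gv i * var (Cov j) * cst (Fmat n i j $$ p)))"
    by (rule sum.swap)
  also have "\<dots> = (\<Sum>p\<in>basis_idx n. Poly_Mapping.single {#basis_mat n p#} (Ycoord n p))"
  proof (rule sum.cong[OF refl])
    fix p assume "p \<in> basis_idx n"
    then obtain k l where p: "p = (k, l)" "k < n" "l < n" using basis_idxD by (cases p) auto
    show "(\<Sum>i<n. \<Sum>j<n. Poly_Mapping.single {#basis_mat n p#} (gv i * var (Cov j) * cst (Fmat n i j $$ p)))
        = Poly_Mapping.single {#basis_mat n p#} (Ycoord n p)"
      using Ymat_expansion[OF p(2,3)] by (simp only: sum_single[symmetric] p(1) Ycoord_def fst_conv snd_conv)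
  qed
  finally show ?thesis .
qed

lemma Phi_gauss:
  "cmap (gauss n (\<lambda>_. 1)) ((\<Sum>p\<in>basis_idx n. Poly_Mapping.single {#basis_mat n p#} (Ycoord n p)) ^ m) = scal (fact m) (\<Phi> n m)"
  using mm_z_eq[of n "\<lambda>i j. so_to_sym n (Fmat n i j)" m]
  by (simp only: mm_z_def mm_E_def mm_form_so mm_mat_def \<Phi>_def)

subsection \<open>Symmetrisation of powers\<close>

lemma power_sum_single:
  fixes h :: "'s \<Rightarrow> 'm::monoid_add" and t :: "'s \<Rightarrow> 'p::comm_ring_1"
  assumes S: "finite S"
  shows "(\<Sum>s\<in>S. Poly_Mapping.single (h s) (t s)) ^ N
     = (\<Sum>l | set l \<subseteq> S \<and> length l = N. Poly_Mapping.single (sum_list (map h l)) (prod_list (map t l)))"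
proof (induction N)
  case 0
  have "{l. set l \<subseteq> S \<and> length l = 0} = {[]}" by auto
  then show ?case by simp
next
  case (Suc N)
  let ?L = "\<lambda>N. {l. set l \<subseteq> S \<and> length l = N}"
  let ?f = "\<lambda>l. Poly_Mapping.single (sum_list (map h l)) (prod_list (map t l))"
  have L: "?L (Suc N) = (\<lambda>(s, l). s # l) ` (S \<times> ?L N)"
    by (auto simp: length_Suc_conv image_iff)
  have "sum ?f (?L (Suc N)) = (\<Sum>(s, l)\<in>S \<times> ?L N. ?f (s # l))"
    unfolding L by (subst sum.reindex) (auto simp: inj_on_def case_prod_unfold)
  also have "\<dots> = (\<Sum>s\<in>S. \<Sum>l\<in>?L N. Poly_Mapping.single (h s) (t s) * ?f l)"
    unfolding sum.cartesian_product[symmetric] by (simp add: mult_single)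
  also have "\<dots> = (\<Sum>s\<in>S. Poly_Mapping.single (h s) (t s)) * sum ?f (?L N)"
    by (simp only: sum_product)
  finally show ?case by (simp only: power_Suc Suc.IH)
qed

text \<open>A permutation of the list only reindexes the sum over all orderings, so the enumeration
  chosen in \<open>symmetrise\<close> is immaterial.\<close>

lemma symm_list_cong:
  assumes "mset ys = mset zs"
  shows "symm_list ys = symm_list zs"
proof -
  let ?n = "length zs"
  have len: "length ys = ?n" using assms by (rule mset_eq_length)
  obtain \<pi> where pi: "\<pi> permutes {..<?n}" "permute_list \<pi> zs = ys"
    using mset_eq_permutation[OF assms] by blast
  let ?f = "\<lambda>\<sigma>. Poly_Mapping.single (Word (map (\<lambda>i. zs ! \<sigma> i) [0..<?n])) (1 :: complex)"
  have "(\<Sum>\<sigma> | \<sigma> permutes {..<?n}. Poly_Mapping.single (Word (map (\<lambda>i. ys ! \<sigma> i) [0..<?n])) (1 :: complex))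
     = (\<Sum>\<sigma> | \<sigma> permutes {..<?n}. ?f (\<pi> \<circ> \<sigma>))"
  proof (rule sum.cong[OF refl])
    fix \<sigma> assume "\<sigma> \<in> {\<sigma>. \<sigma> permutes {..<?n}}"
    then have "\<sigma> i < ?n" if "i < ?n" for i
      using that permutes_in_image[of \<sigma> "{..<?n}" i] by auto
    then have "ys ! \<sigma> i = zs ! \<pi> (\<sigma> i)" if "i < ?n" for i
      using that pi(2)[symmetric] by (simp add: permute_list_def)
    then have "map (\<lambda>i. ys ! \<sigma> i) [0..<?n] = map (\<lambda>i. zs ! (\<pi> \<circ> \<sigma>) i) [0..<?n]"
      by simp
    then show "Poly_Mapping.single (Word (map (\<lambda>i. ys ! \<sigma> i) [0..<?n])) (1 :: complex) = ?f (\<pi> \<circ> \<sigma>)"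
      by (simp only:)
  qed
  also have "\<dots> = (\<Sum>\<sigma> | \<sigma> permutes {..<?n}. ?f \<sigma>)"
  proof (rule sum.reindex_bij_witness[where i = "\<lambda>\<sigma>. inv_into UNIV \<pi> \<circ> \<sigma>" and j = "\<lambda>\<sigma>. \<pi> \<circ> \<sigma>"])
    fix \<sigma> assume "\<sigma> \<in> {\<sigma>. \<sigma> permutes {..<?n}}"
    then have s: "\<sigma> permutes {..<?n}" by simp
    show "inv_into UNIV \<pi> \<circ> (\<pi> \<circ> \<sigma>) = \<sigma>" "\<pi> \<circ> (inv_into UNIV \<pi> \<circ> \<sigma>) = \<sigma>"
      by (simp_all only: o_assoc permutes_inv_o[OF pi(1)] id_o)
    show "\<pi> \<circ> \<sigma> \<in> {\<sigma>. \<sigma> permutes {..<?n}}" "inv_into UNIV \<pi> \<circ> \<sigma> \<in> {\<sigma>. \<sigma> permutes {..<?n}}"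
      using permutes_compose[OF s pi(1)] permutes_compose[OF s permutes_inv[OF pi(1)]] by simp_all
  qed (rule refl)
  finally show ?thesis by (simp only: symm_list_def len)
qed

lemma clinear_symmetrise: "clinear_map symmetrise"
  unfolding symmetrise_def by (rule clinear_lin_ext)

lemma symmetrise_single: "symmetrise (Poly_Mapping.single (mset ys) c) = scal c (symm_list ys)"
proof -
  have "mset (SOME zs. mset zs = mset ys) = mset ys"
    by (rule someI) (rule refl)
  from symm_list_cong[OF this] show ?thesis
    unfolding symmetrise_def lin_ext_single by (simp only:)
qed

lemma sum_list_Word: "sum_list (map (\<lambda>s. Word [g s]) l) = Word (map g l)"
  by (induction l) (simp_all add: zero_fword_def plus_fword_def)

lemma sum_list_singletons: "sum_list (map (\<lambda>s. {#g s#}) l) = mset (map g l)"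
  by (induction l) simp_all

text \<open>In the noncommutative power the coefficient of a word is a product of commuting
  polynomials, hence invariant under reordering the letters. The power is therefore already
  symmetric.\<close>

lemma symmetrise_power:
  fixes t :: "'s \<Rightarrow> gpoly"
  assumes phi: "additive \<phi>" and S: "finite S"
  shows "symmetrise (cmap \<phi> ((\<Sum>s\<in>S. Poly_Mapping.single {#g s#} (t s)) ^ N))
     = cmap \<phi> ((\<Sum>s\<in>S. Poly_Mapping.single (Word [g s]) (t s)) ^ N)"
proof -
  let ?L = "{l. set l \<subseteq> S \<and> length l = N}"
  let ?X = "\<Sum>l\<in>?L. Poly_Mapping.single (Word (map g l)) (\<phi> (prod_list (map t l)))"
  let ?P = "{\<sigma>. \<sigma> permutes {..<N}}"
  have symm: "symm_list (map g l) = scal (1 / fact N) (\<Sum>\<sigma>\<in>?P. Poly_Mapping.single (Word (map g (permute_list \<sigma> l))) 1)"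
    if "l \<in> ?L" for l
  proof -
    have len: "length l = N" using that by simp
    have "map (\<lambda>i. map g l ! \<sigma> i) [0..<N] = map g (permute_list \<sigma> l)" if "\<sigma> \<in> ?P" for \<sigma>
      using permute_list_map[of \<sigma> l g] that len by (simp add: permute_list_def)
    then show ?thesis
      unfolding symm_list_def length_map len by (intro arg_cong[of _ _ "scal _"] sum.cong refl) (simp only:)
  qed
  have inner: "(\<Sum>l\<in>?L. Poly_Mapping.single (Word (map g (permute_list \<sigma> l))) (\<phi> (prod_list (map t l)))) = ?X"
    if s: "\<sigma> \<in> ?P" for \<sigma>
  proof (rule sum.reindex_bij_witness[where i = "permute_list (inv_into UNIV \<sigma>)" and j = "permute_list \<sigma>"])
    have s': "\<sigma> permutes {..<N}" using s by simp
    have i': "inv_into UNIV \<sigma> permutes {..<N}" by (rule permutes_inv[OF s'])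
    fix l assume l: "l \<in> ?L"
    then have len: "length l = N" and sub: "set l \<subseteq> S" by simp_all
    show "permute_list (inv_into UNIV \<sigma>) (permute_list \<sigma> l) = l"
      using permute_list_compose[of "inv_into UNIV \<sigma>" l \<sigma>] i' len permutes_inv_o(1)[OF s'] by simp
    show "permute_list \<sigma> l \<in> ?L" "permute_list (inv_into UNIV \<sigma>) l \<in> ?L"
      using s' i' len sub by simp_all
    show "permute_list \<sigma> (permute_list (inv_into UNIV \<sigma>) l) = l"
      using permute_list_compose[of \<sigma> l "inv_into UNIV \<sigma>"] s' len permutes_inv_o(2)[OF s'] by simp
    have "mset (map t (permute_list \<sigma> l)) = mset (map t l)"
      using s' len by simp
    then have "prod_list (map t (permute_list \<sigma> l)) = prod_list (map t l)"
      by (metis prod_mset_prod_list)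
    then show "Poly_Mapping.single (Word (map g (permute_list \<sigma> l))) (\<phi> (prod_list (map t (permute_list \<sigma> l))))
       = Poly_Mapping.single (Word (map g (permute_list \<sigma> l))) (\<phi> (prod_list (map t l)))"
      by simp
  qed
  have "symmetrise (cmap \<phi> ((\<Sum>s\<in>S. Poly_Mapping.single {#g s#} (t s)) ^ N))
      = (\<Sum>l\<in>?L. scal (\<phi> (prod_list (map t l))) (symm_list (map g l)))"
    unfolding power_sum_single[OF S] sum_list_singletons cmap_sum[OF phi] cmap_single[OF phi]
      clinear_map_sum[OF clinear_symmetrise] symmetrise_single ..
  also have "\<dots> = (\<Sum>l\<in>?L. \<Sum>\<sigma>\<in>?P. scal (1 / fact N) (Poly_Mapping.single (Word (map g (permute_list \<sigma> l))) (\<phi> (prod_list (map t l)))))"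
    by (rule sum.cong[OF refl]) (simp add: symm scal_sum_right mult.commute)
  also have "\<dots> = (\<Sum>\<sigma>\<in>?P. scal (1 / fact N) (\<Sum>l\<in>?L. Poly_Mapping.single (Word (map g (permute_list \<sigma> l))) (\<phi> (prod_list (map t l)))))"
    by (subst sum.swap) (simp only: scal_sum_right)
  also have "\<dots> = (\<Sum>\<sigma>\<in>?P. scal (1 / fact N) ?X)"
    by (rule sum.cong[OF refl]) (simp only: inner)
  also have "\<dots> = ?X"
  proof -
    have c: "card ?P = fact N" using card_permutations[of "{..<N}" N] by simp
    show ?thesis unfolding sum_constant c of_nat_mult_scal by simp
  qed
  also have "?X = cmap \<phi> ((\<Sum>s\<in>S. Poly_Mapping.single (Word [g s]) (t s)) ^ N)"
    unfolding power_sum_single[OF S] sum_list_Word cmap_sum[OF phi] cmap_single[OF phi] ..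
  finally show ?thesis .
qed

lemma clinear_rename: "clinear_map (rename f)"
  unfolding rename_def by (rule clinear_lin_ext)

lemma rename_single: "rename f (Poly_Mapping.single M c) = Poly_Mapping.single (image_mset f M) c"
  by (simp add: rename_def)

lemma rename_mult: "rename f (p * q) = rename f p * rename f q"
proof (induction p rule: poly_mapping_single_induct)
  case (single v c)
  show ?case
    by (induction q rule: poly_mapping_single_induct)
      (simp_all add: mult_single rename_single distrib_left clinear_map_add[OF clinear_rename])
qed (simp add: distrib_right clinear_map_add[OF clinear_rename])

lemma rename_one: "rename f 1 = 1"
  using rename_single[of f 0 1] by simp

lemma rename_power:
  fixes t :: "'s \<Rightarrow> gpoly"
  assumes phi: "additive \<phi>" and S: "finite S"
  shows "rename f (cmap \<phi> ((\<Sum>s\<in>S. Poly_Mapping.single {#g s#} (t s)) ^ N))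
     = cmap \<phi> ((\<Sum>s\<in>S. Poly_Mapping.single {#f (g s)#} (t s)) ^ N)"
  unfolding power_sum_single[OF S] sum_list_singletons cmap_sum[OF phi] cmap_single[OF phi]
      clinear_map_sum[OF clinear_rename] rename_single
  by (simp add: image_mset.compositionality comp_def)

section \<open>Homogeneity and the weight\<close>

definition vhom :: "nat \<Rightarrow> gpoly \<Rightarrow> bool" where
  "vhom m p \<longleftrightarrow> (\<forall>M\<in>Poly_Mapping.keys p. vdeg M = m)"

lemma vdeg_add: "vdeg (M + N) = vdeg M + vdeg N"
  by (simp add: vdeg_def)

lemma vhom_mult: "vhom a p \<Longrightarrow> vhom b q \<Longrightarrow> vhom (a + b) (p * q)"
  unfolding vhom_def using keys_mult[of p q] by (fastforce simp: vdeg_add)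

lemma vhom_diff: "vhom a p \<Longrightarrow> vhom a q \<Longrightarrow> vhom a (p - q)"
  unfolding vhom_def using Poly_Mapping.keys_add[of p "- q"] by (fastforce simp: in_keys_iff)

lemma vhom_Vec: "vhom 1 (gv i)" and vhom_Cov: "vhom 0 (var (Cov i))"
  by (simp_all add: vhom_def var_def vdeg_def)

lemma vhom_Ycoord: "vhom 1 (Ycoord n p)"
  unfolding Ycoord_def Ymat_def wedge_def gw_def
  using vhom_mult[OF vhom_Vec vhom_Cov] vhom_mult[OF vhom_Cov vhom_Vec] by (intro vhom_diff) simp_all

lemma vhom_prod: "vhom (length l) (prod_list (map (Ycoord n) l))"
proof (induction l)
  case Nil
  show ?case by (simp add: vhom_def vdeg_def)
next
  case (Cons p l)
  then show ?case using vhom_mult[OF vhom_Ycoord Cons, of n p] by simp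
qed

lemma gauss_vhom: "vhom m p \<Longrightarrow> gauss n w p = w m * gauss n (\<lambda>_. 1) p"
  unfolding gauss_def lfun_def vhom_def sum_distrib_left by (rule sum.cong) simp_all

text \<open>All coefficients of the power are homogeneous of degree \<open>m\<close>, so the weight
  acts on it as a scalar.\<close>

lemma gauss_Y_power:
  "cmap (gauss n w) ((\<Sum>p\<in>basis_idx n. Poly_Mapping.single {#h p#} (Ycoord n p)) ^ m)
     = scal (w m) (cmap (gauss n (\<lambda>_. 1)) ((\<Sum>p\<in>basis_idx n. Poly_Mapping.single {#h p#} (Ycoord n p)) ^ m))"
proof -
  have "gauss n w (prod_list (map (Ycoord n) l)) = w m * gauss n (\<lambda>_. 1) (prod_list (map (Ycoord n) l))" if "length l = m" for l
    using gauss_vhom[OF vhom_prod[of l n], of n w] that by simp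
  then show ?thesis
    unfolding power_sum_single[OF finite_basis_idx] cmap_sum[OF additive_gauss] cmap_single[OF additive_gauss]
    by (simp add: scal_sum_right)
qed

subsection \<open>Vanishing of the odd invariants\<close>

text \<open>The exchange of \<open>v\<close> with the reflected \<open>u\<close> preserves the Gaussian functional and changes the sign of \<open>Y\<close>.\<close>

definition gswap :: "nat \<Rightarrow> gvar \<Rightarrow> gvar" where
  "gswap n x = (case x of Vec i \<Rightarrow> Cov (if i < n then n - 1 - i else i)
     | Cov i \<Rightarrow> Vec (if i < n then n - 1 - i else i))"

lemma gswap_gswap: "gswap n (gswap n x) = x"
  by (cases x) (auto simp: gswap_def)

lemma count_gswap: "count (image_mset (gswap n) M) x = count M (gswap n x)"
proof (induction M)
  case (add y M)
  have "gswap n y = x \<longleftrightarrow> y = gswap n x" using gswap_gswap by metis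
  then show ?case using add by simp
qed simp

lemma gauss_moment_gswap: "gauss_moment n (image_mset (gswap n) M) = gauss_moment n M"
proof (cases "balanced n M")
  case True
  then have e: "count M (Vec i) = count M (Cov i)" and z: "n \<le> i \<Longrightarrow> count M (Vec i) = 0" for i
    unfolding balanced_def by blast+
  have "balanced n (image_mset (gswap n) M)"
    unfolding balanced_def count_gswap
  proof (intro allI conjI impI)
    fix i
    show "count M (gswap n (Vec i)) = count M (gswap n (Cov i))"
      by (simp add: gswap_def e)
    assume "n \<le> i"
    then show "count M (gswap n (Vec i)) = 0"
      using z[of i] e[of i] by (simp add: gswap_def)
  qed
  moreover have "(\<Prod>i<n. fact (count M (gswap n (Vec i))) :: complex) = (\<Prod>i<n. fact (count M (Vec i)))"
  proof -
    have "(\<Prod>i<n. fact (count M (gswap n (Vec i))) :: complex) = (\<Prod>i<n. fact (count M (Vec (n - Suc i))))"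
      by (rule prod.cong) (simp_all add: gswap_def e)
    also have "\<dots> = (\<Prod>i<n. fact (count M (Vec i)))"
      by (rule prod.nat_diff_reindex)
    finally show ?thesis .
  qed
  ultimately show ?thesis
    using True by (simp add: gauss_moment_def count_gswap)
next
  case False
  have "\<not> balanced n (image_mset (gswap n) M)"
  proof
    assume b: "balanced n (image_mset (gswap n) M)"
    have e: "count M (gswap n (Vec i)) = count M (gswap n (Cov i))" and z: "n \<le> i \<Longrightarrow> count M (gswap n (Vec i)) = 0" for i
      using b unfolding balanced_def count_gswap by blast+
    have "balanced n M"
      unfolding balanced_def
    proof (intro allI conjI impI)
      fix i
      show c: "count M (Vec i) = count M (Cov i)"
      proof (cases "i < n")
        case True
        then have "n - 1 - i < n" "n - 1 - (n - 1 - i) = i" by linarith+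
        then have "gswap n (Vec (n - 1 - i)) = Cov i" "gswap n (Cov (n - 1 - i)) = Vec i"
          by (simp_all only: gswap_def gvar.case if_True)
        then show ?thesis using e[of "n - 1 - i"] by simp
      next
        case False
        then show ?thesis using e[of i] by (simp add: gswap_def)
      qed
      assume "n \<le> i"
      then show "count M (Vec i) = 0"
        using z[of i] c by (simp add: gswap_def)
    qed
    with False show False by simp
  qed
  then show ?thesis using False by (simp add: gauss_moment_def)
qed

lemma gauss_gswap: "gauss n (\<lambda>_. 1) (rename (gswap n) p) = gauss n (\<lambda>_. 1) p"
proof (induction p rule: poly_mapping_single_induct)
  case (single M c)
  show ?case by (simp add: rename_single gauss_single gauss_moment_gswap)
qed (simp add: clinear_map_add[OF clinear_rename] gauss_add)

text \<open>The exchange interchanges \<open>gv i\<close> with \<open>gw n i\<close>, and the wedge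
  is alternating.\<close>

lemma gswap_Ycoord:
  assumes "p \<in> basis_idx n"
  shows "rename (gswap n) (Ycoord n p) = - Ycoord n p"
proof -
  have p: "fst p < n" "snd p < n" using assms by (auto simp: basis_idx_def)
  have v: "rename (gswap n) (gv i) = gw n i" if "i < n" for i
    using that by (simp add: var_def rename_single gswap_def gw_def)
  have w: "rename (gswap n) (gw n i) = gv i" if "i < n" for i
  proof -
    have "n - 1 - i < n" "n - 1 - (n - 1 - i) = i" using that by linarith+
    then show ?thesis
      unfolding gw_def var_def rename_single gswap_def image_mset_single by (simp only: gvar.case if_True)
  qed
  have "n - 1 - snd p < n" using p by linarith
  then show ?thesis
    unfolding Ycoord_def Ymat_def wedge_def clinear_map_diff[OF clinear_rename] rename_mult
    using p by (simp add: v w del: One_nat_def)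
qed

lemma Phi_odd:
  assumes "odd m"
  shows "\<Phi> n m = 0"
proof -
  have "gauss n (\<lambda>_. 1) (prod_list (map (Ycoord n) l)) = 0" if l: "set l \<subseteq> basis_idx n" "length l = m" for l
  proof -
    have "rename (gswap n) (prod_list (map (Ycoord n) l)) = (- 1) ^ length l * prod_list (map (Ycoord n) l)"
      using l(1) by (induction l) (simp_all add: rename_one rename_mult gswap_Ycoord)
    then have "gauss n (\<lambda>_. 1) (prod_list (map (Ycoord n) l)) = - gauss n (\<lambda>_. 1) (prod_list (map (Ycoord n) l))"
      using gauss_gswap[of n "prod_list (map (Ycoord n) l)"] assms l(2) by (simp add: gauss_uminus)
    then show ?thesis by simp
  qed
  then have "scal (fact m) (\<Phi> n m) = 0"
    unfolding Phi_gauss[symmetric] power_sum_single[OF finite_basis_idx] cmap_sum[OF additive_gauss] cmap_single[OF additive_gauss]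
    by (intro sum.neutral) auto
  then have "scal (1 / fact m) (scal (fact m) (\<Phi> n m)) = 0" by simp
  then show ?thesis by simp
qed

subsection \<open>The Segal--Sugawara vector as a Gaussian average\<close>

lemma tauY_sum:
  "tauY n = (\<Sum>s\<in>insert None (Some ` basis_idx n).
     Poly_Mapping.single (Word [map_option (\<lambda>p. Cur (basis_mat n p) (- 1)) s]) (case s of None \<Rightarrow> 1 | Some p \<Rightarrow> Ycoord n p))"
proof -
  have "None \<notin> Some ` basis_idx n" by auto
  then show ?thesis
    unfolding tauY_def gtau_def current_def gletter_def basis_letter_def
    by (simp add: sum.reindex basis_mat_def Ycoord_def gscal_def gletter_def mult_single)
qed

text \<open>In the symmetric algebra the translation symbol commutes with the other letters, so the
  binomial theorem applies there; symmetrising afterwards gives back the power of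
  \<open>tauY n\<close>.\<close>

lemma gauss_tauY_power:
  "on_one (cmap (gauss n w) (tauY n ^ N))
     = (\<Sum>m\<le>N. scal (of_nat (N choose m) * (w m * fact m)) (symm_tau (N - m) (\<Phi> n m)))"
proof -
  let ?S = "insert None (Some ` basis_idx n)"
  let ?g = "map_option (\<lambda>p. Cur (basis_mat n p) (- 1))" and ?t = "\<lambda>s. case s of None \<Rightarrow> 1 | Some p \<Rightarrow> Ycoord n p"
  define a where "a = (\<Sum>p\<in>basis_idx n. Poly_Mapping.single {#Some (Cur (basis_mat n p) (- 1))#} (Ycoord n p))"
  define b where "b = Poly_Mapping.single {#None :: aff option#} (1 :: gpoly)"
  have fin: "finite ?S" by simp
  have E: "additive (gauss n w)" by (rule additive_gauss)
  have sum: "(\<Sum>s\<in>?S. Poly_Mapping.single {#?g s#} (?t s)) = a + b"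
  proof -
    have "None \<notin> Some ` basis_idx n" by auto
    then show ?thesis by (simp add: a_def b_def sum.reindex add.commute)
  qed
  have a: "cmap (gauss n w) (a ^ m) = scal (w m * fact m) (rename Some (at_minus_one (\<Phi> n m)))" for m
  proof -
    have "cmap (gauss n (\<lambda>_. 1)) (a ^ m)
       = rename Some (rename (\<lambda>x. Cur x (- 1)) (cmap (gauss n (\<lambda>_. 1)) ((\<Sum>p\<in>basis_idx n. Poly_Mapping.single {#basis_mat n p#} (Ycoord n p)) ^ m)))"
      unfolding a_def rename_power[OF additive_gauss finite_basis_idx] ..
    also have "\<dots> = scal (fact m) (rename Some (at_minus_one (\<Phi> n m)))"
      unfolding Phi_gauss at_minus_one_def clinear_map_scal[OF clinear_rename] ..
    finally have "cmap (gauss n (\<lambda>_. 1)) (a ^ m) = scal (fact m) (rename Some (at_minus_one (\<Phi> n m)))" .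
    then show ?thesis
      using gauss_Y_power[of n w "\<lambda>p. Some (Cur (basis_mat n p) (- 1))" m] by (simp add: a_def)
  qed
  have b: "cmap (gauss n w) (b ^ r * f) = var None ^ r * cmap (gauss n w) f" for r f
  proof (induction r)
    case (Suc r)
    have "cmap (gauss n w) (b * (b ^ r * f)) = var None * cmap (gauss n w) (b ^ r * f)"
      unfolding b_def by (subst cmap_single_mult[OF E]) (simp add: var_def)
    then show ?case by (simp add: Suc mult.assoc)
  qed simp
  have nat: "cmap (gauss n w) (of_nat k * f) = scal (of_nat k) (cmap (gauss n w) f)" for k and f :: "aff option gsym"
    by (induction k) (simp_all add: cmap_add[OF E] cmap_zero[OF E] distrib_right scal_add_left)
  have "cmap (gauss n w) (tauY n ^ N) = symmetrise (cmap (gauss n w) ((a + b) ^ N))"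
    unfolding tauY_sum symmetrise_power[OF E fin, symmetric] sum ..
  also have "cmap (gauss n w) ((a + b) ^ N)
     = (\<Sum>m\<le>N. scal (of_nat (N choose m) * (w m * fact m)) (var None ^ (N - m) * rename Some (at_minus_one (\<Phi> n m))))"
    unfolding binomial_ring cmap_sum[OF E]
  proof (rule sum.cong[OF refl])
    fix m
    have "of_nat (N choose m) * a ^ m * b ^ (N - m) = of_nat (N choose m) * (b ^ (N - m) * a ^ m)"
      by (simp only: mult_ac)
    then show "cmap (gauss n w) (of_nat (N choose m) * a ^ m * b ^ (N - m))
      = scal (of_nat (N choose m) * (w m * fact m)) (var None ^ (N - m) * rename Some (at_minus_one (\<Phi> n m)))"
      by (simp only: nat b a scal_scal mult_scal_right)
  qed
  finally show ?thesis
    by (simp add: clinear_map_sum[OF clinear_symmetrise] clinear_map_scal[OF clinear_symmetrise] on_one_simps symm_tau_def)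
qed

lemma on_one_symm_list_Some: "on_one (symm_list (map Some ys)) = symm_list ys"
proof -
  have w: "word_on_one (map Some zs) = Poly_Mapping.single (Word zs) 1" for zs
    by (induction zs) (simp_all add: Word_Nil Word_Cons)
  have "on_one (Poly_Mapping.single (Word (map (\<lambda>i. map Some ys ! \<sigma> i) [0..<length ys])) 1)
      = Poly_Mapping.single (Word (map (\<lambda>i. ys ! \<sigma> i) [0..<length ys])) 1"
    if "\<sigma> permutes {..<length ys}" for \<sigma>
  proof -
    have "\<sigma> i < length ys" if "i < length ys" for i
      using \<open>\<sigma> permutes _\<close> that permutes_in_image[of \<sigma> "{..<length ys}" i] by auto
    then have "map (\<lambda>i. map Some ys ! \<sigma> i) [0..<length ys] = map Some (map (\<lambda>i. ys ! \<sigma> i) [0..<length ys])"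
      by simp
    then show ?thesis by (simp only: on_one_Word w scal_one)
  qed
  then show ?thesis
    unfolding symm_list_def length_map on_one_simps by (intro arg_cong[of _ _ "scal _"] sum.cong refl) simp
qed

lemma symm_tau_0: "symm_tau 0 F = symmetrise (at_minus_one F)"
proof -
  have "on_one (symmetrise (rename Some p)) = symmetrise p" for p :: "aff symalg"
  proof (induction p rule: poly_mapping_single_induct)
    case (single M c)
    obtain ys where M: "M = mset ys" by (metis ex_mset)
    have "rename Some (Poly_Mapping.single M c) = Poly_Mapping.single (mset (map Some ys)) c"
      by (simp add: rename_single M)
    then show ?case
      by (simp only: M symmetrise_single on_one_simps on_one_symm_list_Some)
  next
    case (add f g)
    then show ?case
      by (simp add: clinear_map_add[OF clinear_rename] clinear_map_add[OF clinear_symmetrise] on_one_simps)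
  qed
  then show ?thesis by (simp add: symm_tau_def)
qed

subsection \<open>Perfectness of the orthogonal Lie algebra\<close>

definition umat :: "nat \<Rightarrow> nat \<Rightarrow> nat \<Rightarrow> nat \<Rightarrow> complex" where
  "umat i j a b = (if a = i \<and> b = j then 1 else 0)"

lemma umat_mult:
  assumes "j < n"
  shows "(\<Sum>m<n. umat i j a m * umat k l m b) = (if j = k then umat i l a b else 0)"
proof -
  have "(\<Sum>m<n. umat i j a m * umat k l m b) = (\<Sum>m<n. if m = j then (if j = k then umat i l a b else 0) else 0)"
    by (rule sum.cong) (auto simp: umat_def)
  then show ?thesis using assms by simp
qed

text \<open>The conditions on \<open>k\<close> remove the products of a matrix unit with a reflected
  one. There remain the product through \<open>k\<close>, its reflection, and for
  \<open>i = j\<close> the two products in the opposite order.\<close>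

lemma lie_Fmat:
  assumes ijk: "i < n" "j < n" "k < n" and k: "k \<noteq> n - 1 - i" "k \<noteq> n - 1 - j"
  shows "lie (Fmat n i k) (Fmat n k j) = Fmat n i j - (if i = j then Fmat n k k else 0\<^sub>m n n)"
proof (rule eq_matI)
  let ?i = "n - 1 - i" and ?j = "n - 1 - j" and ?k = "n - 1 - k"
  have F: "Fmat n p q $$ (a, b) = umat p q a b - umat (n - 1 - q) (n - 1 - p) a b" if "a < n" "b < n" for p q a b
    unfolding Fmat_index[OF that] umat_def ..
  have gletter: "?i < n" "?j < n" "?k < n" using ijk by linarith+
  have d: "k \<noteq> ?i" "k \<noteq> ?j" "?k \<noteq> i" "?k \<noteq> j" "?i \<noteq> k" "?j \<noteq> k" "i \<noteq> ?k" "j \<noteq> ?k"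
    using ijk k by linarith+
  have e: "?i = ?j \<longleftrightarrow> i = j" "j = i \<longleftrightarrow> i = j" "?j = ?i \<longleftrightarrow> i = j"
    using ijk by linarith+
  fix a b
  assume "a < dim_row (Fmat n i j - (if i = j then Fmat n k k else 0\<^sub>m n n))"
    "b < dim_col (Fmat n i j - (if i = j then Fmat n k k else 0\<^sub>m n n))"
  then have ab: "a < n" "b < n"
    using carrier_matD[OF Fmat_carrier[of n k k]] by (simp_all split: if_splits)
  have "lie (Fmat n i k) (Fmat n k j) $$ (a, b)
     = (\<Sum>m<n. (umat i k a m - umat ?k ?i a m) * (umat k j m b - umat ?j ?k m b)
         - (umat k j a m - umat ?j ?k a m) * (umat i k m b - umat ?k ?i m b))"
    unfolding lie_index[OF Fmat_carrier Fmat_carrier ab] bracket_def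
    by (rule sum.cong) (simp_all only: F ab lessThan_iff)
  also have "\<dots> = (\<Sum>m<n. umat i k a m * umat k j m b) - (\<Sum>m<n. umat i k a m * umat ?j ?k m b)
       - (\<Sum>m<n. umat ?k ?i a m * umat k j m b) + (\<Sum>m<n. umat ?k ?i a m * umat ?j ?k m b)
       - ((\<Sum>m<n. umat k j a m * umat i k m b) - (\<Sum>m<n. umat k j a m * umat ?k ?i m b)
       - (\<Sum>m<n. umat ?j ?k a m * umat i k m b) + (\<Sum>m<n. umat ?j ?k a m * umat ?k ?i m b))"
    by (simp only: sum.distrib[symmetric] sum_subtractf[symmetric]) (rule sum.cong, simp_all add: algebra_simps)
  also have "\<dots> = (umat i j a b - umat ?j ?i a b) - (if i = j then umat k k a b - umat ?k ?k a b else 0)"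
    by (simp only: umat_mult ijk gletter d e if_False if_True refl split: if_split) simp
  also have "\<dots> = (Fmat n i j - (if i = j then Fmat n k k else 0\<^sub>m n n)) $$ (a, b)"
    using ab carrier_matD[OF Fmat_carrier[of n k k]] by (simp add: F[OF ab])
  finally show "lie (Fmat n i k) (Fmat n k j) $$ (a, b) = (Fmat n i j - (if i = j then Fmat n k k else 0\<^sub>m n n)) $$ (a, b)" .
qed (use carrier_matD[OF Fmat_carrier] carrier_matD[OF lie_carrier[OF Fmat_carrier Fmat_carrier]] in \<open>simp_all\<close>)

lemma vac_lie:
  assumes x: "x \<in> so n" and y: "y \<in> so n" and u: "u \<in> word_span (aff_letters n)" and a: "a + b \<noteq> 0"
    and xu: "letter (Cur x a) * u \<in> vac_ideal n" and yu: "letter (Cur y b) * u \<in> vac_ideal n"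
  shows "letter (Cur (lie x y) (a + b)) * u \<in> vac_ideal n"
proof -
  have "(letter (Cur x a) * letter (Cur y b) - letter (Cur y b) * letter (Cur x a) - letter (Cur (lie x y) (a + b))) * u \<in> vac_ideal n"
    using vac_rel[OF aff_ideal_Cur_lie[OF x y, of a b] u] a by simp
  moreover have "letter (Cur x a) * (letter (Cur y b) * u) - letter (Cur y b) * (letter (Cur x a) * u) \<in> vac_ideal n"
    by (intro vac_diff vac_lmult word_span_letter Cur_aff_letters x y xu yu)
  ultimately have "(letter (Cur x a) * (letter (Cur y b) * u) - letter (Cur y b) * (letter (Cur x a) * u))
      - (letter (Cur x a) * letter (Cur y b) - letter (Cur y b) * letter (Cur x a) - letter (Cur (lie x y) (a + b))) * u \<in> vac_ideal n"
    by (rule vac_diff[rotated])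
  then show ?thesis by (simp add: algebra_simps)
qed

lemma vac_Cur_add:
  assumes "x \<in> so n" "y \<in> so n" "u \<in> word_span (aff_letters n)"
    and "letter (Cur x a) * u \<in> vac_ideal n" "letter (Cur y a) * u \<in> vac_ideal n"
  shows "letter (Cur (x + y) a) * u \<in> vac_ideal n"
proof -
  have "(letter (Cur (x + y) a) - letter (Cur x a) - letter (Cur y a)) * u + letter (Cur x a) * u + letter (Cur y a) * u \<in> vac_ideal n"
    by (intro vac_add vac_rel aff_ideal_Cur_add assms)
  then show ?thesis by (simp add: algebra_simps)
qed

lemma vac_Cur_smult:
  assumes "x \<in> so n" "u \<in> word_span (aff_letters n)" "letter (Cur x a) * u \<in> vac_ideal n"
  shows "letter (Cur (c \<cdot>\<^sub>m x) a) * u \<in> vac_ideal n"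
proof -
  have "(letter (Cur (c \<cdot>\<^sub>m x) a) - scal c (letter (Cur x a))) * u + scal c (letter (Cur x a) * u) \<in> vac_ideal n"
    by (intro vac_add vac_rel aff_ideal_Cur_smult vac_scal assms)
  then show ?thesis by (simp add: algebra_simps)
qed

lemma vac_Cur_basis:
  assumes u: "u \<in> word_span (aff_letters n)" and x: "x \<in> so n"
    and F: "\<And>i j. (i, j) \<in> basis_idx n \<Longrightarrow> letter (Cur (Fmat n i j) a) * u \<in> vac_ideal n"
  shows "letter (Cur x a) * u \<in> vac_ideal n"
proof -
  have 1: "(letter (Cur x a) - (\<Sum>p\<in>basis_idx n. scal (x $$ p) (letter (Cur (Fmat n (fst p) (snd p)) a)))) * u \<in> vac_ideal n"
    by (rule vac_rel[OF Cur_expansion[OF x] u])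
  have 2: "(\<Sum>p\<in>basis_idx n. scal (x $$ p) (letter (Cur (Fmat n (fst p) (snd p)) a) * u)) \<in> vac_ideal n"
  proof (intro vac_sum vac_scal)
    fix p assume "p \<in> basis_idx n"
    then show "letter (Cur (Fmat n (fst p) (snd p)) a) * u \<in> vac_ideal n"
      using F[of "fst p" "snd p"] by simp
  qed
  show ?thesis
    using vac_add[OF 1 2] by (simp add: left_diff_distrib sum_distrib_right)
qed

text \<open>In degree \<open>a \<ge> 2\<close> the current of \<open>[y, z]\<close> is the
  commutator of \<open>y[1]\<close> and \<open>z[a - 1]\<close>, without central term. It therefore
  suffices to obtain the basis matrices from brackets.\<close>

lemma vac_Cur_all:
  assumes n: "n \<ge> 7" and u: "u \<in> word_span (aff_letters n)"
    and u0: "\<And>x. x \<in> so n \<Longrightarrow> letter (Cur x 0) * u \<in> vac_ideal n"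
    and u1: "\<And>x. x \<in> so n \<Longrightarrow> letter (Cur x 1) * u \<in> vac_ideal n"
  shows "x \<in> so n \<Longrightarrow> letter (Cur x (int a)) * u \<in> vac_ideal n"
proof (induction a arbitrary: x rule: less_induct)
  case (less a)
  consider "a = 0" | "a = 1" | b where "a = Suc b" "0 < b" by (metis One_nat_def not0_implies_Suc neq0_conv)
  then show ?case
  proof cases
    case (3 b)
    have lie: "letter (Cur (lie y z) (int a)) * u \<in> vac_ideal n" if "y \<in> so n" "z \<in> so n" for y z
      using vac_lie[OF that u, of 1 "int b"] u1[OF that(1)] less.IH[of b z] that(2) 3 by simp
    show ?thesis
    proof (rule vac_Cur_basis[OF u less.prems])
      fix i j assume "(i, j) \<in> basis_idx n"
      then have ij: "i < n" "j < n" "i < n - 1 - j" by (simp_all add: basis_idx_def)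
      \<comment> \<open>Four values cannot exhaust the \<open>n\<close> indices, which provides an
        auxiliary index away from \<open>i\<close>, \<open>j\<close> and their reflections.\<close>
      have "card {i, j, n - 1 - i, n - 1 - j} \<le> 4"
        using card_length[of "[i, j, n - 1 - i, n - 1 - j]"] by simp
      then have "card {i, j, n - 1 - i, n - 1 - j} < card {..<n}" using n by simp
      then have "\<not> {..<n} \<subseteq> {i, j, n - 1 - i, n - 1 - j}"
        by (metis card_mono finite.emptyI finite.insertI not_le)
      then obtain k where "k \<in> {..<n}" "k \<notin> {i, j, n - 1 - i, n - 1 - j}" by blast
      then have k: "k < n" "k \<noteq> i" "k \<noteq> j" "k \<noteq> n - 1 - i" "k \<noteq> n - 1 - j"
        unfolding insert_iff lessThan_iff by blast+
      define l where "l = n - 1 - k"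
      have k': "l < n" unfolding l_def using k(1) by linarith
      have l: "l \<noteq> n - 1 - i" unfolding l_def using k(1,2) ij(1) by linarith
      have so: "Fmat n p q \<in> so n" if "p < n" "q < n" for p q using that by (rule so_Fmat)
      show "letter (Cur (Fmat n i j) (int a)) * u \<in> vac_ideal n"
      proof (cases "i = j")
        case False
        have "lie (Fmat n i k) (Fmat n k j) = Fmat n i j"
          unfolding lie_Fmat[OF ij(1,2) k(1,4,5)] using False
          by (intro eq_matI) (use carrier_matD[OF Fmat_carrier[of n i j]] in auto)
        then show ?thesis using lie[OF so so, of i k k j] ij k by simp
      next
        case True
        \<comment> \<open>For \<open>i = j\<close> the bracket leaves an unwanted
          \<open>- Fmat n k k\<close>. The reflected index \<open>l\<close> gives the opposite
          diagonal element, so the sum of the brackets through \<open>k\<close> and \<open>l\<close>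
          is free of it.\<close>
        have 1: "lie (Fmat n i k) (Fmat n k i) = Fmat n i i - Fmat n k k"
          using lie_Fmat[OF ij(1) ij(1) k(1,4) k(4)] by simp
        have 2: "lie (Fmat n i l) (Fmat n l i) = Fmat n i i - Fmat n l l"
          using lie_Fmat[OF ij(1) ij(1) k' l l] by simp
        have kk: "Fmat n l l $$ (c, d) = - Fmat n k k $$ (c, d)" if "c < n" "d < n" for c d
        proof -
          have "n - 1 - l = k" unfolding l_def using k(1) by linarith
          then show ?thesis
            unfolding Fmat_index[OF that] by (simp only: minus_diff_eq l_def[symmetric])
        qed
        have "Fmat n i i = (1 / 2) \<cdot>\<^sub>m (lie (Fmat n i k) (Fmat n k i) + lie (Fmat n i l) (Fmat n l i))"
          unfolding 1 2
        proof (rule eq_matI)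
          fix c d
          assume "c < dim_row ((1 / 2) \<cdot>\<^sub>m (Fmat n i i - Fmat n k k + (Fmat n i i - Fmat n l l)))"
            "d < dim_col ((1 / 2) \<cdot>\<^sub>m (Fmat n i i - Fmat n k k + (Fmat n i i - Fmat n l l)))"
          then have cd: "c < n" "d < n"
            using carrier_matD[OF Fmat_carrier[of n l l]] by simp_all
          show "Fmat n i i $$ (c, d) = ((1 / 2) \<cdot>\<^sub>m (Fmat n i i - Fmat n k k + (Fmat n i i - Fmat n l l))) $$ (c, d)"
            using cd carrier_matD[OF Fmat_carrier[of n l l]] carrier_matD[OF Fmat_carrier[of n k k]]
              carrier_matD[OF Fmat_carrier[of n i i]]
            by (simp add: kk[OF cd] del: One_nat_def)
        qed (use carrier_matD[OF Fmat_carrier[of n l l]] carrier_matD[OF Fmat_carrier[of n i i]] in simp_all)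
        moreover have "letter (Cur ((1 / 2) \<cdot>\<^sub>m (lie (Fmat n i k) (Fmat n k i) + lie (Fmat n i l) (Fmat n l i))) (int a)) * u \<in> vac_ideal n"
          by (intro vac_Cur_smult vac_Cur_add lie so_add so_lie so u ij(1) k(1) k')
        ultimately show ?thesis using True by metis
      qed
    qed
  qed (use u0 u1 less.prems in simp_all)
qed

subsection \<open>The negative part\<close>

text \<open>Translation lowers degrees, so evaluating words never leaves the negative part; this
  makes the vector an element of \<open>U_neg\<close>.\<close>

lemma on_one_neg_word_span:
  assumes "f \<in> word_span (insert None (Some ` cur_letters n {..<0}))"
  shows "on_one f \<in> word_span (cur_letters n {..<0})"
proof -
  let ?X = "cur_letters n {..<0}"
  have l: "tau_letter g \<in> word_span ?X" if "g \<in> ?X" for g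
    using that by (auto simp: cur_letters_def intro!: word_span_scal word_span_letter)
  have w: "tau_word ws \<in> word_span ?X" if "set ws \<subseteq> ?X" for ws
    using that by (induction ws) (auto intro!: word_span_add word_span_mult word_span_letter word_span_single l)
  have t: "tau_der p \<in> word_span ?X" if "p \<in> word_span ?X" for p
    using that by (induction p rule: word_span_induct) (auto simp: tau_der_simps tau_der_single intro!: word_span_add word_span_scal w)
  have o: "word_on_one gs \<in> word_span ?X" if "set gs \<subseteq> insert None (Some ` ?X)" for gs
    using that by (induction gs) (auto intro!: word_span_mult word_span_letter t split: option.splits)
  show ?thesis
    using assms by (induction f rule: word_span_induct)
      (auto simp: on_one_simps on_one_Word intro!: word_span_add word_span_scal o)
qed

lemma tauY_neg_word_span: "tauY n ^ N \<in> word_span (insert None (Some ` cur_letters n {..<0}))"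
proof -
  have "SC (Fmat n (fst p) (snd p)) (- 1) \<in> insert None (Some ` cur_letters n {..<0})" if "p \<in> basis_idx n" for p
    using basis_idx_so[OF that] by (auto simp: cur_letters_def)
  then show ?thesis
    unfolding tauY_def gtau_def current_def basis_letter_def
    by (intro word_span_power word_span_add word_span_sum word_span_mult gscal_word_span gletter_word_span) auto
qed

lemma current_rels_neg_word_span: "cur_rels n {..<0} \<subseteq> word_span (cur_letters n {..<0})"
proof -
  let ?X = "cur_letters n {..<0}"
  have l: "letter (Cur x a) \<in> word_span ?X" if "x \<in> so n" "a < 0" for x a
    using that by (auto intro!: word_span_letter simp: cur_letters_def)
  show ?thesis
  proof
    fix r assume "r \<in> cur_rels n {..<0}"
    then consider
      (sum) x y a where "r = letter (Cur (x + y) a) - letter (Cur x a) - letter (Cur y a)" "x \<in> so n" "y \<in> so n" "a < 0"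
    | (smult) c x a where "r = letter (Cur (c \<cdot>\<^sub>m x) a) - scal c (letter (Cur x a))" "x \<in> so n" "a < 0"
    | (lie) x y a b where "r = letter (Cur x a) * letter (Cur y b) - letter (Cur y b) * letter (Cur x a)
          - letter (Cur (lie x y) (a + b))
          - (if a + b = 0 then scal (of_int a * form x y) (letter Cent) else 0)" "x \<in> so n" "y \<in> so n" "a < 0" "b < 0"
      unfolding cur_rels_def lessThan_iff by blast
    then show "r \<in> word_span ?X"
    proof cases
      case lie
      then have "a + b < 0" by simp
      then show ?thesis
        using lie by (auto intro!: word_span_diff word_span_mult l so_lie)
    qed (auto intro!: word_span_diff word_span_scal l so_add so_smult)
  qed
qed

lemma U_class_FF:
  assumes u: "u \<in> word_span (cur_letters n {..<0})"
    and vac: "\<And>x a. x \<in> so n \<Longrightarrow> 0 \<le> a \<Longrightarrow> letter (Cur x a) * u \<in> vac_ideal n"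
  shows "U_class n u \<in> FF_centre n"
proof -
  have "0 \<in> neg_ideal n"
    using genideal_tensor(3)[OF current_rels_neg_word_span[of n]] by (simp add: neg_ideal_def neg_ring_def)
  then have "u \<in> U_class n u"
    unfolding U_class_def a_r_coset_def' neg_ring_def tensor_ring_simps by force
  moreover have "U_class n u \<in> carrier (U_neg n)"
    using u by (auto simp: U_neg_def FactRing_def A_RCOSETS_def' U_class_def neg_ring_def tensor_ring_simps)
  ultimately show ?thesis
    unfolding FF_centre_def using vac by blast
qed

subsection \<open>The coefficients\<close>

text \<open>With \<open>m = n + 2 (k - u) - 2\<close>, twice the factor at \<open>u\<close> is
  \<open>(m + 2) (m + 1)\<close>, so the product telescopes to a quotient of factorials.\<close>

lemma coefficient_eq:
  fixes n k r :: nat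
  assumes "n \<ge> 2" "r \<le> k"
  shows "2 ^ r / fact (2 * r) *
        (\<Prod>u = 1..r. of_nat (n choose 2) + 2 * of_nat n * (of_nat k - of_nat u)
            + (of_nat k - of_nat u) * (2 * of_nat k - 2 * of_nat u - 1))
     = (fact (n + 2 * k - 2) / (fact (2 * r) * fact (n + (2 * k - 2 * r) - 2)) :: complex)"
proof -
  define f :: "nat \<Rightarrow> complex" where "f = (\<lambda>u. of_nat (n choose 2) + 2 * of_nat n * (of_nat k - of_nat u)
            + (of_nat k - of_nat u) * (2 * of_nat k - 2 * of_nat u - 1))"
  have "2 ^ r * (\<Prod>u = 1..r. f u) * fact (n + (2 * k - 2 * r) - 2) = fact (n + 2 * k - 2)"
    using assms(2)
  proof (induction r)
    case (Suc r)
    define m where "m = n + (2 * k - 2 * Suc r) - 2"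
    have m: "n + (2 * k - 2 * r) - 2 = Suc (Suc m)"
      using Suc.prems assms(1) by (simp add: m_def)
    have mm: "of_nat m = (of_nat n + 2 * of_nat k - 2 * of_nat (Suc r) - 2 :: complex)"
      using Suc.prems assms(1) by (simp add: m_def of_nat_diff)
    have "2 * (n choose 2) = n * (n - 1)"
    proof -
      have "2 dvd n * (n - 1)" by (cases n) simp_all
      then show ?thesis by (simp add: choose_two)
    qed
    then have "of_nat (2 * (n choose 2)) = (of_nat (n * (n - 1)) :: complex)"
      by (simp only:)
    moreover have "of_nat (n - 1) = (of_nat n - 1 :: complex)"
      using assms(1) by (simp add: of_nat_diff)
    ultimately have ch: "2 * of_nat (n choose 2) = (of_nat n * (of_nat n - 1) :: complex)"
      by (simp only: of_nat_mult of_nat_numeral)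
    have "2 * f (Suc r) = (of_nat m + 2) * (of_nat m + 1)"
    proof -
      have "2 * f (Suc r) = 2 * of_nat (n choose 2) + 2 * (2 * of_nat n * (of_nat k - of_nat (Suc r))
            + (of_nat k - of_nat (Suc r)) * (2 * of_nat k - 2 * of_nat (Suc r) - 1))"
        by (simp only: f_def distrib_left add.assoc)
      also have "\<dots> = (of_nat m + 2) * (of_nat m + 1)"
        unfolding mm ch by (simp add: algebra_simps)
      finally show ?thesis .
    qed
    moreover have "2 ^ Suc r * (\<Prod>u = 1..Suc r. f u) * fact m = 2 ^ r * (\<Prod>u = 1..r. f u) * ((2 * f (Suc r)) * fact m)"
      by (simp add: mult_ac)
    moreover have "fact (Suc (Suc m)) = (of_nat m + 2) * (of_nat m + 1) * (fact m :: complex)"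
      by (simp add: algebra_simps)
    ultimately have "2 ^ Suc r * (\<Prod>u = 1..Suc r. f u) * fact m = 2 ^ r * (\<Prod>u = 1..r. f u) * fact (Suc (Suc m))"
      by (simp only:)
    moreover have "2 ^ r * (\<Prod>u = 1..r. f u) * fact (Suc (Suc m)) = fact (n + 2 * k - 2)"
      using Suc.IH[unfolded m] Suc.prems by simp
    ultimately show ?case
      unfolding m_def[symmetric] by (simp only:)
  qed simp
  then have main: "2 ^ r * prod f {1..r} * fact (n + (2 * k - 2 * r) - 2) = fact (n + 2 * k - 2)" .
  have "a / b * p = c / (b * g)" if "a * p * g = c" "g \<noteq> 0" for a b c g p :: complex
    using that by (auto simp: divide_simps)
  from this[OF main] show ?thesis unfolding f_def by simp
qed

theorem theorem7p6:
  fixes n k :: nat and R :: "nat \<Rightarrow> nat \<Rightarrow> complex"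
  assumes "n \<ge> 7" and "k \<ge> 2"
    and R: "\<And>r. 1 \<le> r \<Longrightarrow> r < k \<Longrightarrow>
      R k r = 2 ^ r / fact (2 * r) *
        (\<Prod>u = 1..r. of_nat (n choose 2) + 2 * of_nat n * (of_nat k - of_nat u)
            + (of_nat k - of_nat u) * (2 * of_nat k - 2 * of_nat u - 1))"
  shows "U_class n (symmetrise (at_minus_one (\<Phi> n (2 * k)))
           + (\<Sum>r | 1 \<le> r \<and> r < k. scal (R k r) (symm_tau (2 * r) (\<Phi> n (2 * k - 2 * r)))))
         \<in> FF_centre n"
proof -
  \<comment> \<open>This normalisation makes the coefficient of the invariant of degree
    \<open>2 * k\<close> equal to 1.\<close>
  define C :: complex where "C = fact (n + 2 * k - 2) / fact (2 * k)"
  define w :: "nat \<Rightarrow> complex" where "w m = C / fact (n + m - 2)" for m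
  define u where "u = on_one (cmap (gauss n w) (tauY n ^ (2 * k)))"
  \<comment> \<open>Since \<open>n + m \<ge> 2\<close>, the subtraction inside the factorial does
    not truncate.\<close>
  have w: "w m = (of_nat n + of_nat m) * (of_nat n + of_nat m - 1) * w (m + 2)" for m
  proof -
    have "2 \<le> n + m" using assms(1) by simp
    then obtain j where "n + m = 2 + j" using le_Suc_ex by blast
    then have j: "n + m = Suc (Suc j)" by simp
    have "n + (m + 2) - 2 = Suc (Suc j)" "n + m - 2 = j" using j by simp_all
    then have "w (m + 2) = C / (of_nat (Suc (Suc j)) * of_nat (Suc j) * fact j)" "w m = C / fact j"
      unfolding w_def by (simp_all add: mult.assoc del: of_nat_Suc)
    moreover have s: "(of_nat n + of_nat m :: complex) = of_nat (Suc (Suc j))"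
      unfolding of_nat_add[symmetric] j ..
    moreover have "(of_nat n + of_nat m - 1 :: complex) = of_nat (Suc j)"
      unfolding s by simp
    moreover have "c / f = a * b * (c / (a * b * f))" if "a \<noteq> 0" "b \<noteq> 0" for a b c f :: complex
      using that by simp
    ultimately show ?thesis
      by (simp only: of_nat_neq_0 not_False_eq_True)
  qed
  have u_word_span: "u \<in> word_span (cur_letters n {..<0})"
    unfolding u_def by (intro on_one_neg_word_span cmap_word_span additive_gauss tauY_neg_word_span)
  have u_aff_letters: "u \<in> word_span (aff_letters n)"
    unfolding u_def by (intro on_one_word_span cmap_word_span additive_gauss tauY_power_word_span)
  have act: "letter (Cur x a) * u \<in> vac_ideal n"
    if x: "x \<in> so n" and v: "on_one (cmap (gauss n w) (current n (cmat (\<lambda>i j. x $$ (i, j))) a * tauY n ^ (2 * k))) \<in> vac_ideal n" for x a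
  proof -
    have "on_one (cmap (gauss n w) (gletter (SC x a) * tauY n ^ (2 * k) - current n (cmat (\<lambda>i j. x $$ (i, j))) a * tauY n ^ (2 * k))) \<in> vac_ideal n"
      using gletter_expansion[OF x tauY_power_word_span, of a "2 * k"] cfunctional_gauss
      by (simp add: vnull_def cmat_def[abs_def])
    from vac_add[OF this v] have "on_one (cmap (gauss n w) (gletter (SC x a) * tauY n ^ (2 * k))) \<in> vac_ideal n"
      by (simp add: cmap_diff additive_gauss on_one_simps)
    then show ?thesis
      by (simp add: cmap_gletter additive_gauss letter_def[symmetric] on_one_Some u_def)
  qed
  have u0: "letter (Cur x 0) * u \<in> vac_ideal n" if "x \<in> so n" for x
    by (rule act[OF that current0_vac[OF so_skew[OF that]]])
  have u1: "letter (Cur x 1) * u \<in> vac_ideal n" if "x \<in> so n" for x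
  proof -
    have "2 * k = Suc (2 * k - 1)" using assms(2) by simp
    then show ?thesis
      using act[OF that, of 1] current1_vac[OF so_skew[OF that] w, of "2 * k - 1"] by (simp only:)
  qed
  have "letter (Cur x a) * u \<in> vac_ideal n" if "x \<in> so n" "0 \<le> a" for x a
    using vac_Cur_all[OF assms(1) u_aff_letters u0 u1 that(1), of "nat a"] that(2) by simp
  then have "U_class n u \<in> FF_centre n"
    by (rule U_class_FF[OF u_word_span])
  moreover have "u = symmetrise (at_minus_one (\<Phi> n (2 * k)))
           + (\<Sum>r | 1 \<le> r \<and> r < k. scal (R k r) (symm_tau (2 * r) (\<Phi> n (2 * k - 2 * r))))"
  proof -
    let ?h = "\<lambda>m. scal (of_nat (2 * k choose m) * (w m * fact m)) (symm_tau (2 * k - m) (\<Phi> n m))"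
    have Phi0: "\<Phi> n 0 = 1"
      by (simp add: \<Phi>_def)
    \<comment> \<open>This term is a power of the translation applied to 1; it accounts for the
      absence of a summand with \<open>r = k\<close>.\<close>
    have zero: "?h 0 = 0"
    proof -
      have "on_one (symmetrise (Poly_Mapping.single (mset (replicate (2 * k) None)) 1)) = 0"
      proof -
        have r: "map (\<lambda>i. replicate N None ! \<sigma> i) [0..<N] = replicate N None" if "\<sigma> permutes {..<N}" for \<sigma> N
          using that permutes_in_image[of \<sigma> "{..<N}"] by (intro nth_equalityI) auto
        have "word_on_one (replicate (Suc N) None) = 0" for N
          by (induction N) (simp_all add: tau_der_simps)
        then have z: "word_on_one (replicate (2 * k) None) = 0"
          using assms(2) by (metis Suc_pred' mult_pos_pos not_gr0 not_numeral_le_zero zero_less_numeral)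
        show ?thesis
          unfolding symmetrise_single symm_list_def on_one_simps length_replicate
          by (simp add: r on_one_Word z)
      qed
      moreover have "(var None :: aff option symalg) ^ N = Poly_Mapping.single (mset (replicate N None)) 1" for N
        by (induction N) (simp_all add: var_def mult_single)
      ultimately have "symm_tau (2 * k) 1 = 0"
        by (simp add: symm_tau_def at_minus_one_def rename_one)
      then show ?thesis by (simp add: Phi0)
    qed
    have coeff: "of_nat (2 * k choose (2 * k - 2 * r)) * (w (2 * k - 2 * r) * fact (2 * k - 2 * r))
        = fact (n + 2 * k - 2) / (fact (2 * r) * fact (n + (2 * k - 2 * r) - 2))" if "r < k" for r
    proof -
      have "of_nat (2 * k choose (2 * k - 2 * r)) = (fact (2 * k) / (fact (2 * k - 2 * r) * fact (2 * r)) :: complex)"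
        using binomial_fact[of "2 * k - 2 * r" "2 * k", where 'a = complex] that by simp
      then show ?thesis by (simp add: w_def C_def)
    qed
    have "u = (\<Sum>m\<le>2 * k. ?h m)"
      unfolding u_def by (rule gauss_tauY_power)
    \<comment> \<open>Only the degrees \<open>2 * k - 2 * r\<close> with \<open>r < k\<close>
      survive: odd invariants vanish, and degree 0 is covered by \<open>zero\<close>.\<close>
    also have "\<dots> = (\<Sum>m\<in>(\<lambda>r. 2 * k - 2 * r) ` {..<k}. ?h m)"
    proof (rule sum.mono_neutral_right)
      show "\<forall>m\<in>{..2 * k} - (\<lambda>r. 2 * k - 2 * r) ` {..<k}. ?h m = 0"
      proof
        fix m assume m: "m \<in> {..2 * k} - (\<lambda>r. 2 * k - 2 * r) ` {..<k}"
        show "?h m = 0"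
        proof (cases "odd m")
          case True
          have "symm_tau s 0 = 0" for s
            by (simp add: symm_tau_def at_minus_one_def clinear_map_zero[OF clinear_rename]
                clinear_map_zero[OF clinear_symmetrise] on_one_simps)
          then show ?thesis by (simp add: Phi_odd[OF True])
        next
          case False
          then obtain q where q: "m = 2 * q" by (auto elim: evenE)
          have "q = 0"
          proof (rule ccontr)
            assume "q \<noteq> 0"
            then have "m = 2 * k - 2 * (k - q)" "k - q < k" using m q assms(2) by auto
            then show False using m by blast
          qed
          then show ?thesis using zero q by simp
        qed
      qed
    qed auto
    also have "\<dots> = (\<Sum>r<k. ?h (2 * k - 2 * r))"
      by (rule sum.reindex_cong[where l = "\<lambda>r. 2 * k - 2 * r"]) (auto simp: inj_on_def)
    also have "{..<k} = insert 0 {r. 1 \<le> r \<and> r < k}" using assms(2) by auto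
    also have "(\<Sum>r\<in>insert 0 {r. 1 \<le> r \<and> r < k}. ?h (2 * k - 2 * r))
        = ?h (2 * k) + (\<Sum>r | 1 \<le> r \<and> r < k. ?h (2 * k - 2 * r))"
      by simp
    also have "?h (2 * k) = symmetrise (at_minus_one (\<Phi> n (2 * k)))"
      using coeff[of 0] assms(2) by (simp add: symm_tau_0)
    also have "(\<Sum>r | 1 \<le> r \<and> r < k. ?h (2 * k - 2 * r))
        = (\<Sum>r | 1 \<le> r \<and> r < k. scal (R k r) (symm_tau (2 * r) (\<Phi> n (2 * k - 2 * r))))"
    proof (rule sum.cong[OF refl])
      fix r assume "r \<in> {r. 1 \<le> r \<and> r < k}"
      then have r: "1 \<le> r" "r < k" by simp_all
      have "R k r = of_nat (2 * k choose (2 * k - 2 * r)) * (w (2 * k - 2 * r) * fact (2 * k - 2 * r))"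
        unfolding coeff[OF r(2)] R[OF r] by (rule coefficient_eq) (use assms(1) r in simp_all)
      moreover have "2 * k - (2 * k - 2 * r) = 2 * r" using r by simp
      ultimately show "?h (2 * k - 2 * r) = scal (R k r) (symm_tau (2 * r) (\<Phi> n (2 * k - 2 * r)))"
        by simp
    qed
    finally show ?thesis .
  qed
  ultimately show ?thesis by simp
qed

end
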